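(* Let $W \in \mathbb{Z}^{m \times n}$ be totally unimodular, and let $w \in \mathbb{Z}^m$, $k \le n$, $q \in \mathbb{Z}^k_{>0}$, $h \in \mathbb{Z}^n$. Consider the integer quadratic program $$(\mathcal{IQP}) \qquad \min\ \sum_{i=1}^k - q_i x_i^2 + h^\top x \quad \text{s.t.}\quad Wx \le w,\ x \in \mathbb{Z}^n .$$ For every $\epsilon \in (0,1]$ there is an algorithm that finds an $\epsilon$-approximate solution to $(\mathcal{IQP})$ by solving $$\left(3 + \left\lceil\sqrt{k \left(1 + \frac{1}{\epsilon}\right)}\right\rceil \right)^k$$ linear programs (LPs) of size polynomial in the size of $(\mathcal{IQP})$. Moreover, each LP has at most $n$ variables, at most $m$ linear inequalities and possibly additional variable bounds, and a totally unimodular constraint matrix.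
   Context: A matrix is totally unimodular if all its subdeterminants (determinants of square submatrices) are in $\{0,1,-1\}$. The size of a problem is the binary encoding length of its data. $\epsilon$-approximate solution: consider an instance of a minimization problem with objective function $f$ that has an optimal solution $x^*$, and let $f_{\max}$ be the maximum value of $f$ on the feasible region. For $\epsilon \in [0,1]$, a feasible point $x^\diamond$ is an $\epsilon$-approximate solution if $f(x^* ) = f_{\max}$, or if $f(x^* ) < f_{\max}$ and $$\frac{f(x^\diamond) - f(x^* )}{f_{\max} - f(x^* )} \le \epsilon .$$ If $f$ has no upper bound on the feasible region, every feasible point is regarded as an $\epsilon$-approximate solution for every $\epsilon>0$. If the problem is infeasible or unbounded, an $\epsilon$-approximate solution is not defined, and the algorithm is expected to return an indicator that the problem is infeasible or unbounded. *)

theory Defs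
  imports
    Complex_Main
    "HOL-Library.Log_Nat"
    "HOL-Computational_Algebra.Polynomial"
    "Jordan_Normal_Form.Determinant"
    "Jordan_Normal_Form.DL_Submatrix"
begin

section \<open>Totally unimodular matrices\<close>

definition totally_unimodular :: "int mat \<Rightarrow> bool" where
  "totally_unimodular A \<longleftrightarrow>
     (\<forall>I J. I \<subseteq> {..<dim_row A} \<and> J \<subseteq> {..<dim_col A} \<and> card I = card J \<longrightarrow>
            det (submatrix A I J) \<in> {0, 1, -1})"


section \<open>Optimization problems and their solutions\<close>

text \<open>A minimization problem is given by an objective function f and a feasible set F.\<close>

definition optimal :: "('a \<Rightarrow> real) \<Rightarrow> 'a set \<Rightarrow> 'a \<Rightarrow> bool" where
  "optimal f F x \<longleftrightarrow> x \<in> F \<and> (\<forall>y\<in>F. f x \<le> f y)"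

definition approx_solution :: "real \<Rightarrow> ('a \<Rightarrow> real) \<Rightarrow> 'a set \<Rightarrow> 'a \<Rightarrow> bool" where
  "approx_solution \<epsilon> f F x \<longleftrightarrow>
     x \<in> F \<and>
     (\<exists>xs. optimal f F xs \<and>
        (bdd_above (f ` F) \<longrightarrow>
           (let fmax = Sup (f ` F) in
              f xs = fmax \<or>
              f xs < fmax \<and> (f x - f xs) / (fmax - f xs) \<le> \<epsilon>)))"

datatype 'a outcome = Infeasible | Unbounded | Solution 'a

fun correct_outcome ::
  "(('a \<Rightarrow> real) \<Rightarrow> 'a set \<Rightarrow> 'a \<Rightarrow> bool) \<Rightarrow> ('a \<Rightarrow> real) \<Rightarrow> 'a set \<Rightarrow> 'a outcome \<Rightarrow> bool"
where
  "correct_outcome good f F Infeasible \<longleftrightarrow> F = {}"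
| "correct_outcome good f F Unbounded \<longleftrightarrow> F \<noteq> {} \<and> \<not> bdd_below (f ` F)"
| "correct_outcome good f F (Solution x) \<longleftrightarrow> good f F x"


section \<open>Encodings and sizes\<close>

text \<open>Problem data and answers are encoded as lists of integers. The size of an integer z is
  1 + \<lceil>log 2 (\<bar>z\<bar> + 1)\<rceil>, the leading 1 accounting for the sign.\<close>

definition int_size :: "int \<Rightarrow> nat" where
  "int_size z = 1 + nat (bitlen \<bar>z\<bar>)"

definition code_size :: "int list \<Rightarrow> nat" where
  "code_size zs = sum_list (map int_size zs)"

definition mat_code :: "int mat \<Rightarrow> int list" where
  "mat_code A = concat (mat_to_list A)"

fun bound_code :: "int option \<Rightarrow> int list" where
  "bound_code None = [0, 0]"
| "bound_code (Some z) = [1, z]"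

definition rat_code :: "rat \<Rightarrow> int list" where
  "rat_code r = [fst (quotient_of r), snd (quotient_of r)]"

fun outcome_code :: "('a \<Rightarrow> int list) \<Rightarrow> 'a vec outcome \<Rightarrow> int list" where
  "outcome_code code (Solution x) = 0 # concat (map code (list_of_vec x))"
| "outcome_code code Infeasible = [1]"
| "outcome_code code Unbounded = [2]"


section \<open>Linear programs\<close>

text \<open>Minimize c x subject to the linear inequalities A x \<le> b and to the individual variable
  bounds lo and up, where \<^const>\<open>None\<close> stands for an absent bound.\<close>

record lp =
  lp_A :: "int mat"
  lp_b :: "int vec"
  lp_c :: "int vec"
  lp_lo :: "int option vec"
  lp_up :: "int option vec"

definition lp_vars :: "lp \<Rightarrow> nat" where
  "lp_vars P = dim_col (lp_A P)"

definition lp_ineqs :: "lp \<Rightarrow> nat" where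
  "lp_ineqs P = dim_row (lp_A P)"

definition wf_lp :: "lp \<Rightarrow> bool" where
  "wf_lp P \<longleftrightarrow>
     lp_b P \<in> carrier_vec (lp_ineqs P) \<and>
     lp_c P \<in> carrier_vec (lp_vars P) \<and>
     lp_lo P \<in> carrier_vec (lp_vars P) \<and>
     lp_up P \<in> carrier_vec (lp_vars P)"

definition lp_feasible :: "lp \<Rightarrow> real vec set" where
  "lp_feasible P =
     {x \<in> carrier_vec (lp_vars P).
        map_mat real_of_int (lp_A P) *\<^sub>v x \<le> map_vec real_of_int (lp_b P) \<and>
        (\<forall>j<lp_vars P.
           (\<forall>l. lp_lo P $ j = Some l \<longrightarrow> real_of_int l \<le> x $ j) \<and>
           (\<forall>u. lp_up P $ j = Some u \<longrightarrow> x $ j \<le> real_of_int u))}"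

definition lp_objective :: "lp \<Rightarrow> real vec \<Rightarrow> real" where
  "lp_objective P x = map_vec real_of_int (lp_c P) \<bullet> x"

definition lp_code :: "lp \<Rightarrow> int list" where
  "lp_code P =
     [int (lp_vars P), int (lp_ineqs P)]
     @ list_of_vec (lp_c P) @ mat_code (lp_A P) @ list_of_vec (lp_b P)
     @ concat (map bound_code (list_of_vec (lp_lo P)))
     @ concat (map bound_code (list_of_vec (lp_up P)))"

text \<open>An LP solver may return any optimal solution, not necessarily a vertex or an integral point.
  Since the data are integral, a rational optimal solution exists whenever an optimal one does.\<close>

type_synonym lp_oracle = "lp \<Rightarrow> rat vec outcome"

definition lp_solver :: "lp_oracle \<Rightarrow> bool" where
  "lp_solver solve \<longleftrightarrow>
     (\<forall>P. wf_lp P \<longrightarrow>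
        correct_outcome optimal (lp_objective P) (lp_feasible P)
          (map_outcome (map_vec real_of_rat) (solve P)))"


section \<open>The integer quadratic program\<close>

record iqp =
  iqp_W :: "int mat"
  iqp_w :: "int vec"
  iqp_q :: "int vec"
  iqp_h :: "int vec"

definition iqp_vars :: "iqp \<Rightarrow> nat" where
  "iqp_vars I = dim_col (iqp_W I)"

definition iqp_ineqs :: "iqp \<Rightarrow> nat" where
  "iqp_ineqs I = dim_row (iqp_W I)"

definition iqp_k :: "iqp \<Rightarrow> nat" where
  "iqp_k I = dim_vec (iqp_q I)"

definition tu_iqp :: "iqp \<Rightarrow> bool" where
  "tu_iqp I \<longleftrightarrow>
     totally_unimodular (iqp_W I) \<and>
     iqp_w I \<in> carrier_vec (iqp_ineqs I) \<and>
     iqp_h I \<in> carrier_vec (iqp_vars I) \<and>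
     iqp_k I \<le> iqp_vars I \<and>
     (\<forall>i<iqp_k I. iqp_q I $ i > 0)"

definition iqp_feasible :: "iqp \<Rightarrow> int vec set" where
  "iqp_feasible I = {x \<in> carrier_vec (iqp_vars I). iqp_W I *\<^sub>v x \<le> iqp_w I}"

definition iqp_objective :: "iqp \<Rightarrow> int vec \<Rightarrow> real" where
  "iqp_objective I x =
     real_of_int ((\<Sum>i<iqp_k I. - (iqp_q I $ i) * (x $ i)\<^sup>2) + iqp_h I \<bullet> x)"

definition iqp_code :: "iqp \<Rightarrow> int list" where
  "iqp_code I =
     [int (iqp_vars I), int (iqp_ineqs I), int (iqp_k I)]
     @ list_of_vec (iqp_q I) @ list_of_vec (iqp_h I)
     @ mat_code (iqp_W I) @ list_of_vec (iqp_w I)"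

definition iqp_size :: "iqp \<Rightarrow> nat" where
  "iqp_size I = code_size (iqp_code I)"

definition lp_count :: "nat \<Rightarrow> real \<Rightarrow> nat" where
  "lp_count k \<epsilon> = (3 + nat \<lceil>sqrt (real k * (1 + 1 / \<epsilon>))\<rceil>) ^ k"


section \<open>Algorithms that solve linear programs\<close>

text \<open>
  Algorithms are finite programs for a random access machine with integer cells, addressed by
  integers, indirect addressing and logarithmic cost: every evaluated subexpression costs the size of its value
  (this covers addresses, too). Hence polynomially bounded cost is polynomial time in the usual
  sense. Two additions:

  \<^item> Solving an LP is an instruction. It reads the encoding of a linear program from memory, and
    writes the encoding of the solver's answer to memory. If there is no encoding of a linear
    program at the given address, there is no execution.

  \<^item> The accuracy is an arbitrary real number, which has no finite encoding. A program can use it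
    only by comparing it with rational numbers, through \<open>Cut\<close>, which decides a \<le> b * \<epsilon> for
    integers a and b.
\<close>

datatype expr =
    Const int
  | Cell expr
  | Add expr expr
  | Sub expr expr
  | Mul expr expr
  | Quot expr expr
  | Cut expr expr

datatype cmd =
    Assign expr expr
  | Seq cmd cmd
  | IfPos expr cmd cmd
  | WhilePos expr cmd
  | SolveLP expr expr

type_synonym memory = "int \<Rightarrow> int"

fun eval :: "real \<Rightarrow> memory \<Rightarrow> expr \<Rightarrow> int" where
  "eval \<epsilon> s (Const z) = z"
| "eval \<epsilon> s (Cell a) = s (eval \<epsilon> s a)"
| "eval \<epsilon> s (Add a b) = eval \<epsilon> s a + eval \<epsilon> s b"
| "eval \<epsilon> s (Sub a b) = eval \<epsilon> s a - eval \<epsilon> s b"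
| "eval \<epsilon> s (Mul a b) = eval \<epsilon> s a * eval \<epsilon> s b"
| "eval \<epsilon> s (Quot a b) = eval \<epsilon> s a div eval \<epsilon> s b"
| "eval \<epsilon> s (Cut a b) =
     (if real_of_int (eval \<epsilon> s a) \<le> real_of_int (eval \<epsilon> s b) * \<epsilon> then 1 else 0)"

fun subexprs_cost :: "real \<Rightarrow> memory \<Rightarrow> expr \<Rightarrow> nat"
  and cost :: "real \<Rightarrow> memory \<Rightarrow> expr \<Rightarrow> nat" where
  "subexprs_cost \<epsilon> s (Const z) = 0"
| "subexprs_cost \<epsilon> s (Cell a) = cost \<epsilon> s a"
| "subexprs_cost \<epsilon> s (Add a b) = cost \<epsilon> s a + cost \<epsilon> s b"
| "subexprs_cost \<epsilon> s (Sub a b) = cost \<epsilon> s a + cost \<epsilon> s b"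
| "subexprs_cost \<epsilon> s (Mul a b) = cost \<epsilon> s a + cost \<epsilon> s b"
| "subexprs_cost \<epsilon> s (Quot a b) = cost \<epsilon> s a + cost \<epsilon> s b"
| "subexprs_cost \<epsilon> s (Cut a b) = cost \<epsilon> s a + cost \<epsilon> s b"
| "cost \<epsilon> s e = int_size (eval \<epsilon> s e) + subexprs_cost \<epsilon> s e"

definition holds_at :: "memory \<Rightarrow> int \<Rightarrow> int list \<Rightarrow> bool" where
  "holds_at s a zs \<longleftrightarrow> (\<forall>i<length zs. s (a + int i) = zs ! i)"

definition store :: "memory \<Rightarrow> int \<Rightarrow> int list \<Rightarrow> memory" where
  "store s a zs = (\<lambda>i. if a \<le> i \<and> i < a + int (length zs) then zs ! nat (i - a) else s i)"

text \<open>\<open>exec solve \<epsilon> c s t Ps s'\<close>: started in memory s, the program c halts in memory s', at cost t,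
  and Ps is the list of the linear programs it has solved.\<close>

inductive exec ::
  "lp_oracle \<Rightarrow> real \<Rightarrow> cmd \<Rightarrow> memory \<Rightarrow> nat \<Rightarrow> lp list \<Rightarrow> memory \<Rightarrow> bool"
  for solve :: lp_oracle and \<epsilon> :: real
where
  Assign:
    "exec solve \<epsilon> (Assign a e) s (cost \<epsilon> s a + cost \<epsilon> s e) []
       (s(eval \<epsilon> s a := eval \<epsilon> s e))"
| Seq:
    "exec solve \<epsilon> c s t Ps s' \<Longrightarrow> exec solve \<epsilon> d s' t' Ps' s'' \<Longrightarrow>
     exec solve \<epsilon> (Seq c d) s (t + t') (Ps @ Ps') s''"
| IfTrue:
    "eval \<epsilon> s e > 0 \<Longrightarrow> exec solve \<epsilon> c s t Ps s' \<Longrightarrow>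
     exec solve \<epsilon> (IfPos e c d) s (cost \<epsilon> s e + t) Ps s'"
| IfFalse:
    "eval \<epsilon> s e \<le> 0 \<Longrightarrow> exec solve \<epsilon> d s t Ps s' \<Longrightarrow>
     exec solve \<epsilon> (IfPos e c d) s (cost \<epsilon> s e + t) Ps s'"
| WhileTrue:
    "eval \<epsilon> s e > 0 \<Longrightarrow> exec solve \<epsilon> c s t Ps s' \<Longrightarrow>
     exec solve \<epsilon> (WhilePos e c) s' t' Ps' s'' \<Longrightarrow>
     exec solve \<epsilon> (WhilePos e c) s (cost \<epsilon> s e + t + t') (Ps @ Ps') s''"
| WhileFalse:
    "eval \<epsilon> s e \<le> 0 \<Longrightarrow>
     exec solve \<epsilon> (WhilePos e c) s (cost \<epsilon> s e) [] s"
| SolveLP: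
    "wf_lp P \<Longrightarrow> holds_at s (eval \<epsilon> s a) (lp_code P) \<Longrightarrow>
     ans = outcome_code rat_code (solve P) \<Longrightarrow>
     exec solve \<epsilon> (SolveLP a d) s
       (cost \<epsilon> s a + cost \<epsilon> s d + code_size (lp_code P) + code_size ans) [P]
       (store s (eval \<epsilon> s d) ans)"


section \<open>Executions are unique\<close>

text \<open>The encoding of a linear program is prefix-free, so that the linear program that
  \<open>SolveLP\<close> finds at an address is unique. Hence to say that an execution with certain properties
  exists is to say that the program halts and its only execution has these properties.\<close>

lemma holds_at_append:
  "holds_at s a (xs @ ys) \<longleftrightarrow> holds_at s a xs \<and> holds_at s (a + int (length xs)) ys"
proof -
  have "holds_at s (a + int (length xs)) ys" if h: "holds_at s a (xs @ ys)"
    unfolding holds_at_def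
  proof (intro allI impI)
    fix i assume "i < length ys"
    then show "s (a + int (length xs) + int i) = ys ! i"
      using h[unfolded holds_at_def, rule_format, of "length xs + i"] by (simp add: nth_append add.assoc)
  qed
  moreover have "holds_at s a xs" if h: "holds_at s a (xs @ ys)"
    using h by (force simp: holds_at_def nth_append)
  moreover have "holds_at s a (xs @ ys)" if h: "holds_at s a xs" "holds_at s (a + int (length xs)) ys"
    unfolding holds_at_def
  proof (intro allI impI)
    fix i assume i: "i < length (xs @ ys)"
    show "s (a + int i) = (xs @ ys) ! i"
      using h(1)[unfolded holds_at_def, rule_format, of i]
        h(2)[unfolded holds_at_def, rule_format, of "i - length xs"] i
      by (cases "i < length xs") (auto simp: nth_append)
  qed
  ultimately show ?thesis by blast
qed

lemma holds_at_unique: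
  "holds_at s a xs \<Longrightarrow> holds_at s a ys \<Longrightarrow> length xs = length ys \<Longrightarrow> xs = ys"
  by (rule nth_equalityI) (auto simp: holds_at_def)

lemma bound_code_inj:
  "concat (map bound_code xs) = concat (map bound_code ys) \<Longrightarrow> xs = ys"
proof (induction xs arbitrary: ys)
  case Nil then show ?case by (cases ys; cases "hd ys") auto
next
  case (Cons x xs) then show ?case by (cases ys; cases x; cases "hd ys") auto
qed

lemma length_bounds: "length (concat (map bound_code xs)) = 2 * length xs"
proof (induction xs)
  case (Cons x xs) then show ?case by (cases x) auto
qed simp

lemma mat_code_length: "length (mat_code A) = dim_row A * dim_col A"
proof -
  have "length (concat (map (\<lambda>i. map (\<lambda>j. A $$ (i,j)) [0..<dim_col A]) xs)) = length xs * dim_col A" for xs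
    by (induction xs) auto
  then show ?thesis unfolding mat_code_def mat_to_list_def by simp
qed

lemma mat_code_inj:
  assumes "mat_code A = mat_code B" "dim_row A = dim_row B" "dim_col A = dim_col B"
  shows "A = B"
proof -
  have eq: "mat_to_list A = mat_to_list B"
    by (rule concat_injective[OF assms(1)[unfolded mat_code_def]])
       (auto simp: mat_to_list_def assms set_zip)
  show ?thesis
  proof (rule eq_matI)
    fix i j assume i: "i < dim_row B" "j < dim_col B"
    have "mat_to_list A ! i ! j = mat_to_list B ! i ! j" using eq by simp
    then show "A $$ (i,j) = B $$ (i,j)" using i assms by (simp add: mat_to_list_def)
  qed (use assms in auto)
qed

lemma list_of_vec_inj: "list_of_vec v = list_of_vec w \<Longrightarrow> v = w"
  by (metis vec_list)

lemma app_eqD: "xs @ us = ys @ vs \<Longrightarrow> length xs = length ys \<Longrightarrow> xs = ys \<and> us = vs"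
  by simp

lemma lp_code_unique:
  assumes "wf_lp P" "wf_lp Q" "holds_at s a (lp_code P)" "holds_at s a (lp_code Q)"
  shows "P = Q"
proof -
  have d: "lp_vars P = lp_vars Q" "lp_ineqs P = lp_ineqs Q"
  proof -
    have *: "s a = int (lp_vars R)" "s (a + 1) = int (lp_ineqs R)" if "holds_at s a (lp_code R)" for R
      using that[unfolded holds_at_def, rule_format, of 0] that[unfolded holds_at_def, rule_format, of 1]
      unfolding lp_code_def by auto
    from *[OF assms(3)] *[OF assms(4)]
    show "lp_vars P = lp_vars Q" "lp_ineqs P = lp_ineqs Q" by auto
  qed
  have dims: "dim_row (lp_A P) = lp_ineqs P" "dim_col (lp_A P) = lp_vars P"
      "dim_row (lp_A Q) = lp_ineqs Q" "dim_col (lp_A Q) = lp_vars Q"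
    by (auto simp: lp_vars_def lp_ineqs_def)
  have vs: "dim_vec (lp_c P) = dim_vec (lp_c Q)" "dim_vec (lp_b P) = dim_vec (lp_b Q)"
     "dim_vec (lp_lo P) = dim_vec (lp_lo Q)" "dim_vec (lp_up P) = dim_vec (lp_up Q)"
    using assms(1,2) d unfolding wf_lp_def by (metis carrier_vecD)+
  have ms: "dim_row (lp_A P) = dim_row (lp_A Q)" "dim_col (lp_A P) = dim_col (lp_A Q)"
    by (metis dims d)+
  have len: "length (lp_code P) = length (lp_code Q)"
    unfolding lp_code_def length_append length_bounds mat_code_length by (simp add: vs ms)
  have eq: "lp_code P = lp_code Q" using holds_at_unique[OF assms(3,4) len] .
  have l: "length (list_of_vec (lp_c P)) = length (list_of_vec (lp_c Q))"
    "length (mat_code (lp_A P)) = length (mat_code (lp_A Q))"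
    "length (list_of_vec (lp_b P)) = length (list_of_vec (lp_b Q))"
    "length (concat (map bound_code (list_of_vec (lp_lo P)))) = length (concat (map bound_code (list_of_vec (lp_lo Q))))"
    unfolding length_bounds mat_code_length by (simp_all add: vs ms)
  have e1: "list_of_vec (lp_c P) @ mat_code (lp_A P) @ list_of_vec (lp_b P)
     @ concat (map bound_code (list_of_vec (lp_lo P))) @ concat (map bound_code (list_of_vec (lp_up P)))
     = list_of_vec (lp_c Q) @ mat_code (lp_A Q) @ list_of_vec (lp_b Q)
     @ concat (map bound_code (list_of_vec (lp_lo Q))) @ concat (map bound_code (list_of_vec (lp_up Q)))"
    using eq unfolding lp_code_def d by (simp only: append_Cons append_Nil list.inject)
  note f1 = app_eqD[OF e1 l(1)]
  note f2 = app_eqD[OF conjunct2[OF f1] l(2)]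
  note f3 = app_eqD[OF conjunct2[OF f2] l(3)]
  note f4 = app_eqD[OF conjunct2[OF f3] l(4)]
  have "lp_A P = lp_A Q"
    by (rule mat_code_inj[OF conjunct1[OF f2]], fact, fact)
  moreover note list_of_vec_inj[OF conjunct1[OF f1]] list_of_vec_inj[OF conjunct1[OF f3]]
    list_of_vec_inj[OF bound_code_inj[OF conjunct1[OF f4]]]
    list_of_vec_inj[OF bound_code_inj[OF conjunct2[OF f4]]]
  ultimately have "P = Q" by (intro lp.equality) simp_all
  then show ?thesis .
qed

lemma exec_deterministic:
  "exec solve \<epsilon> c s t Ps s' \<Longrightarrow> exec solve \<epsilon> c s u Qs s'' \<Longrightarrow> t = u \<and> Ps = Qs \<and> s' = s''"
proof (induction arbitrary: u Qs s'' rule: exec.induct)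
  case (Assign a e s) from Assign.prems show ?case by cases auto
next
  case (Seq c s t Ps s' d t' Ps' s'') from Seq.prems show ?case by cases (use Seq.IH in blast)
next
  case (IfTrue s e c t Ps s' d) from IfTrue.prems show ?case
  proof cases
    case (IfTrue t) with IfTrue.IH show ?thesis by blast
  qed (use IfTrue.hyps in simp)
next
  case (IfFalse s e d t Ps s' c) from IfFalse.prems show ?case
  proof cases
    case (IfFalse t) with IfFalse.IH show ?thesis by blast
  qed (use IfFalse.hyps in simp)
next
  case (WhileTrue s e c t Ps s' t' Ps' s'') from WhileTrue.prems show ?case
  proof cases
    case (WhileTrue) with WhileTrue.IH show ?thesis by blast
  qed (use WhileTrue.hyps in simp)
next
  case (WhileFalse s e c) from WhileFalse.prems show ?case by cases (use WhileFalse in simp_all)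
next
  case (SolveLP P s a ans d) from SolveLP.prems show ?case
  proof cases
    case (SolveLP Q ans')
    have "P = Q" by (rule lp_code_unique[OF \<open>wf_lp P\<close> \<open>wf_lp Q\<close> SolveLP.hyps(2) SolveLP(5)])
    then show ?thesis using SolveLP SolveLP.hyps by simp
  qed
qed

end

theory Submission
  imports Defs
begin

text \<open>For a totally unimodular W, Cramer's rule gives kernel vectors with entries in {0, 1, -1}. Moving
  along them rounds a real x to an integral y such that y and W y lie between the rounded down and
  rounded up entries of x and W x, and a given linear functional does not increase. Rounding x / N for
  a far point x splits off a ray with entries in {0, 1, -1}. Hence either all rays vanish on the
  quadratic variables and do not decrease the objective, and a minimum is attained in the box of
  radius \<beta>, the sum of the absolute values of the right-hand sides, or else the problem is infeasible
  or unbounded.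

  The solver may return any optimal point. If the cost vector c is replaced by M^n c + (M^j), with M
  exceeding the widths of the variable bounds, then distinct integral points have distinct values.
  Rounding shows that the only optimal point is then integral, and it is optimal for c, too.

  Minimizing and maximizing each quadratic variable in a large box takes 2k linear programs and
  yields its range, of width D_i, or a proof of unboundedness. Each range is cut into
  g = \<lceil>sqrt (k (1 + 1/\<epsilon>))\<rceil> parts. On each of the g^k pieces the concave objective is replaced by
  its chords, with an error of at most the sum of q_i (D_i div g)^2 / 4. Rounding the midpoint of two feasible
  points at distance D_i gives a feasible point whose value exceeds the minimum by at least
  q_i (D_i^2 - 1) / 4, and the choice of g makes the error at most \<epsilon> times the gap. Finally
  2k + g^k \<le> (3 + g)^k.\<close>

section \<open>Totally unimodular matrices\<close>

text \<open>For k = 0 the budget is one LP, so feasibility and boundedness cannot be tested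
  separately: the 2k + g^k programs must settle them as well. The box radius \<open>B\<close> is
  therefore large enough for unboundedness to show inside the box: either the range of a quadratic
  variable leaves [-\<beta>, \<beta>], or the best value found falls below -T, which no feasible
  point attains in the bounded case. The LPs may change the given system only through variable
  bounds, and their sizes may not grow with 1/\<epsilon>; hence a tilted cost vector and not extra
  rows forces integrality, and pieces are cut off at the range. The factor k in the grid size is
  there because the error is a sum over k variables, each allowed \<epsilon>/k of the gap; the 1 in
  1 + 1/\<epsilon> pays for rounding the midpoint. On integers the error of a range narrower than 2g
  vanishes altogether, so only wide ranges need an estimate.\<close>

definition selection :: "(nat \<Rightarrow> nat \<Rightarrow> 'a) \<Rightarrow> nat \<Rightarrow> (nat \<Rightarrow> nat) \<Rightarrow> (nat \<Rightarrow> nat) \<Rightarrow> 'a mat" where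
  "selection a r \<rho> \<gamma> = mat r r (\<lambda>(i,j). a (\<rho> i) (\<gamma> j))"

lemma selection_carrier [simp]: "selection a r \<rho> \<gamma> \<in> carrier_mat r r"
  by (simp add: selection_def)

lemma det_selection_inj:
  fixes a :: "nat \<Rightarrow> nat \<Rightarrow> 'a :: idom"
  assumes "det (selection a r \<rho> \<gamma>) \<noteq> 0"
  shows "inj_on \<rho> {..<r}" "inj_on \<gamma> {..<r}"
proof -
  show "inj_on \<rho> {..<r}"
  proof (rule inj_onI, rule ccontr)
    fix x y assume xy: "x \<in> {..<r}" "y \<in> {..<r}" "\<rho> x = \<rho> y" "x \<noteq> y"
    have "row (selection a r \<rho> \<gamma>) x = row (selection a r \<rho> \<gamma>) y"
      using xy by (intro eq_vecI) (auto simp: selection_def)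
    then show False
      using det_identical_rows[OF selection_carrier, of x y r a \<rho> \<gamma>] xy assms by auto
  qed
  show "inj_on \<gamma> {..<r}"
  proof (rule inj_onI, rule ccontr)
    fix x y assume xy: "x \<in> {..<r}" "y \<in> {..<r}" "\<gamma> x = \<gamma> y" "x \<noteq> y"
    have "col (selection a r \<rho> \<gamma>) x = col (selection a r \<rho> \<gamma>) y"
      using xy by (intro eq_vecI) (auto simp: selection_def)
    then show False
      using det_identical_columns[OF selection_carrier, of x y r a \<rho> \<gamma>] xy assms by auto
  qed
qed

text \<open>\<open>submatrix\<close> lists its indices in increasing order; p sends a position to
  the rank of its index, the position that \<open>submatrix\<close> gives it.\<close>

lemma rank_permutation:
  fixes \<rho> :: "nat \<Rightarrow> nat"
  assumes inj: "inj_on \<rho> {..<r}"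
  shows "\<exists>p. p permutes {0..<r} \<and> (\<forall>i<r. p i = card {x \<in> \<rho> ` {..<r}. x < \<rho> i})"
proof -
  define p where "p i = (if i < r then card {x \<in> \<rho> ` {..<r}. x < \<rho> i} else i)" for i
  have bnd: "p i < r" if "i < r" for i
  proof -
    have "\<rho> i \<in> \<rho> ` {..<r} - {x \<in> \<rho> ` {..<r}. x < \<rho> i}" using that by auto
    then have "{x \<in> \<rho> ` {..<r}. x < \<rho> i} \<subset> \<rho> ` {..<r}" by blast
    then have "card {x \<in> \<rho> ` {..<r}. x < \<rho> i} < card (\<rho> ` {..<r})" by (simp add: psubset_card_mono)
    then show ?thesis using that inj by (simp add: p_def card_image)
  qed
  have "inj_on p {0..<r}"
  proof (rule inj_onI)
    fix x y assume xy: "x \<in> {0..<r}" "y \<in> {0..<r}" "p x = p y"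
    have "pick (\<rho> ` {..<r}) (p z) = \<rho> z" if "z < r" for z
      using that pick_card_in_set[of "\<rho> z" "\<rho> ` {..<r}"] by (simp add: p_def)
    from this[of x] this[of y] have "\<rho> x = \<rho> y" using xy by simp
    then show "x = y" using inj_onD[OF inj, of x y] xy(1,2) by simp
  qed
  moreover have "p ` {0..<r} \<subseteq> {0..<r}" using bnd by auto
  ultimately have "bij_betw p {0..<r} {0..<r}"
    by (simp add: bij_betw_def endo_inj_surj)
  then have "p permutes {0..<r}" by (rule bij_imp_permutes) (auto simp: p_def)
  then show ?thesis by (auto simp: p_def)
qed

text \<open>A nonsingular selection repeats no row or column, so it is a submatrix with rows and
  columns permuted, which changes the determinant at most in sign. Index functions instead of index
  sets make it easy to border a selection by a row and a column.\<close>

lemma totally_unimodular_selection: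
  assumes tu: "totally_unimodular A"
    and \<rho>: "\<And>i. i < r \<Longrightarrow> \<rho> i < dim_row A" and \<gamma>: "\<And>i. i < r \<Longrightarrow> \<gamma> i < dim_col A"
  shows "det (selection (\<lambda>i j. A $$ (i,j)) r \<rho> \<gamma>) \<in> {0, 1, -1}"
proof (cases "det (selection (\<lambda>i j. A $$ (i,j)) r \<rho> \<gamma>) = 0")
  case False
  note inj = det_selection_inj[OF False]
  obtain p where p: "p permutes {0..<r}" "\<And>i. i < r \<Longrightarrow> p i = card {x \<in> \<rho> ` {..<r}. x < \<rho> i}"
    using rank_permutation[OF inj(1)] by blast
  obtain p' where p': "p' permutes {0..<r}" "\<And>i. i < r \<Longrightarrow> p' i = card {x \<in> \<gamma> ` {..<r}. x < \<gamma> i}"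
    using rank_permutation[OF inj(2)] by blast
  define I where "I = \<rho> ` {..<r}"
  define J where "J = \<gamma> ` {..<r}"
  define S where "S = submatrix A I J"
  have IJ: "I \<subseteq> {..<dim_row A}" "J \<subseteq> {..<dim_col A}" "card I = r" "card J = r"
    using \<rho> \<gamma> inj by (auto simp: I_def J_def card_image)
  have sets: "{i. i < dim_row A \<and> i \<in> I} = I" "{i. i < dim_col A \<and> i \<in> J} = J" using IJ by auto
  have S: "S \<in> carrier_mat r r" unfolding S_def submatrix_def using IJ by (simp add: sets)
  have dS: "det S \<in> {0, 1, -1}"
    using tu IJ unfolding totally_unimodular_def S_def by auto
  have ent: "A $$ (\<rho> i, \<gamma> j) = S $$ (p i, p' j)" if "i < r" "j < r" for i j
    using submatrix_index_card[of "\<rho> i" A "\<gamma> j" I J] \<rho> \<gamma> that p(2) p'(2) unfolding S_def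
    by (auto simp: I_def J_def)
  define S1 where "S1 = mat r r (\<lambda>(i,j). S $$ (p i, j))"
  define S2 where "S2 = mat r r (\<lambda>(i,j). S1\<^sup>T $$ (p' i, j))"
  have p'lt: "p' i < r" if "i < r" for i using p'(1) that permutes_in_image[OF p'(1), of i] by auto
  have plt: "p i < r" if "i < r" for i using p(1) that permutes_in_image[OF p(1), of i] by auto
  have S1: "S1 \<in> carrier_mat r r" "det S1 = signof p * det S"
    unfolding S1_def using det_permute_rows[OF S p(1)] by auto
  have S2: "S2 \<in> carrier_mat r r" "det S2 = signof p' * det (S1\<^sup>T)"
    unfolding S2_def using det_permute_rows[of "S1\<^sup>T" r p'] S1 p'(1) by auto
  have "selection (\<lambda>i j. A $$ (i,j)) r \<rho> \<gamma> = S2\<^sup>T"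
    by (intro eq_matI) (use S2(1) S1(1) p'lt plt in \<open>auto simp: selection_def ent S2_def S1_def\<close>)
  then have "det (selection (\<lambda>i j. A $$ (i,j)) r \<rho> \<gamma>) = signof p' * (signof p * det S)"
    using S1 S2 by (metis det_transpose)
  then show ?thesis using dS by (auto simp: sign_def)
qed simp

text \<open>A maximal nonsingular selection either exhausts the columns in F, or the cofactors of its
  extension by one further column form a kernel vector.\<close>

lemma selection_dichotomy:
  fixes a :: "nat \<Rightarrow> nat \<Rightarrow> int"
  assumes "finite F"
  shows "(\<exists>d. (\<forall>j. j \<notin> F \<longrightarrow> d j = 0) \<and> (\<exists>j\<in>F. d j \<noteq> (0::int)) \<and> (\<forall>i\<in>R. (\<Sum>j\<in>F. a i j * d j) = 0))
    \<or> (\<exists>r \<rho> \<gamma>. (\<forall>i<r. \<rho> i \<in> R) \<and> bij_betw \<gamma> {..<r} F \<and> det (selection a r \<rho> \<gamma>) \<noteq> 0)"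
proof -
  define good where "good r \<longleftrightarrow> (\<exists>\<rho> \<gamma>. (\<forall>i<r. \<rho> i \<in> R) \<and> (\<forall>i<r. \<gamma> i \<in> F) \<and> det (selection a r \<rho> \<gamma>) \<noteq> 0)" for r
  have good0: "good 0" unfolding good_def selection_def by (simp add: det_dim_zero)
  have bound: "r \<le> card F" if r: "good r" for r
  proof -
    obtain \<gamma> \<rho> where g: "\<forall>i<r. \<gamma> i \<in> F" "det (selection a r \<rho> \<gamma>) \<noteq> 0" using r unfolding good_def by blast
    have "card {..<r} \<le> card F"
      by (rule card_inj_on_le[OF det_selection_inj(2)[OF g(2)]]) (use g assms in auto)
    then show ?thesis by simp
  qed
  obtain r where r: "good r" "\<And>r'. good r' \<Longrightarrow> r' \<le> r"
    using GreatestI_nat[of good 0 "card F"] Greatest_le_nat[of good _ "card F"] good0 bound by blast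
  obtain \<rho> \<gamma> where g: "\<forall>i<r. \<rho> i \<in> R" "\<forall>i<r. \<gamma> i \<in> F" "det (selection a r \<rho> \<gamma>) \<noteq> 0"
    using r(1) unfolding good_def by blast
  have inj: "inj_on \<gamma> {..<r}" by (rule det_selection_inj(2)[OF g(3)])
  show ?thesis
  proof (cases "\<gamma> ` {..<r} = F")
    case True
    then have "bij_betw \<gamma> {..<r} F" using inj by (simp add: bij_betw_def)
    then show ?thesis using g by blast
  next
    case False
    then obtain j0 where j0: "j0 \<in> F" "j0 \<notin> \<gamma> ` {..<r}" using g by blast
    define \<gamma>' where "\<gamma>' l = (if l < r then \<gamma> l else j0)" for l
    \<comment> \<open>The selection bordered by row i and the new column \<open>j0\<close>. Only the
      last row depends on i, so one family \<open>C\<close> of last-row cofactors serves all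
      rows.\<close>
    define B where "B i = selection a (Suc r) (\<lambda>l. if l < r then \<rho> l else i) \<gamma>'" for i
    define C where "C l = cofactor (B 0) r l" for l
    have B: "B i \<in> carrier_mat (Suc r) (Suc r)" for i by (simp add: B_def)
    have del: "mat_delete (B i) r l = mat_delete (B 0) r l" for i l
      by (intro eq_matI) (auto simp: mat_delete_def B_def selection_def)
    have C: "cofactor (B i) r l = C l" for i l by (simp only: C_def cofactor_def del[of i l])
    have inj': "inj_on \<gamma>' {..<Suc r}"
    proof -
      have eq: "\<gamma>' ` {..<r} = \<gamma> ` {..<r}" "inj_on \<gamma>' {..<r} = inj_on \<gamma> {..<r}"
        by (rule image_cong, simp, simp add: \<gamma>'_def) (rule inj_on_cong, simp add: \<gamma>'_def)
      have "\<gamma>' r \<notin> \<gamma>' ` {..<r}" unfolding eq using j0(2) by (simp add: \<gamma>'_def)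
      then show ?thesis unfolding lessThan_Suc inj_on_insert using inj eq by simp
    qed
    have img: "\<gamma>' ` {..<Suc r} \<subseteq> F" using g j0 by (auto simp: \<gamma>'_def)
    define d where "d j = (\<Sum>l<Suc r. if \<gamma>' l = j then C l else 0)" for j
    have d: "d (\<gamma>' l) = C l" if "l < Suc r" for l
    proof -
      have "\<gamma>' l' = \<gamma>' l \<longleftrightarrow> l' = l" if "l' < Suc r" for l'
        using inj_on_eq_iff[OF inj', of l' l] that \<open>l < Suc r\<close> by simp
      then have "d (\<gamma>' l) = (\<Sum>l'<Suc r. if l' = l then C l' else 0)"
        unfolding d_def by (intro sum.cong) simp_all
      then show ?thesis using that by simp
    qed
    have dout: "d j = 0" if "j \<notin> \<gamma>' ` {..<Suc r}" for j
      unfolding d_def by (rule sum.neutral) (use that in auto)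
    have "(\<Sum>j\<in>F. a i j * d j) = 0" if i: "i \<in> R" for i
    proof -
      have "(\<Sum>j\<in>F. a i j * d j) = (\<Sum>j\<in>\<gamma>' ` {..<Suc r}. a i j * d j)"
        by (rule sum.mono_neutral_right) (use assms img dout in auto)
      also have "\<dots> = (\<Sum>l<Suc r. a i (\<gamma>' l) * C l)"
        by (subst sum.reindex[OF inj']) (auto intro!: sum.cong simp: d)
      also have "\<dots> = (\<Sum>l<Suc r. B i $$ (r, l) * cofactor (B i) r l)"
      proof (rule sum.cong[OF refl])
        fix l assume "l \<in> {..<Suc r}"
        then have "B i $$ (r, l) = a i (\<gamma>' l)" by (simp add: B_def selection_def)
        then show "a i (\<gamma>' l) * C l = B i $$ (r, l) * cofactor (B i) r l" by (simp only: C)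
      qed
      also have "\<dots> = det (B i)" by (rule laplace_expansion_row[symmetric, OF B]) simp
      \<comment> \<open>A nonzero \<open>det (B i)\<close> would be a larger nonsingular selection.
        This also covers rows already selected.\<close>
      also have "\<dots> = 0"
      proof (rule ccontr)
        assume "det (B i) \<noteq> 0"
        then have "good (Suc r)"
          unfolding good_def B_def
          by (intro exI[of _ "\<lambda>l. if l < r then \<rho> l else i"] exI[of _ \<gamma>'])
             (use g i img in \<open>auto simp: image_subset_iff\<close>)
        then show False using r(2) by fastforce
      qed
      finally show ?thesis .
    qed
    moreover have "d j0 \<noteq> 0"
    proof -
      have "mat_delete (B 0) r r = selection a r \<rho> \<gamma>"
        by (intro eq_matI) (auto simp: mat_delete_def B_def selection_def \<gamma>'_def)
      then have "C r = det (selection a r \<rho> \<gamma>)" by (simp add: C_def cofactor_def)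
      moreover have "j0 = \<gamma>' r" by (simp add: \<gamma>'_def)
      ultimately show ?thesis using d[of r] g(3) by simp
    qed
    moreover have "d j = 0" if "j \<notin> F" for j using dout img that by blast
    ultimately show ?thesis using j0(1) by blast
  qed
qed

text \<open>Multiplying the system by the adjugate expresses \<open>det B * x l\<close> as an
  integral combination of integers, and the determinant is 1 or -1.\<close>

lemma integral_solution_unimodular:
  fixes B :: "int mat" and x :: "nat \<Rightarrow> real"
  assumes B: "B \<in> carrier_mat r r" and d: "\<bar>det B\<bar> = 1"
    and z: "\<And>i. i < r \<Longrightarrow> (\<Sum>j<r. of_int (B $$ (i,j)) * x j) \<in> \<int>"
    and l: "l < r"
  shows "x l \<in> \<int>"
proof -
  define A where "A = adj_mat B"
  note adj = adj_mat[OF B]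
  have A: "A \<in> carrier_mat r r" using adj(1) by (simp add: A_def)
  have AB: "(\<Sum>i<r. A $$ (l,i) * B $$ (i,j)) = (if l = j then det B else 0)" if j: "j < r" for j
  proof -
    have "(A * B) $$ (l,j) = (\<Sum>i<r. A $$ (l,i) * B $$ (i,j))"
      using A B l j by (auto simp: scalar_prod_def atLeast0LessThan intro!: sum.cong)
    then have "(\<Sum>i<r. A $$ (l,i) * B $$ (i,j)) = (det B \<cdot>\<^sub>m 1\<^sub>m r) $$ (l,j)"
      using adj(3) by (simp add: A_def)
    then show ?thesis using l j by simp
  qed
  have "(\<Sum>i<r. of_int (A $$ (l,i)) * (\<Sum>j<r. of_int (B $$ (i,j)) * x j))
      = (\<Sum>j<r. of_int (\<Sum>i<r. A $$ (l,i) * B $$ (i,j)) * x j)"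
    unfolding sum_distrib_left of_int_sum sum_distrib_right
    by (subst sum.swap) (simp add: algebra_simps)
  also have "\<dots> = (\<Sum>j<r. if j = l then of_int (det B) * x j else 0)"
    by (rule sum.cong) (auto simp: AB)
  also have "\<dots> = of_int (det B) * x l" using l by simp
  finally have "of_int (det B) * x l \<in> \<int>" using z by (metis (no_types, lifting) Ints_mult Ints_of_int Ints_sum lessThan_iff)
  moreover have "det B = 1 \<or> det B = -1" using d by linarith
  ultimately show ?thesis by (auto simp: minus_in_Ints_iff)
qed

section \<open>Rounding\<close>

text \<open>Total unimodularity in the form in which bordered selections are used; repeated indices
  are harmless because they give determinant 0.\<close>

definition tu_family :: "nat \<Rightarrow> nat \<Rightarrow> (nat \<Rightarrow> nat \<Rightarrow> int) \<Rightarrow> bool" where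
  "tu_family m n a \<longleftrightarrow> (\<forall>r \<rho> \<gamma>. (\<forall>i<r. \<rho> i < m) \<and> (\<forall>i<r. \<gamma> i < n) \<longrightarrow> det (selection a r \<rho> \<gamma>) \<in> {0, 1, -1})"

lemma tu_family_mat: "totally_unimodular A \<Longrightarrow> tu_family (dim_row A) (dim_col A) (\<lambda>i j. A $$ (i,j))"
  unfolding tu_family_def using totally_unimodular_selection by blast

text \<open>F collects the fractional coordinates, R the integral rows. In the second case of
  \<open>selection_dichotomy\<close> the fractional coordinates would solve a unimodular system with
  integral right-hand side and be integral. So a kernel vector exists: it moves fractional
  coordinates only and leaves the integral rows unchanged.\<close>

lemma fractional_kernel_vector:
  fixes x :: "nat \<Rightarrow> real"
  assumes tu: "tu_family m n a" and ne: "\<exists>j<n. x j \<notin> \<int>"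
  shows "\<exists>d :: nat \<Rightarrow> int. (\<forall>j<n. x j \<in> \<int> \<longrightarrow> d j = 0) \<and> (\<exists>j<n. d j \<noteq> 0) \<and>
    (\<forall>i<m. (\<Sum>j<n. of_int (a i j) * x j) \<in> \<int> \<longrightarrow> (\<Sum>j<n. a i j * d j) = 0)"
proof -
  define F where "F = {j\<in>{..<n}. x j \<notin> \<int>}"
  define R where "R = {i\<in>{..<m}. (\<Sum>j<n. of_int (a i j) * x j) \<in> \<int>}"
  have F: "finite F" "F \<subseteq> {..<n}" by (auto simp: F_def)
  have "\<not> (\<exists>r \<rho> \<gamma>. (\<forall>i<r. \<rho> i \<in> R) \<and> bij_betw \<gamma> {..<r} F \<and> det (selection a r \<rho> \<gamma>) \<noteq> 0)"
  proof
    assume "\<exists>r \<rho> \<gamma>. (\<forall>i<r. \<rho> i \<in> R) \<and> bij_betw \<gamma> {..<r} F \<and> det (selection a r \<rho> \<gamma>) \<noteq> 0"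
    then obtain r \<rho> \<gamma> where g: "\<forall>i<r. \<rho> i \<in> R" "bij_betw \<gamma> {..<r} F" "det (selection a r \<rho> \<gamma>) \<noteq> 0"
      by blast
    have inF: "\<gamma> l \<in> F" if "l < r" for l using g(2) that by (auto simp: bij_betw_def)
    have "det (selection a r \<rho> \<gamma>) \<in> {0, 1, -1}"
    proof (rule tu[unfolded tu_family_def, rule_format], intro conjI allI impI)
      show "\<rho> i < m" if "i < r" for i using g(1) that by (simp add: R_def)
      show "\<gamma> i < n" if "i < r" for i using inF[OF that] by (simp add: F_def)
    qed
    then have d: "\<bar>det (selection a r \<rho> \<gamma>)\<bar> = 1" using g(3) by auto
    have int: "(\<Sum>l<r. of_int (selection a r \<rho> \<gamma> $$ (i,l)) * x (\<gamma> l)) \<in> \<int>" if i: "i < r" for i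
    proof -
      have "(\<Sum>l<r. of_int (selection a r \<rho> \<gamma> $$ (i,l)) * x (\<gamma> l)) = (\<Sum>l<r. of_int (a (\<rho> i) (\<gamma> l)) * x (\<gamma> l))"
        using i by (auto simp: selection_def intro!: sum.cong)
      also have "\<dots> = (\<Sum>j\<in>F. of_int (a (\<rho> i) j) * x j)"
        using sum.reindex_bij_betw[OF g(2), of "\<lambda>j. of_int (a (\<rho> i) j) * x j"] by simp
      also have "\<dots> = (\<Sum>j<n. of_int (a (\<rho> i) j) * x j) - (\<Sum>j\<in>{..<n} - F. of_int (a (\<rho> i) j) * x j)"
        using F by (simp add: sum_diff)
      also have "\<dots> \<in> \<int>"
      proof (rule Ints_diff)
        show "(\<Sum>j<n. of_int (a (\<rho> i) j) * x j) \<in> \<int>" using g(1) i by (simp add: R_def)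
        show "(\<Sum>j\<in>{..<n} - F. of_int (a (\<rho> i) j) * x j) \<in> \<int>"
          by (intro Ints_sum Ints_mult) (auto simp: F_def)
      qed
      finally show ?thesis .
    qed
    obtain j where j: "j \<in> F" using ne by (auto simp: F_def)
    then obtain l where l: "l < r" "j = \<gamma> l" using g(2) by (auto simp: bij_betw_def)
    have "x (\<gamma> l) \<in> \<int>"
      by (rule integral_solution_unimodular[where x = "\<lambda>l. x (\<gamma> l)", OF selection_carrier d int l(1)])
    then show False using j l by (simp add: F_def)
  qed
  then obtain d where d: "\<forall>j. j \<notin> F \<longrightarrow> d j = (0::int)" "\<exists>j\<in>F. d j \<noteq> 0" "\<forall>i\<in>R. (\<Sum>j\<in>F. a i j * d j) = 0"
    using selection_dichotomy[OF F(1), of R a] by blast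
  have "(\<Sum>j<n. a i j * d j) = (\<Sum>j\<in>F. a i j * d j)" for i
    by (rule sum.mono_neutral_right) (use F d(1) in auto)
  then show ?thesis using d by (intro exI[of _ d]) (auto simp: F_def R_def)
qed

text \<open>Entry p starts at \<open>z p\<close> and moves with speed \<open>v p\<close>; t is the
  first time at which a moving entry reaches the next integer in its direction.\<close>

lemma move_to_integer:
  fixes z v :: "'b \<Rightarrow> real"
  assumes A: "finite A" and z: "\<And>p. p \<in> A \<Longrightarrow> z p \<notin> \<int>" and v: "\<exists>p\<in>A. v p \<noteq> 0"
  shows "\<exists>t>0. (\<forall>p\<in>A. of_int \<lfloor>z p\<rfloor> \<le> z p + t * v p \<and> z p + t * v p \<le> of_int \<lceil>z p\<rceil>) \<and> (\<exists>p\<in>A. z p + t * v p \<in> \<int>)"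
proof -
  define A' where "A' = {p\<in>A. v p \<noteq> 0}"
  define \<tau> where "\<tau> p = (if v p > 0 then (of_int \<lceil>z p\<rceil> - z p) / v p else (of_int \<lfloor>z p\<rfloor> - z p) / v p)" for p
  define t where "t = Min (\<tau> ` A')"
  have A': "finite A'" "A' \<noteq> {}" using A v by (auto simp: A'_def)
  have strict: "of_int \<lfloor>z p\<rfloor> < z p \<and> z p < of_int \<lceil>z p\<rceil>" if "p \<in> A" for p
    using z[OF that] by (metis Ints_of_int floor_correct ceiling_correct le_less)
  have pos: "\<tau> p > 0" if "p \<in> A'" for p
    using strict[of p] that by (auto simp: \<tau>_def A'_def zero_less_divide_iff)
  obtain p0 where p0: "p0 \<in> A'" "t = \<tau> p0" 
  proof -
    have "t \<in> \<tau> ` A'" unfolding t_def by (rule Min_in) (use A' in auto)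
    then show ?thesis using that by blast
  qed
  have tle: "t \<le> \<tau> p" if "p \<in> A'" for p using A' that by (simp add: t_def)
  have t: "t > 0" using p0 pos by simp
  have bounds: "of_int \<lfloor>z p\<rfloor> \<le> z p + t * v p \<and> z p + t * v p \<le> of_int \<lceil>z p\<rceil>" if p: "p \<in> A" for p
  proof -
    consider "v p = 0" | "v p > 0" | "v p < 0" by linarith
    then show ?thesis
    proof cases
      case 1 then show ?thesis using strict[OF p] by simp
    next
      case 2
      then have "t * v p \<le> \<tau> p * v p" using tle[of p] p by (simp add: A'_def)
      also have "\<dots> = of_int \<lceil>z p\<rceil> - z p" using 2 by (simp add: \<tau>_def)
      finally show ?thesis using strict[OF p] 2 t mult_pos_pos[OF t 2] by linarith
    next
      case 3
      then have "t * v p \<ge> \<tau> p * v p" using tle[of p] p by (simp add: A'_def mult_right_mono_neg)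
      moreover have "\<tau> p * v p = of_int \<lfloor>z p\<rfloor> - z p" using 3 by (simp add: \<tau>_def)
      ultimately show ?thesis using strict[OF p] mult_pos_neg[OF t 3] by linarith
    qed
  qed
  have "z p0 + t * v p0 \<in> \<int>"
    using p0 by (cases "v p0 > 0") (auto simp: \<tau>_def A'_def)
  then show ?thesis using t bounds p0 by (auto simp: A'_def)
qed

text \<open>Coordinates and row values form one family, so that the number of its non-integral
  members is the induction measure of rounding.\<close>

fun coord_or_row :: "nat \<Rightarrow> (nat \<Rightarrow> nat \<Rightarrow> int) \<Rightarrow> (nat \<Rightarrow> real) \<Rightarrow> nat + nat \<Rightarrow> real" where
  "coord_or_row n a x (Inl j) = x j"
| "coord_or_row n a x (Inr i) = (\<Sum>j<n. of_int (a i j) * x j)"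

lemma coord_or_row_add:
  "coord_or_row n a (\<lambda>j. x j + t * d j) p = coord_or_row n a x p + t * coord_or_row n a d p"
  by (cases p) (simp_all add: algebra_simps sum.distrib sum_distrib_left)

text \<open>Moving along a kernel vector keeps every integral entry and makes a fractional one
  integral. Entries stay between their floor and ceiling, so the rounding intervals only shrink from
  step to step.\<close>

lemma tu_round_aux:
  fixes x c :: "nat \<Rightarrow> real"
  assumes tu: "tu_family m n a"
  defines "D \<equiv> Inl ` {..<n} \<union> Inr ` {..<m}"
  shows "\<exists>y :: nat \<Rightarrow> int. (\<forall>p\<in>D. of_int \<lfloor>coord_or_row n a x p\<rfloor> \<le> coord_or_row n a (of_int \<circ> y) p \<and>
      coord_or_row n a (of_int \<circ> y) p \<le> of_int \<lceil>coord_or_row n a x p\<rceil>) \<and> (\<Sum>j<n. c j * of_int (y j)) \<le> (\<Sum>j<n. c j * x j)"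
proof (induction "card {p\<in>D. coord_or_row n a x p \<notin> \<int>}" arbitrary: x rule: less_induct)
  case less
  let ?z = "coord_or_row n a"
  have D: "finite D" by (simp add: D_def)
  show ?case
  proof (cases "\<exists>j<n. x j \<notin> \<int>")
    case False
    then have x: "of_int \<lfloor>x j\<rfloor> = x j" if "j < n" for j using that by (auto simp: Ints_def)
    have "?z (of_int \<circ> (\<lambda>j. \<lfloor>x j\<rfloor>)) p = ?z x p" if "p \<in> D" for p
      using that x by (auto simp: D_def intro!: sum.cong)
    moreover have "(\<Sum>j<n. c j * of_int \<lfloor>x j\<rfloor>) = (\<Sum>j<n. c j * x j)"
      by (rule sum.cong) (simp_all add: x)
    ultimately show ?thesis
      by (intro exI[of _ "\<lambda>j. \<lfloor>x j\<rfloor>"]) simp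
  next
    case True
    obtain d0 where d0: "\<forall>j<n. x j \<in> \<int> \<longrightarrow> d0 j = 0" "\<exists>j<n. d0 j \<noteq> 0"
      "\<forall>i<m. (\<Sum>j<n. of_int (a i j) * x j) \<in> \<int> \<longrightarrow> (\<Sum>j<n. a i j * d0 j) = 0"
      using fractional_kernel_vector[OF tu True] by blast
    \<comment> \<open>Of the two signs of a kernel vector, one does not increase the
      functional.\<close>
    define d where "d j = (if (\<Sum>j<n. c j * of_int (d0 j)) \<le> 0 then real_of_int (d0 j) else - real_of_int (d0 j))" for j
    have dc: "(\<Sum>j<n. c j * d j) \<le> 0"
      by (cases "(\<Sum>j<n. c j * of_int (d0 j)) \<le> 0") (auto simp: d_def sum_negf)
    have dz: "?z d p = (if (\<Sum>j<n. c j * of_int (d0 j)) \<le> 0 then ?z (of_int \<circ> d0) p else - ?z (of_int \<circ> d0) p)" for p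
      by (cases p) (auto simp: d_def sum_negf)
    have dint: "?z d p = 0" if "p \<in> D" "?z x p \<in> \<int>" for p
    proof -
      have "?z (of_int \<circ> d0) p = 0"
        using that d0(1,3) by (auto simp: D_def simp flip: of_int_mult of_int_sum)
      then show ?thesis by (simp add: dz)
    qed
    define A where "A = {p\<in>D. ?z x p \<notin> \<int>}"
    obtain j where j: "j < n" "d0 j \<noteq> 0" using d0(2) by blast
    have "Inl j \<in> A" using j d0(1) by (auto simp: A_def D_def)
    moreover have "?z d (Inl j) \<noteq> 0" using j by (simp add: d_def)
    ultimately have "\<exists>p\<in>A. ?z d p \<noteq> 0" by blast
    then obtain t where t: "t > 0" "\<forall>p\<in>A. of_int \<lfloor>?z x p\<rfloor> \<le> ?z x p + t * ?z d p \<and> ?z x p + t * ?z d p \<le> of_int \<lceil>?z x p\<rceil>"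
      "\<exists>p\<in>A. ?z x p + t * ?z d p \<in> \<int>"
    proof -
      have "finite A" "\<And>p. p \<in> A \<Longrightarrow> ?z x p \<notin> \<int>" using D by (simp_all add: A_def)
      from move_to_integer[where z = "?z x" and v = "?z d", OF this \<open>\<exists>p\<in>A. ?z d p \<noteq> 0\<close>]
      show ?thesis using that by blast
    qed
    define x' where "x' j = x j + t * d j" for j
    have x': "?z x' p = ?z x p + t * ?z d p" for p unfolding x'_def by (rule coord_or_row_add)
    have between: "of_int \<lfloor>?z x p\<rfloor> \<le> ?z x' p \<and> ?z x' p \<le> of_int \<lceil>?z x p\<rceil>" if "p \<in> D" for p
      using t(2) dint[OF that] that by (cases "p \<in> A") (auto simp: x' A_def)
    have "{p\<in>D. ?z x' p \<notin> \<int>} \<subset> {p\<in>D. ?z x p \<notin> \<int>}"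
      using t(3) dint by (auto simp: x' A_def)
    then have "card {p\<in>D. ?z x' p \<notin> \<int>} < card {p\<in>D. ?z x p \<notin> \<int>}"
      using D by (intro psubset_card_mono) auto
    from less[OF this] obtain y :: "nat \<Rightarrow> int" where y: "\<forall>p\<in>D. of_int \<lfloor>?z x' p\<rfloor> \<le> ?z (of_int \<circ> y) p \<and>
      ?z (of_int \<circ> y) p \<le> of_int \<lceil>?z x' p\<rceil>" "(\<Sum>j<n. c j * of_int (y j)) \<le> (\<Sum>j<n. c j * x' j)" by blast
    have "(\<Sum>j<n. c j * x' j) = (\<Sum>j<n. c j * x j) + t * (\<Sum>j<n. c j * d j)"
      by (simp add: x'_def algebra_simps sum.distrib sum_distrib_left)
    then have "(\<Sum>j<n. c j * x' j) \<le> (\<Sum>j<n. c j * x j)"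
      using mult_nonneg_nonpos[of t "\<Sum>j<n. c j * d j"] t(1) dc by linarith
    moreover have "of_int \<lfloor>?z x p\<rfloor> \<le> ?z (of_int \<circ> y) p \<and> ?z (of_int \<circ> y) p \<le> of_int \<lceil>?z x p\<rceil>" if "p \<in> D" for p
    proof -
      have "\<lfloor>?z x p\<rfloor> \<le> \<lfloor>?z x' p\<rfloor>" "\<lceil>?z x' p\<rceil> \<le> \<lceil>?z x p\<rceil>"
        using between[OF that] by (simp_all add: le_floor_iff ceiling_le_iff)
      then show ?thesis using y(1) that by (meson of_int_le_iff order_trans)
    qed
    ultimately show ?thesis using y(2) by (intro exI[of _ y]) auto
  qed
qed

theorem tu_round:
  fixes x c :: "nat \<Rightarrow> real"
  assumes "tu_family m n a"
  shows "\<exists>y :: nat \<Rightarrow> int. (\<forall>j<n. \<lfloor>x j\<rfloor> \<le> y j \<and> y j \<le> \<lceil>x j\<rceil>) \<and>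
    (\<forall>i<m. \<lfloor>\<Sum>j<n. of_int (a i j) * x j\<rfloor> \<le> (\<Sum>j<n. a i j * y j) \<and>
      (\<Sum>j<n. a i j * y j) \<le> \<lceil>\<Sum>j<n. of_int (a i j) * x j\<rceil>) \<and>
    (\<Sum>j<n. c j * of_int (y j)) \<le> (\<Sum>j<n. c j * x j)"
proof -
  define D :: "(nat + nat) set" where "D = Inl ` {..<n} \<union> Inr ` {..<m}"
  obtain y :: "nat \<Rightarrow> int" where y: "\<forall>p\<in>D. of_int \<lfloor>coord_or_row n a x p\<rfloor> \<le> coord_or_row n a (of_int \<circ> y) p \<and>
      coord_or_row n a (of_int \<circ> y) p \<le> of_int \<lceil>coord_or_row n a x p\<rceil>" "(\<Sum>j<n. c j * of_int (y j)) \<le> (\<Sum>j<n. c j * x j)"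
    using tu_round_aux[OF assms, of x c] unfolding D_def by blast
  have row: "coord_or_row n a (of_int \<circ> y) (Inr i) = of_int (\<Sum>j<n. a i j * y j)" for i by simp
  have "\<lfloor>x j\<rfloor> \<le> y j \<and> y j \<le> \<lceil>x j\<rceil>" if "j < n" for j
  proof -
    have "Inl j \<in> D" using that by (simp add: D_def)
    from y(1)[rule_format, OF this] show ?thesis by simp
  qed
  moreover have "\<lfloor>\<Sum>j<n. of_int (a i j) * x j\<rfloor> \<le> (\<Sum>j<n. a i j * y j) \<and>
      (\<Sum>j<n. a i j * y j) \<le> \<lceil>\<Sum>j<n. of_int (a i j) * x j\<rceil>" if "i < m" for i
  proof -
    have "Inr i \<in> D" using that by (simp add: D_def)
    from y(1)[rule_format, OF this, unfolded row] show ?thesis by (simp del: of_int_sum)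
  qed
  ultimately show ?thesis using y(2) by blast
qed

section \<open>Perturbed functionals and rays\<close>

text \<open>A geometric sum: (M - 1)(1 + M + ... + M^(n-1)) is less than M^n.\<close>

lemma digits_bound:
  fixes M :: int and d :: "nat \<Rightarrow> int"
  assumes M: "M \<ge> 1" and d: "\<And>j. j < n \<Longrightarrow> \<bar>d j\<bar> \<le> M - 1"
  shows "\<bar>\<Sum>j<n. M ^ j * d j\<bar> < M ^ n"
  using d
proof (induction n)
  case (Suc n)
  then have IH: "\<bar>\<Sum>j<n. M ^ j * d j\<bar> < M ^ n" by simp
  have "\<bar>M ^ n * d n\<bar> \<le> M ^ n * (M - 1)" using Suc.prems[of n] M by (simp add: abs_mult mult_left_mono)
  then have "\<bar>\<Sum>j<Suc n. M ^ j * d j\<bar> < M ^ n + M ^ n * (M - 1)" using IH by simp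
  also have "\<dots> = M ^ Suc n" by (simp add: algebra_simps)
  finally show ?case .
qed simp

lemma digits_zero:
  fixes M :: int and d :: "nat \<Rightarrow> int"
  assumes M: "M \<ge> 1" and d: "\<And>j. j < n \<Longrightarrow> \<bar>d j\<bar> \<le> M - 1" and z: "(\<Sum>j<n. M ^ j * d j) = 0"
  shows "j < n \<Longrightarrow> d j = 0"
  using d z
proof (induction n)
  case (Suc n)
  have "\<bar>\<Sum>j<n. M ^ j * d j\<bar> < M ^ n" by (rule digits_bound[OF M]) (use Suc.prems in auto)
  then have "\<bar>M ^ n * d n\<bar> < M ^ n" using Suc.prems(3) by simp
  then have "d n = 0" using M by (auto simp: abs_mult mult_less_cancel_left1)
  moreover from this have "(\<Sum>j<n. M ^ j * d j) = 0" using Suc.prems(3) by simp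
  ultimately show ?case using Suc by (auto simp: less_Suc_eq)
qed simp

text \<open>The perturbed values differ by M^n C + E, where C is the difference for \<open>c\<close>
  and |E| < M^n. So C decides unless it is 0, and E only breaks ties; E is 0 only for equal points,
  because the coordinate differences are its digits in base M.\<close>

lemma perturbed_functional:
  fixes M :: int and c y z :: "nat \<Rightarrow> int"
  assumes M: "M \<ge> 1" and d: "\<And>j. j < n \<Longrightarrow> \<bar>y j - z j\<bar> \<le> M - 1"
  defines "c' \<equiv> \<lambda>j. M ^ n * c j + M ^ j"
  shows "(\<Sum>j<n. c' j * y j) = (\<Sum>j<n. c' j * z j) \<Longrightarrow> j < n \<Longrightarrow> y j = z j"
    and "(\<Sum>j<n. c' j * y j) \<le> (\<Sum>j<n. c' j * z j) \<Longrightarrow> (\<Sum>j<n. c j * y j) \<le> (\<Sum>j<n. c j * z j)"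
proof -
  define C where "C = (\<Sum>j<n. c j * y j) - (\<Sum>j<n. c j * z j)"
  define E where "E = (\<Sum>j<n. M ^ j * (y j - z j))"
  have eq: "(\<Sum>j<n. c' j * y j) - (\<Sum>j<n. c' j * z j) = M ^ n * C + E"
    unfolding C_def E_def c'_def sum_subtractf[symmetric] sum_distrib_left sum.distrib[symmetric]
    by (rule sum.cong) (simp_all add: algebra_simps)
  have E: "\<bar>E\<bar> < M ^ n" unfolding E_def by (rule digits_bound[OF M]) (rule d)
  have pos: "M ^ n > 0" using M by simp
  have C0: "C \<le> 0" if "M ^ n * C + E \<le> 0"
  proof (rule ccontr)
    assume "\<not> C \<le> 0"
    then have "M ^ n * 1 \<le> M ^ n * C" using pos by (intro mult_left_mono) auto
    then show False using that E by linarith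
  qed
  show "(\<Sum>j<n. c j * y j) \<le> (\<Sum>j<n. c j * z j)" if "(\<Sum>j<n. c' j * y j) \<le> (\<Sum>j<n. c' j * z j)"
    using C0 that eq by (simp add: C_def)
  show "y j = z j" if eq0: "(\<Sum>j<n. c' j * y j) = (\<Sum>j<n. c' j * z j)" and j: "j < n"
  proof -
    have z: "M ^ n * C + E = 0" using eq eq0 by simp
    then have "\<bar>M ^ n * C\<bar> < M ^ n" using E by linarith
    then have "C = 0" using pos by (auto simp: abs_mult mult_less_cancel_left1)
    then have "E = 0" using z by simp
    then have "y j - z j = 0" unfolding E_def using digits_zero[OF M, of n "\<lambda>j. y j - z j" j] d j by simp
    then show ?thesis by simp
  qed
qed

section \<open>Integral feasible points, rays and the reduction to a box\<close>

locale tu_system =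
  fixes m n :: nat and a :: "nat \<Rightarrow> nat \<Rightarrow> int" and w :: "nat \<Rightarrow> int"
  assumes tu: "tu_family m n a"
begin

definition row :: "(nat \<Rightarrow> int) \<Rightarrow> nat \<Rightarrow> int" where
  "row x i = (\<Sum>j<n. a i j * x j)"

definition feas :: "(nat \<Rightarrow> int) \<Rightarrow> bool" where
  "feas x \<longleftrightarrow> (\<forall>i<m. row x i \<le> w i)"

definition real_feas :: "(nat \<Rightarrow> real) \<Rightarrow> bool" where
  "real_feas x \<longleftrightarrow> (\<forall>i<m. (\<Sum>j<n. of_int (a i j) * x j) \<le> of_int (w i))"

definition ray :: "(nat \<Rightarrow> int) \<Rightarrow> bool" where
  "ray g \<longleftrightarrow> (\<forall>j<n. \<bar>g j\<bar> \<le> 1) \<and> (\<forall>i<m. row g i \<le> 0)"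

lemma row_diff: "row (\<lambda>j. x j - y j) i = row x i - row y i"
  by (simp add: row_def algebra_simps sum_subtractf)

lemma row_add_mult: "row (\<lambda>j. x j + t * y j) i = row x i + t * row y i"
  by (simp add: row_def algebra_simps sum.distrib sum_distrib_left)

lemma feas_cong: "(\<And>j. j < n \<Longrightarrow> x j = y j) \<Longrightarrow> feas x = feas y"
  by (simp add: feas_def row_def)

lemma real_feas_of_int: "real_feas (\<lambda>j. of_int (x j)) \<longleftrightarrow> feas x"
  by (simp add: real_feas_def feas_def row_def flip: of_int_mult of_int_sum)

lemma feas_ray: "feas x \<Longrightarrow> ray g \<Longrightarrow> t \<ge> 0 \<Longrightarrow> feas (\<lambda>j. x j + t * g j)"
  unfolding feas_def ray_def row_add_mult
  using mult_nonneg_nonpos[of t] by (meson add_mono_thms_linordered_semiring(1) add_decreasing2)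

text \<open>The right-hand sides are integral, so raising a row value to at most its ceiling
  violates no inequality.\<close>

lemma real_feas_round:
  assumes "real_feas x"
  shows "\<exists>y. feas y \<and> (\<forall>j<n. \<lfloor>x j\<rfloor> \<le> y j \<and> y j \<le> \<lceil>x j\<rceil>) \<and>
    (\<Sum>j<n. c j * of_int (y j)) \<le> (\<Sum>j<n. c j * x j)"
proof -
  obtain y where y: "\<forall>j<n. \<lfloor>x j\<rfloor> \<le> y j \<and> y j \<le> \<lceil>x j\<rceil>"
    "\<forall>i<m. \<lfloor>\<Sum>j<n. of_int (a i j) * x j\<rfloor> \<le> (\<Sum>j<n. a i j * y j) \<and>
      (\<Sum>j<n. a i j * y j) \<le> \<lceil>\<Sum>j<n. of_int (a i j) * x j\<rceil>"
    "(\<Sum>j<n. c j * of_int (y j)) \<le> (\<Sum>j<n. c j * x j)"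
    using tu_round[OF tu, of x c] by blast
  have "row y i \<le> w i" if i: "i < m" for i
  proof -
    have "\<lceil>\<Sum>j<n. of_int (a i j) * x j\<rceil> \<le> w i" using assms i by (simp add: real_feas_def ceiling_le_iff)
    moreover have "row y i \<le> \<lceil>\<Sum>j<n. of_int (a i j) * x j\<rceil>" using y(2) i unfolding row_def by blast
    ultimately show ?thesis by linarith
  qed
  then show ?thesis using y by (auto simp: feas_def)
qed

text \<open>Rounding a non-integral optimum for the functional itself, and once more for the functional
  tilted away from the first rounded point, gives two distinct integral optima.\<close>

lemma unique_optimum_integral:
  fixes c :: "nat \<Rightarrow> int" and v :: "nat \<Rightarrow> real"
  assumes v: "real_feas v" "\<And>j. j < n \<Longrightarrow> of_int (lo j) \<le> v j \<and> v j \<le> of_int (up j)"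
    and opt: "\<And>x. feas x \<Longrightarrow> (\<And>j. j < n \<Longrightarrow> lo j \<le> x j \<and> x j \<le> up j) \<Longrightarrow>
      (\<Sum>j<n. of_int (c j) * v j) \<le> of_int (\<Sum>j<n. c j * x j)"
    and uniq: "\<And>x y j. (\<And>j. j < n \<Longrightarrow> lo j \<le> x j \<and> x j \<le> up j) \<Longrightarrow> (\<And>j. j < n \<Longrightarrow> lo j \<le> y j \<and> y j \<le> up j) \<Longrightarrow>
      (\<Sum>j<n. c j * x j) = (\<Sum>j<n. c j * y j) \<Longrightarrow> j < n \<Longrightarrow> x j = y j"
  obtains x where "feas x" "\<And>j. j < n \<Longrightarrow> v j = of_int (x j)"
proof -
  have box: "lo j \<le> y j \<and> y j \<le> up j" if "\<forall>j<n. \<lfloor>v j\<rfloor> \<le> y j \<and> y j \<le> \<lceil>v j\<rceil>" "j < n" for y j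
  proof -
    have "lo j \<le> \<lfloor>v j\<rfloor>" "\<lceil>v j\<rceil> \<le> up j" using v(2)[OF that(2)] by (simp_all add: le_floor_iff ceiling_le_iff)
    moreover have "\<lfloor>v j\<rfloor> \<le> y j" "y j \<le> \<lceil>v j\<rceil>" using that by blast+
    ultimately show ?thesis by linarith
  qed
  have cs: "of_int (\<Sum>j<n. c j * y j) = (\<Sum>j<n. real_of_int (c j) * of_int (y j))" for y by simp
  obtain y where y: "feas y" "\<forall>j<n. \<lfloor>v j\<rfloor> \<le> y j \<and> y j \<le> \<lceil>v j\<rceil>"
    "(\<Sum>j<n. of_int (c j) * of_int (y j)) \<le> (\<Sum>j<n. of_int (c j) * v j)"
    using real_feas_round[OF v(1), of "\<lambda>j. of_int (c j)"] by blast
  have ybox: "\<And>j. j < n \<Longrightarrow> lo j \<le> y j \<and> y j \<le> up j" using box y(2) by blast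
  have cy: "(\<Sum>j<n. of_int (c j) * v j) = of_int (\<Sum>j<n. c j * y j)"
    using opt[OF y(1) ybox] y(3) cs[of y] by linarith
  have "v j0 = of_int (y j0)" if j0: "j0 < n" for j0
  proof (rule ccontr)
    assume ne: "v j0 \<noteq> of_int (y j0)"
    define s :: real where "s = (if v j0 < of_int (y j0) then 1 else -1)"
    have s: "s * v j0 < s * of_int (y j0)" using ne by (auto simp: s_def)
    \<comment> \<open>Minimizing the tilt s x favours values of coordinate \<open>j0\<close> away
      from y. The factor 2 keeps the tilt subordinate: s x changes by at most 1 in the rounding,
      less than one unit of 2 c. So z ties with y for c, but does not lie on the side of
      \<open>v j0\<close> where y lies.\<close>
    define c2 where "c2 j = 2 * real_of_int (c j) + (if j = j0 then s else 0)" for j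
    have c2: "(\<Sum>j<n. c2 j * u j) = 2 * (\<Sum>j<n. of_int (c j) * u j) + s * u j0" for u
    proof -
      have "(\<Sum>j<n. c2 j * u j) = (\<Sum>j<n. 2 * (of_int (c j) * u j) + (if j = j0 then s * u j else 0))"
        by (rule sum.cong) (auto simp: c2_def algebra_simps)
      then show ?thesis using j0 by (simp add: sum.distrib sum_distrib_left)
    qed
    obtain z where z: "feas z" "\<forall>j<n. \<lfloor>v j\<rfloor> \<le> z j \<and> z j \<le> \<lceil>v j\<rceil>"
      "(\<Sum>j<n. c2 j * of_int (z j)) \<le> (\<Sum>j<n. c2 j * v j)"
      using real_feas_round[OF v(1), of c2] by blast
    have zbox: "\<And>j. j < n \<Longrightarrow> lo j \<le> z j \<and> z j \<le> up j" using box z(2) by blast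
    have "\<bar>v j0 - of_int (z j0)\<bar> \<le> 1"
      using z(2)[rule_format, OF j0] floor_correct[of "v j0"] ceiling_correct[of "v j0"] by linarith
    then have "s * v j0 - s * of_int (z j0) \<le> 1" by (auto simp: s_def)
    then have "2 * real_of_int (\<Sum>j<n. c j * z j) \<le> 2 * of_int (\<Sum>j<n. c j * y j) + 1"
      using z(3) unfolding c2 cy cs[symmetric] by linarith
    then have "(\<Sum>j<n. c j * z j) \<le> (\<Sum>j<n. c j * y j)" by linarith
    moreover have "(\<Sum>j<n. c j * y j) \<le> (\<Sum>j<n. c j * z j)" using opt[OF z(1) zbox] cy by linarith
    ultimately have eq: "(\<Sum>j<n. c j * z j) = (\<Sum>j<n. c j * y j)" by simp
    then have "s * of_int (z j0) \<le> s * v j0" using z(3) unfolding c2 cy cs[symmetric] by simp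
    then show False using uniq[OF zbox ybox eq j0] s by simp
  qed
  then show ?thesis using that y(1) by blast
qed

text \<open>For a row of value r whose right-hand side has absolute value u: removing the rounded
  down N-th part of r leaves at most -u. For r \<ge> -N the removed amount is at least -1; for
  smaller r it is at least r + N - 1.\<close>

lemma floor_division_gap:
  fixes N r u :: int
  assumes "N \<ge> 1" "u \<le> N - 1" "u \<ge> 0" "r \<le> - u - 1"
  shows "r - \<lfloor>of_int r / real_of_int N\<rfloor> \<le> - u"
proof (cases "r \<ge> - N")
  case True
  then have "- 1 \<le> of_int r / real_of_int N" using assms(1) by (simp add: field_simps)
  then have "- 1 \<le> \<lfloor>of_int r / real_of_int N\<rfloor>" by (simp add: le_floor_iff)
  then show ?thesis using assms by linarith
next
  case False
  then have "(r + N) * (N - 1) \<le> 0" using assms(1) by (intro mult_nonpos_nonneg) auto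
  then have "(r + N - 1) * N \<le> r" by (simp add: algebra_simps)
  then have "real_of_int (r + N - 1) * of_int N \<le> of_int r" by (metis of_int_le_iff of_int_mult)
  then have "of_int (r + N - 1) \<le> of_int r / real_of_int N" using assms(1) by (simp add: le_divide_eq)
  then have "r + N - 1 \<le> \<lfloor>of_int r / real_of_int N\<rfloor>" by (simp add: le_floor_iff)
  then show ?thesis using assms by linarith
qed

text \<open>The ray rounds x / N, where N is the largest absolute value of an entry of x. The functional
  forces it to vanish on the rows that are not far from zero.\<close>

lemma split_off_ray:
  assumes x: "feas x" and j0: "j0 < n" "\<bar>x j0\<bar> > \<beta>" and \<beta>: "(\<Sum>i<m. \<bar>w i\<bar>) \<le> \<beta>"
  obtains g where "ray g" "feas (\<lambda>j. x j - g j)" "(\<Sum>j<n. \<bar>x j - g j\<bar>) < (\<Sum>j<n. \<bar>x j\<bar>)"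
proof -
  define N where "N = Max ((\<lambda>j. \<bar>x j\<bar>) ` {..<n})"
  have "N \<in> (\<lambda>j. \<bar>x j\<bar>) ` {..<n}" unfolding N_def by (rule Max_in) (use j0 in auto)
  then obtain j1 where j1: "j1 < n" "N = \<bar>x j1\<bar>" by auto
  have leN: "\<bar>x j\<bar> \<le> N" if "j < n" for j unfolding N_def using that by simp
  have w0: "\<bar>w i\<bar> \<le> \<beta>" if "i < m" for i
    using member_le_sum[of i "{..<m}" "\<lambda>i. \<bar>w i\<bar>"] that \<beta> by simp
  have "0 \<le> (\<Sum>i<m. \<bar>w i\<bar>)" by (rule sum_nonneg) simp
  with \<beta> have \<beta>0: "\<beta> \<ge> 0" by linarith
  have N: "N > \<beta>" using leN[OF j0(1)] j0 by simp
  then have N1: "N \<ge> 1" using \<beta>0 by simp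
  have N0: "real_of_int N > 0" using N1 by simp
  \<comment> \<open>The rows near zero. A feasible row outside R is at most -|w i| - 1, so it has
    room to increase when g is subtracted.\<close>
  define R where "R = {i\<in>{..<m}. \<bar>row x i\<bar> \<le> \<bar>w i\<bar>}"
  \<comment> \<open>This functional adds the rows in R with the signs they have at x. Rounding
    cannot reverse these signs, so at g it is a sum of nonnegative integers; at x / N it is less
    than 1, because the |w i| sum to at most \<beta> < N. Hence all rows of g in R vanish.\<close>
  define c where "c j = real_of_int (\<Sum>i\<in>R. sgn (row x i) * a i j)" for j
  have swap: "(\<Sum>j<n. c j * u j) = (\<Sum>i\<in>R. of_int (sgn (row x i)) * (\<Sum>j<n. of_int (a i j) * u j))" for u
    unfolding c_def of_int_sum sum_distrib_left sum_distrib_right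
    by (subst sum.swap) (simp add: algebra_simps)
  have rowx: "(\<Sum>j<n. of_int (a i j) * (of_int (x j) / real_of_int N)) = of_int (row x i) / of_int N" for i
    by (simp add: row_def sum_divide_distrib)
  obtain g where g': "\<forall>j<n. \<lfloor>of_int (x j) / real_of_int N\<rfloor> \<le> g j \<and> g j \<le> \<lceil>of_int (x j) / real_of_int N\<rceil>"
    "\<forall>i<m. \<lfloor>of_int (row x i) / real_of_int N\<rfloor> \<le> row g i \<and> row g i \<le> \<lceil>of_int (row x i) / real_of_int N\<rceil>"
    "(\<Sum>j<n. c j * of_int (g j)) \<le> (\<Sum>j<n. c j * (of_int (x j) / of_int N))"
    using tu_round[OF tu, of "\<lambda>j. of_int (x j) / of_int N" c, unfolded rowx, folded row_def] by blast
  note g = g'(1)[rule_format, THEN conjunct1] g'(1)[rule_format, THEN conjunct2]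
    g'(2)[rule_format, THEN conjunct1] g'(2)[rule_format, THEN conjunct2] g'(3)
  have pos: "0 \<le> \<lfloor>of_int z / real_of_int N\<rfloor>" if "z \<ge> 0" for z using that N0 by (simp add: le_floor_iff)
  have neg: "\<lceil>of_int z / real_of_int N\<rceil> \<le> 0" if "z \<le> 0" for z using that N0 by (simp add: ceiling_le_iff divide_nonpos_pos)
  have gneg: "row g i \<le> 0" if "i < m" "row x i \<le> 0" for i
    using g(4)[OF that(1)] neg[OF that(2)] by linarith
  have gpos: "row g i \<ge> 0" if "i < m" "row x i \<ge> 0" for i
    using g(3)[OF that(1)] pos[OF that(2)] by linarith
  have gR: "row g i = 0" if i: "i \<in> R" for i
  proof -
    have nonneg: "sgn (row x i) * row g i \<ge> 0" if "i \<in> R" for i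
      using gneg[of i] gpos[of i] that
      by (cases "row x i" "0::int" rule: linorder_cases) (auto simp: R_def)
    have "real_of_int (\<Sum>i\<in>R. sgn (row x i) * row g i) = (\<Sum>j<n. c j * of_int (g j))"
      unfolding swap row_def by simp
    also have "\<dots> \<le> (\<Sum>i\<in>R. of_int (sgn (row x i)) * (of_int (row x i) / of_int N))"
      using g(5) unfolding swap rowx .
    also have "\<dots> = of_int (\<Sum>i\<in>R. \<bar>row x i\<bar>) / of_int N"
      by (simp add: sum_divide_distrib abs_sgn mult.commute flip: of_int_mult)
    also have "\<dots> < 1"
    proof -
      have "(\<Sum>i\<in>R. \<bar>row x i\<bar>) \<le> (\<Sum>i\<in>R. \<bar>w i\<bar>)" by (rule sum_mono) (simp add: R_def)
      also have "\<dots> \<le> (\<Sum>i<m. \<bar>w i\<bar>)" by (rule sum_mono2) (auto simp: R_def)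
      finally have "(\<Sum>i\<in>R. \<bar>row x i\<bar>) < N" using \<beta> N by linarith
      then have "real_of_int (\<Sum>i\<in>R. \<bar>row x i\<bar>) < of_int N" by (simp only: of_int_less_iff)
      then show ?thesis using N0 by simp
    qed
    finally have "(\<Sum>i\<in>R. sgn (row x i) * row g i) \<le> 0" by linarith
    moreover have "sgn (row x i) * row g i \<le> (\<Sum>i\<in>R. sgn (row x i) * row g i)"
      by (rule member_le_sum) (use i nonneg in \<open>auto simp: R_def\<close>)
    ultimately have "sgn (row x i) * row g i = 0" using nonneg[OF i] by linarith
    then show ?thesis using gneg[of i] gpos[of i] i by (auto simp: R_def sgn_0_0)
  qed
  have far: "row x i \<le> - \<bar>w i\<bar> - 1" if "i < m" "i \<notin> R" for i
    using x that by (force simp: feas_def R_def)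
  have g1: "\<bar>g j\<bar> \<le> 1" "\<bar>x j - g j\<bar> \<le> \<bar>x j\<bar>" if j: "j < n" for j
  proof -
    have "- 1 \<le> of_int (x j) / real_of_int N" "of_int (x j) / real_of_int N \<le> 1"
      using leN[OF j] N0 by (auto simp: field_simps abs_le_iff)
    then have "- 1 \<le> \<lfloor>of_int (x j) / real_of_int N\<rfloor>" "\<lceil>of_int (x j) / real_of_int N\<rceil> \<le> 1"
      by (simp_all add: le_floor_iff ceiling_le_iff)
    then show "\<bar>g j\<bar> \<le> 1" "\<bar>x j - g j\<bar> \<le> \<bar>x j\<bar>"
      using g(1,2)[OF j] pos[of "x j"] neg[of "x j"] by linarith+
  qed
  \<comment> \<open>The largest entry divided by N is exactly 1 or -1, so rounding keeps it and this
    coordinate strictly shrinks.\<close>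
  have "\<bar>x j1 - g j1\<bar> < \<bar>x j1\<bar>"
  proof (cases "x j1 > 0")
    case True
    then have "of_int (x j1) / real_of_int N = 1" using j1 N0 by simp
    then have "g j1 = 1" using g(1,2)[OF j1(1)] by simp
    then show ?thesis using True by simp
  next
    case False
    then have e: "of_int (x j1) / real_of_int N = of_int (- 1)" using j1 N0 by (simp add: field_simps)
    have "g j1 = - 1" using g(1,2)[OF j1(1)] unfolding e floor_of_int ceiling_of_int by linarith
    then show ?thesis using False j1 N1 by simp
  qed
  then have less: "(\<Sum>j<n. \<bar>x j - g j\<bar>) < (\<Sum>j<n. \<bar>x j\<bar>)"
    using g1(2) j1(1) by (intro sum_strict_mono_ex1) auto
  have "row g i \<le> 0 \<and> row x i - row g i \<le> w i" if i: "i < m" for i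
  proof (cases "i \<in> R")
    case True
    then show ?thesis using gR x i by (simp add: feas_def)
  next
    case False
    note far = far[OF i False]
    have "row g i \<le> 0" by (rule gneg[OF i]) (use far in linarith)
    moreover have "row x i - \<lfloor>of_int (row x i) / real_of_int N\<rfloor> \<le> - \<bar>w i\<bar>"
      by (rule floor_division_gap) (use N1 N w0[OF i] far in auto)
    ultimately show ?thesis using g(3)[OF i] by linarith
  qed
  then have "ray g" "feas (\<lambda>j. x j - g j)"
    using g1(1) by (auto simp: ray_def feas_def row_diff)
  then show ?thesis using that less by blast
qed

text \<open>Rays are split off until no entry exceeds \<beta>; each one lowers the sum of the
  absolute entries. P carries what the reduction preserves: the quadratic coordinates, a bound on
  the objective, or nothing.\<close>

lemma reduce_to_box:
  assumes \<beta>: "(\<Sum>i<m. \<bar>w i\<bar>) \<le> \<beta>"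
    and step: "\<And>x g. P x \<Longrightarrow> ray g \<Longrightarrow> P (\<lambda>j. x j - g j)"
    and x: "feas x" "P x"
  shows "\<exists>y. feas y \<and> P y \<and> (\<forall>j<n. \<bar>y j\<bar> \<le> \<beta>)"
  using x
proof (induction "nat (\<Sum>j<n. \<bar>x j\<bar>)" arbitrary: x rule: less_induct)
  case less
  show ?case
  proof (cases "\<exists>j0<n. \<bar>x j0\<bar> > \<beta>")
    case True
    then obtain g where g: "ray g" "feas (\<lambda>j. x j - g j)" "(\<Sum>j<n. \<bar>x j - g j\<bar>) < (\<Sum>j<n. \<bar>x j\<bar>)"
      using split_off_ray[OF less.prems(1) _ _ \<beta>] by metis
    have "(\<Sum>j<n. \<bar>x j - g j\<bar>) \<ge> 0" by (simp add: sum_nonneg)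
    with g(3) have "nat (\<Sum>j<n. \<bar>x j - g j\<bar>) < nat (\<Sum>j<n. \<bar>x j\<bar>)" by linarith
    from less.hyps[OF this g(2) step[OF less.prems(2) g(1)]] show ?thesis .
  next
    case False
    then show ?thesis using less.prems by (intro exI[of _ x]) auto
  qed
qed

end

section \<open>Concave minimization\<close>

lemma digits_exist:
  fixes g :: int and e :: "nat \<Rightarrow> int"
  assumes g: "g \<ge> 1" and e: "\<And>i. i < k \<Longrightarrow> 0 \<le> e i \<and> e i < g"
  shows "\<exists>t. 0 \<le> t \<and> t < g ^ k \<and> (\<forall>i<k. (t div g ^ i) mod g = e i)"
  using e
proof (induction k)
  case (Suc k)
  then obtain t where t: "0 \<le> t" "t < g ^ k" "\<forall>i<k. (t div g ^ i) mod g = e i" by force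
  define t' where "t' = t + g ^ k * e k"
  have pos: "g ^ k > 0" for k using g by simp
  have ek: "0 \<le> e k" "e k + 1 \<le> g" using Suc.prems[of k] by auto
  have "g ^ k * (e k + 1) \<le> g ^ k * g" using ek pos[of k] by (intro mult_left_mono) auto
  then have "0 \<le> t'" "t' < g ^ Suc k" using t ek pos[of k] by (auto simp: t'_def algebra_simps)
  moreover have "(t' div g ^ i) mod g = e i" if "i < Suc k" for i
  proof (cases "i = k")
    case True
    then show ?thesis using t ek pos[of k] by (simp add: t'_def)
  next
    case False
    then have "i < k" using that by simp
    then obtain d where d: "k = i + Suc d" using less_imp_Suc_add[of i k] by auto
    have "t' = t + g ^ i * (g * g ^ d * e k)" by (simp add: t'_def d power_add mult_ac)
    also have "\<dots> div g ^ i = g * g ^ d * e k + t div g ^ i"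
      by (rule div_mult_self2) (use g in simp)
    finally have "t' div g ^ i = t div g ^ i + g * (g ^ d * e k)" by simp
    then show ?thesis using t(3) False that by simp
  qed
  ultimately show ?case by blast
qed (simp add: exI[of _ "0::int"])

text \<open>Only inequalities are required of \<beta> and \<open>T\<close>, so that the program may
  use any bounds that it can compute: \<beta> is the radius to which points are reduced, and
  \<open>T\<close> bounds the objective there.\<close>

locale concave_iqp = tu_system +
  fixes k :: nat and q h :: "nat \<Rightarrow> int" and \<beta> T :: int
  assumes k: "k \<le> n" and q: "\<And>i. i < k \<Longrightarrow> q i > 0"
    and \<beta>: "(\<Sum>i<m. \<bar>w i\<bar>) \<le> \<beta>"
    and T: "(\<Sum>i<k. q i) * \<beta>\<^sup>2 + (\<Sum>j<n. \<bar>h j\<bar>) * \<beta> \<le> T"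
begin

definition f :: "(nat \<Rightarrow> int) \<Rightarrow> int" where
  "f x = (\<Sum>i<k. - (q i) * (x i)\<^sup>2) + (\<Sum>j<n. h j * x j)"

text \<open>Room for K = 3 T + 2 \<beta> + 1 steps along a ray from any point of radius \<beta>. A
  coordinate that moves K steps ends outside [-\<beta>, \<beta>], and a linear decrease by K exceeds
  3 T.\<close>

definition B :: int where
  "B = 3 * T + 3 * \<beta> + 1"

definition in_box :: "int \<Rightarrow> (nat \<Rightarrow> int) \<Rightarrow> bool" where
  "in_box b x \<longleftrightarrow> (\<forall>j<n. \<bar>x j\<bar> \<le> b)"

text \<open>The criterion for boundedness below on a nonempty feasible set: a ray that moves a
  quadratic coordinate, or decreases the linear part, drives the concave objective to minus
  infinity.\<close>

definition rays_good :: bool where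
  "rays_good \<longleftrightarrow> (\<forall>g. ray g \<longrightarrow> (\<forall>i<k. g i = 0) \<and> 0 \<le> (\<Sum>j<n. h j * g j))"

lemma \<beta>_nonneg: "0 \<le> \<beta>"
proof -
  have "0 \<le> (\<Sum>i<m. \<bar>w i\<bar>)" by (rule sum_nonneg) simp
  then show ?thesis using \<beta> by linarith
qed

lemma sum_q_nonneg: "0 \<le> (\<Sum>i<k. q i)"
  by (rule sum_nonneg) (use q in force)

lemma T_ge: "(\<Sum>i<k. q i) * \<beta>\<^sup>2 \<le> T"
proof -
  have "0 \<le> (\<Sum>j<n. \<bar>h j\<bar>) * \<beta>" using \<beta>_nonneg by (simp add: sum_nonneg)
  then show ?thesis using T by linarith
qed

lemma T_nonneg: "0 \<le> T"
  using T_ge sum_q_nonneg by (meson mult_nonneg_nonneg order_trans zero_le_power2)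

lemma f_cong: "(\<And>j. j < n \<Longrightarrow> x j = y j) \<Longrightarrow> f x = f y"
  using k unfolding f_def by (intro arg_cong2[where f = "(+)"] sum.cong) auto

lemma f_small_box:
  assumes "in_box \<beta> x"
  shows "\<bar>f x\<bar> \<le> T"
proof -
  have "(x i)\<^sup>2 \<le> \<beta>\<^sup>2" if "i < k" for i
  proof -
    have "\<bar>x i\<bar> \<le> \<bar>\<beta>\<bar>" using assms that k \<beta>_nonneg by (simp add: in_box_def)
    then show ?thesis by (simp add: abs_le_square_iff)
  qed
  then have "\<bar>\<Sum>i<k. - (q i) * (x i)\<^sup>2\<bar> \<le> (\<Sum>i<k. q i * \<beta>\<^sup>2)"
    using q by (intro order_trans[OF sum_abs] sum_mono) (simp add: abs_mult mult_left_mono less_imp_le)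
  moreover have "\<bar>\<Sum>j<n. h j * x j\<bar> \<le> (\<Sum>j<n. \<bar>h j\<bar> * \<beta>)"
    using assms by (intro order_trans[OF sum_abs] sum_mono) (simp add: abs_mult mult_left_mono in_box_def)
  ultimately show ?thesis using T unfolding f_def sum_distrib_right by linarith
qed

lemma f_add_mult:
  "f (\<lambda>j. x j + t * g j) = f x + t * ((\<Sum>j<n. h j * g j) - 2 * (\<Sum>i<k. q i * x i * g i)) - t\<^sup>2 * (\<Sum>i<k. q i * (g i)\<^sup>2)"
proof -
  have "(\<Sum>i<k. - (q i) * (x i + t * g i)\<^sup>2) =
    (\<Sum>i<k. - (q i) * (x i)\<^sup>2 - 2 * t * (q i * x i * g i) - t\<^sup>2 * (q i * (g i)\<^sup>2))"
    by (rule sum.cong) (simp_all add: power2_eq_square algebra_simps)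
  also have "\<dots> = (\<Sum>i<k. - (q i) * (x i)\<^sup>2) - 2 * t * (\<Sum>i<k. q i * x i * g i) - t\<^sup>2 * (\<Sum>i<k. q i * (g i)\<^sup>2)"
    by (simp add: sum_subtractf sum_distrib_left)
  finally show ?thesis
    by (simp add: f_def algebra_simps sum.distrib sum_distrib_left)
qed

text \<open>Stated for the first half of \<open>rays_good\<close> alone, because
  \<open>small_bounds_cover\<close> uses it before boundedness is known.\<close>

lemma reduce_fixed:
  assumes "\<forall>g. ray g \<longrightarrow> (\<forall>i<k. g i = 0)" and "feas x"
  obtains y where "feas y" "in_box \<beta> y" "\<forall>i<k. y i = x i"
proof -
  have "\<exists>y. feas y \<and> (\<forall>i<k. y i = x i) \<and> (\<forall>j<n. \<bar>y j\<bar> \<le> \<beta>)"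
    by (rule reduce_to_box[OF \<beta>, where P = "\<lambda>y. \<forall>i<k. y i = x i"]) (use assms in auto)
  then show ?thesis using that by (auto simp: in_box_def)
qed

lemma reduce_small:
  assumes "feas x"
  obtains y where "feas y" "in_box \<beta> y"
proof -
  have "\<exists>y. feas y \<and> True \<and> (\<forall>j<n. \<bar>y j\<bar> \<le> \<beta>)"
    by (rule reduce_to_box[OF \<beta>, where P = "\<lambda>y. True"]) (use assms in auto)
  then show ?thesis using that by (auto simp: in_box_def)
qed

text \<open>Subtracting a good ray leaves the quadratic part unchanged and lowers the linear part by
  a nonnegative amount.\<close>

lemma reduce_good:
  assumes good: rays_good and "feas x"
  obtains y where "feas y" "in_box \<beta> y" "f y \<le> f x"
proof -
  have "f (\<lambda>j. z j - g j) \<le> f z" if "ray g" for z g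
  proof -
    have g: "g i = 0" if "i < k" for i using good \<open>ray g\<close> that by (auto simp: rays_good_def)
    have "f (\<lambda>j. z j + (-1) * g j) = f z - (\<Sum>j<n. h j * g j)"
      unfolding f_add_mult by (simp add: g)
    then show ?thesis using good \<open>ray g\<close> by (simp add: rays_good_def)
  qed
  then have step: "f (\<lambda>j. z j - g j) \<le> f x" if "f z \<le> f x" "ray g" for z g
    using that order_trans by blast
  have "\<exists>y. feas y \<and> f y \<le> f x \<and> (\<forall>j<n. \<bar>y j\<bar> \<le> \<beta>)"
    by (rule reduce_to_box[OF \<beta>, where P = "\<lambda>y. f y \<le> f x"]) (use assms step in auto)
  then show ?thesis using that by (auto simp: in_box_def)
qed

text \<open>Along the ray the value is f x + t l - t^2 Q. If a quadratic coordinate moves, then Q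
  \<ge> 1 and the last term dominates; otherwise l is a negative integer.\<close>

lemma not_good_unbounded:
  assumes bad: "\<not> rays_good" and x: "feas x"
  obtains y where "feas y" "f y < L"
proof -
  obtain g where g: "ray g" "(\<exists>i<k. g i \<noteq> 0) \<or> (\<Sum>j<n. h j * g j) < 0"
    using bad unfolding rays_good_def by fastforce
  define Q where "Q = (\<Sum>i<k. q i * (g i)\<^sup>2)"
  define l where "l = (\<Sum>j<n. h j * g j) - 2 * (\<Sum>i<k. q i * x i * g i)"
  have Q0: "Q \<ge> 0" unfolding Q_def by (rule sum_nonneg) (use q in \<open>force intro: mult_nonneg_nonneg\<close>)
  define D where "D = \<bar>f x - L\<bar>"
  \<comment> \<open>One choice for both cases: t |l| - t^2 = -t (D + 1) when Q \<ge> 1, and t l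
    \<le> -t \<le> -(D + 1) when l \<le> -1.\<close>
  define t where "t = \<bar>l\<bar> + D + 1"
  have t: "t \<ge> 1" by (simp add: t_def D_def)
  have y: "f (\<lambda>j. x j + t * g j) = f x + t * l - t\<^sup>2 * Q" unfolding f_add_mult l_def Q_def ..
  have "t * l - t\<^sup>2 * Q \<le> - (D + 1)"
  proof (cases "\<exists>i<k. g i \<noteq> 0")
    case True
    then obtain i where i: "i < k" "g i \<noteq> 0" by blast
    have "q i * (g i)\<^sup>2 \<le> Q" unfolding Q_def
      by (rule member_le_sum) (use i q in \<open>force intro: mult_nonneg_nonneg\<close>)+
    moreover have "q i * (g i)\<^sup>2 > 0" using i q by simp
    ultimately have "t\<^sup>2 \<le> t\<^sup>2 * Q" using mult_left_mono[of 1 Q "t\<^sup>2"] by simp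
    moreover have "t * l \<le> t * \<bar>l\<bar>" using t by (intro mult_left_mono) auto
    moreover have "t * \<bar>l\<bar> - t\<^sup>2 = - (t * (D + 1))" by (simp add: t_def power2_eq_square algebra_simps)
    moreover have "D + 1 \<le> t * (D + 1)" using t mult_right_mono[of 1 t "D + 1"] by (simp add: D_def)
    ultimately show ?thesis by linarith
  next
    case False
    then have "l = (\<Sum>j<n. h j * g j)" by (simp add: l_def)
    then have "l \<le> - 1" using g(2) False by auto
    then have "t * l \<le> t * (- 1)" using t by (intro mult_left_mono) auto
    moreover have "t\<^sup>2 * Q \<ge> 0" using Q0 by simp
    ultimately show ?thesis using t_def abs_ge_zero[of l] by linarith
  qed
  then have "f (\<lambda>j. x j + t * g j) < L" unfolding y D_def by linarith
  moreover have "feas (\<lambda>j. x j + t * g j)" by (rule feas_ray[OF x g(1)]) (use t in simp)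
  ultimately show ?thesis using that by blast
qed

lemma box_ray:
  assumes "in_box \<beta> x" "ray g"
  shows "in_box B (\<lambda>j. x j + (3 * T + 2 * \<beta> + 1) * g j)"
  unfolding in_box_def
proof (intro allI impI)
  fix j assume j: "j < n"
  have "\<bar>(3 * T + 2 * \<beta> + 1) * g j\<bar> \<le> (3 * T + 2 * \<beta> + 1) * 1"
    unfolding abs_mult using assms j T_nonneg \<beta>_nonneg by (intro mult_mono) (auto simp: ray_def)
  then show "\<bar>x j + (3 * T + 2 * \<beta> + 1) * g j\<bar> \<le> B"
    using assms(1) j unfolding in_box_def B_def by (smt (verit))
qed

lemma in_box_mono: "in_box b x \<Longrightarrow> b \<le> b' \<Longrightarrow> in_box b' x"
  unfolding in_box_def by force

lemma small_box: "in_box \<beta> x \<Longrightarrow> in_box B x"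
  by (erule in_box_mono) (use T_nonneg \<beta>_nonneg in \<open>simp add: B_def\<close>)

text \<open>Two-point estimate: on the integral points next to the midpoint of x and y the objective
  function is affine.\<close>

lemma midpoint_gap:
  assumes x: "feas x" and y: "feas y" and i: "i < k"
  obtains z where "feas z" "4 * f z \<ge> 2 * (f x + f y) + q i * ((x i - y i)\<^sup>2 - 1)"
proof -
  define s where "s j = x j + y j" for j
  \<comment> \<open>Near the midpoint (2 z - s)^2 is the parity of s, so 4 z^2 may be replaced by 4
    s z - s^2 + s mod 2; c is the coefficient vector of 4 f after this substitution.\<close>
  define c where "c j = 4 * h j - (if j < k then 4 * q j * s j else 0)" for j
  have "real_feas (\<lambda>j. of_int (s j) / 2)"
    unfolding real_feas_def
  proof (intro allI impI)
    fix i assume i: "i < m"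
    have "(\<Sum>j<n. of_int (a i j) * (of_int (s j) / 2)) = real_of_int (row x i + row y i) / 2"
      by (simp add: row_def s_def sum_divide_distrib algebra_simps sum.distrib add_divide_distrib)
    also have "\<dots> \<le> of_int (w i)" using x y i by (simp add: feas_def) (smt (verit) of_int_le_iff)
    finally show "(\<Sum>j<n. of_int (a i j) * (of_int (s j) / 2)) \<le> real_of_int (w i)" .
  qed
  \<comment> \<open>Rounding for -c makes the value of c at z at least its value at the
    midpoint.\<close>
  from real_feas_round[OF this, of "\<lambda>j. - of_int (c j)"]
  obtain z where z: "feas z" "\<forall>j<n. \<lfloor>real_of_int (s j) / 2\<rfloor> \<le> z j \<and> z j \<le> \<lceil>real_of_int (s j) / 2\<rceil>"
    "(\<Sum>j<n. - of_int (c j) * of_int (z j)) \<le> (\<Sum>j<n. - of_int (c j) * (real_of_int (s j) / 2))" by blast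
  have sq: "(2 * z j - s j)\<^sup>2 = s j mod 2" if "j < n" for j
  proof -
    have "real_of_int (s j) / 2 < of_int (z j) + 1" "of_int (z j) - 1 < real_of_int (s j) / 2"
      using z(2) that by (simp_all add: floor_le_iff le_ceiling_iff)
    then have "real_of_int (s j) < of_int (2 * z j + 2)" "real_of_int (2 * z j - 2) < of_int (s j)" by simp_all
    then have "s j < 2 * z j + 2" "2 * z j - 2 < s j" by (simp_all only: of_int_less_iff)
    then have "2 * z j - s j = - 1 \<or> 2 * z j - s j = 0 \<or> 2 * z j - s j = 1" by linarith
    then show ?thesis by (elim disjE) (simp_all, presburger+)
  qed
  have "real_of_int (\<Sum>j<n. 2 * (c j * z j)) \<ge> real_of_int (\<Sum>j<n. c j * s j)"
    using z(3) by (simp add: sum_negf sum_distrib_left[symmetric] sum_divide_distrib[symmetric])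
  then have cz: "(\<Sum>j<n. c j * s j) \<le> 2 * (\<Sum>j<n. c j * z j)" by (simp only: of_int_le_iff sum_distrib_left)
  have split: "(\<Sum>j<n. c j * u j) = 4 * (\<Sum>j<n. h j * u j) - 4 * (\<Sum>i<k. q i * s i * u i)" for u
  proof -
    have "(\<Sum>j<n. c j * u j) = (\<Sum>j<n. 4 * (h j * u j)) - (\<Sum>j<n. if j < k then 4 * (q j * s j * u j) else 0)"
      unfolding sum_subtractf[symmetric] by (rule sum.cong) (auto simp: c_def algebra_simps)
    also have "(\<Sum>j<n. if j < k then 4 * (q j * s j * u j) else 0) = (\<Sum>j<k. 4 * (q j * s j * u j))"
      using k by (intro sum.mono_neutral_cong_right) auto
    finally show ?thesis by (simp add: sum_distrib_left)
  qed
  have "4 * (- (q i) * (z i)\<^sup>2) = - (q i) * (4 * s i * z i - (s i)\<^sup>2 + s i mod 2)" if "i < k" for i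
  proof -
    have "(2 * z i - s i)\<^sup>2 = s i mod 2" using sq k that by simp
    then have "4 * (z i)\<^sup>2 = 4 * s i * z i - (s i)\<^sup>2 + s i mod 2" by (simp add: power2_eq_square algebra_simps)
    then show ?thesis by (metis mult.left_commute)
  qed
  then have "4 * (\<Sum>i<k. - (q i) * (z i)\<^sup>2) = (\<Sum>i<k. - (q i) * (4 * s i * z i - (s i)\<^sup>2 + s i mod 2))"
    unfolding sum_distrib_left by (intro sum.cong) simp_all
  also have "(\<Sum>i<k. - (q i) * (4 * s i * z i - (s i)\<^sup>2 + s i mod 2))
      = - 4 * (\<Sum>i<k. q i * s i * z i) + (\<Sum>i<k. q i * ((s i)\<^sup>2 - s i mod 2))"
    unfolding sum_distrib_left sum.distrib[symmetric] by (rule sum.cong) (simp_all add: algebra_simps)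
  finally have fz: "4 * f z = (\<Sum>j<n. c j * z j) + (\<Sum>i<k. q i * ((s i)\<^sup>2 - s i mod 2))"
    unfolding split f_def distrib_left by simp
  have "2 * (f x + f y) = 2 * (\<Sum>j<n. h j * s j) - (\<Sum>i<k. q i * ((s i)\<^sup>2 + (x i - y i)\<^sup>2))"
    unfolding f_def s_def
    by (simp add: distrib_left sum_distrib_left power2_eq_square algebra_simps sum.distrib sum_subtractf sum_negf)
  moreover have "(\<Sum>i<k. q i * s i * s i) = (\<Sum>i<k. q i * (s i)\<^sup>2)" by (simp add: power2_eq_square algebra_simps)
  ultimately have "4 * f z - 2 * (f x + f y) \<ge> - 2 * (\<Sum>i<k. q i * (s i)\<^sup>2) + (\<Sum>i<k. q i * ((s i)\<^sup>2 - s i mod 2))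
      + (\<Sum>i<k. q i * ((s i)\<^sup>2 + (x i - y i)\<^sup>2))"
    using cz fz split[of s] by linarith
  also have "- 2 * (\<Sum>i<k. q i * (s i)\<^sup>2) + (\<Sum>i<k. q i * ((s i)\<^sup>2 - s i mod 2))
      + (\<Sum>i<k. q i * ((s i)\<^sup>2 + (x i - y i)\<^sup>2)) = (\<Sum>i<k. q i * ((x i - y i)\<^sup>2 - s i mod 2))"
    unfolding sum_distrib_left sum.distrib[symmetric] by (rule sum.cong) (simp_all add: algebra_simps)
  finally have "4 * f z - 2 * (f x + f y) \<ge> (\<Sum>i<k. q i * ((x i - y i)\<^sup>2 - s i mod 2))" .
  moreover have "q i * ((x i - y i)\<^sup>2 - s i mod 2) \<le> (\<Sum>i<k. q i * ((x i - y i)\<^sup>2 - s i mod 2))"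
  proof (rule member_le_sum)
    fix l assume l: "l \<in> {..<k} - {i}"
    \<comment> \<open>The terms of the other coordinates are nonnegative: for x l = y l the sum s l
      is even, otherwise the square is at least 1.\<close>
    have "s l mod 2 \<le> (x l - y l)\<^sup>2"
    proof (cases "x l = y l")
      case True then show ?thesis by (simp add: s_def)
    next
      case False
      then have "(x l - y l)\<^sup>2 > 0" by simp
      moreover have "s l mod 2 < 2" by simp
      ultimately show ?thesis by linarith
    qed
    then show "0 \<le> q l * ((x l - y l)\<^sup>2 - s l mod 2)" using q[of l] l by simp
  qed (use i in auto)
  moreover have "q i * ((x i - y i)\<^sup>2 - 1) \<le> q i * ((x i - y i)\<^sup>2 - s i mod 2)"
    using q[OF i] by (intro mult_left_mono) auto
  ultimately show ?thesis using that[OF z(1)] by linarith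
qed

text \<open>The box is cut into g^k pieces; the base-g digits of t select the piece with number t.
  The cap by u keeps the size of the bounds independent of g.\<close>

definition piece_lo :: "(nat \<Rightarrow> int) \<Rightarrow> (nat \<Rightarrow> int) \<Rightarrow> int \<Rightarrow> int \<Rightarrow> nat \<Rightarrow> int" where
  "piece_lo l u g t i = min (l i + ((t div g ^ i) mod g) * ((u i - l i) div g + 1)) (u i)"

text \<open>Not capped, so that all pieces have the same width in a coordinate. A solution beyond
  \<open>u\<close> is still a feasible point, and its true objective value is used.\<close>

definition piece_up :: "(nat \<Rightarrow> int) \<Rightarrow> (nat \<Rightarrow> int) \<Rightarrow> int \<Rightarrow> int \<Rightarrow> nat \<Rightarrow> int" where
  "piece_up l u g t i = piece_lo l u g t i + (u i - l i) div g"

definition in_piece :: "(nat \<Rightarrow> int) \<Rightarrow> (nat \<Rightarrow> int) \<Rightarrow> int \<Rightarrow> int \<Rightarrow> (nat \<Rightarrow> int) \<Rightarrow> bool" where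
  "in_piece l u g t x \<longleftrightarrow> (\<forall>i<k. piece_lo l u g t i \<le> x i \<and> x i \<le> piece_up l u g t i)"

text \<open>The chord of -q x^2 over [lo, up] is -q (lo + up) x + q lo up; the constant is left out
  because chords are compared within one piece only.\<close>

definition chord_slope :: "(nat \<Rightarrow> int) \<Rightarrow> (nat \<Rightarrow> int) \<Rightarrow> int \<Rightarrow> int \<Rightarrow> nat \<Rightarrow> int" where
  "chord_slope l u g t j = h j - (if j < k then q j * (piece_lo l u g t j + piece_up l u g t j) else 0)"

text \<open>On integers (x - lo)(lo + d - x) is at most the floor of d^2 / 4. Rounding down matters:
  width at most 1 gives no error.\<close>

definition chord_error :: "(nat \<Rightarrow> int) \<Rightarrow> (nat \<Rightarrow> int) \<Rightarrow> int \<Rightarrow> int" where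
  "chord_error l u g = (\<Sum>i<k. q i * (((u i - l i) div g)\<^sup>2 div 4))"

text \<open>A piece holds s = D div g + 1 integers per coordinate, where D is the width of the
  range, and g s > D; so (x - l) div s is a digit below g.\<close>

lemma piece_cover:
  assumes g: "g \<ge> 1" and x: "\<And>i. i < k \<Longrightarrow> l i \<le> x i \<and> x i \<le> u i"
  shows "\<exists>t. 0 \<le> t \<and> t < g ^ k \<and> in_piece l u g t x"
proof -
  define s where "s i = (u i - l i) div g + 1" for i
  define e where "e i = (x i - l i) div s i" for i
  have s: "s i > 0" if "i < k" for i
    using x[OF that] g by (simp add: s_def pos_imp_zdiv_nonneg_iff add_nonneg_pos)
  have e: "0 \<le> e i \<and> e i < g" if "i < k" for i
  proof
    show "0 \<le> e i" using x[OF that] s[OF that] by (simp add: e_def pos_imp_zdiv_nonneg_iff)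
    have "u i - l i = g * ((u i - l i) div g) + (u i - l i) mod g" by simp
    moreover have "(u i - l i) mod g < g" using g by simp
    moreover have "g * s i = g * ((u i - l i) div g) + g" by (simp add: s_def algebra_simps)
    ultimately have "x i - l i < g * s i" using x[OF that] by linarith
    moreover have "e i * s i \<le> x i - l i"
      using s[OF that] pos_mod_sign[of "s i" "x i - l i"] minus_mod_eq_div_mult[of "x i - l i" "s i"] unfolding e_def by linarith
    ultimately have "e i * s i < g * s i" by linarith
    then show "e i < g" using s[OF that] by (simp add: mult_less_cancel_right)
  qed
  have "\<exists>t. 0 \<le> t \<and> t < g ^ k \<and> (\<forall>i<k. (t div g ^ i) mod g = e i)"
    by (rule digits_exist[OF g]) (rule e)
  then obtain t where t: "0 \<le> t" "t < g ^ k" "\<forall>i<k. (t div g ^ i) mod g = e i" by blast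
  have "piece_lo l u g t i \<le> x i \<and> x i \<le> piece_up l u g t i" if i: "i < k" for i
  proof -
    have eq: "x i - l i = e i * s i + (x i - l i) mod s i" by (simp add: e_def)
    have m: "0 \<le> (x i - l i) mod s i" "(x i - l i) mod s i < s i" using s[OF i] by simp_all
    have "(t div g ^ i) mod g = e i" using t(3) i by blast
    then have "piece_lo l u g t i = min (l i + e i * s i) (u i)" by (simp only: piece_lo_def s_def)
    \<comment> \<open>The cap is inactive on the piece that contains x, whose uncapped left end is
      at most \<open>x i\<close>.\<close>
    also have "\<dots> = l i + e i * s i" using x[OF i] eq m by linarith
    finally have "piece_lo l u g t i = l i + e i * s i" .
    moreover from this have "piece_up l u g t i = l i + e i * s i + s i - 1" by (simp add: piece_up_def s_def)
    ultimately show ?thesis using eq m by linarith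
  qed
  then show ?thesis using t by (auto simp: in_piece_def)
qed

lemma parabola_bound:
  fixes x lo d :: int
  assumes "lo \<le> x" "x \<le> lo + d"
  shows "0 \<le> (x - lo) * (lo + d - x)" "(x - lo) * (lo + d - x) \<le> d\<^sup>2 div 4"
proof -
  show "0 \<le> (x - lo) * (lo + d - x)" using assms by simp
  have "4 * ((x - lo) * (lo + d - x)) = d\<^sup>2 - (2 * (x - lo) - d)\<^sup>2" by (simp add: power2_eq_square algebra_simps)
  then have "4 * ((x - lo) * (lo + d - x)) \<le> d\<^sup>2" using zero_le_power2[of "2 * (x - lo) - d"] by linarith
  then show "(x - lo) * (lo + d - x) \<le> d\<^sup>2 div 4" by linarith
qed

text \<open>The objective minus the chords is the sum of q (x - lo)(up - x), which lies between 0
  and \<open>chord_error\<close> on the piece. Comparing chords therefore compares f up to that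
  error.\<close>

lemma piece_compare:
  assumes x: "in_piece l u g t x" and y: "in_piece l u g t y"
    and le: "(\<Sum>j<n. chord_slope l u g t j * x j) \<le> (\<Sum>j<n. chord_slope l u g t j * y j)"
  shows "f x \<le> f y + chord_error l u g"
proof -
  define lo where "lo = piece_lo l u g t"
  define d where "d i = (u i - l i) div g" for i
  have up: "piece_up l u g t i = lo i + d i" for i by (simp add: piece_up_def lo_def d_def)
  define K where "K = (\<Sum>i<k. q i * lo i * (lo i + d i))"
  have eq: "f z = (\<Sum>j<n. chord_slope l u g t j * z j) + K + (\<Sum>i<k. q i * ((z i - lo i) * (lo i + d i - z i)))" for z
  proof -
    have "(\<Sum>j<n. chord_slope l u g t j * z j) = (\<Sum>j<n. h j * z j) - (\<Sum>j<n. if j < k then q j * (2 * lo j + d j) * z j else 0)"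
      unfolding sum_subtractf[symmetric] by (rule sum.cong) (auto simp: chord_slope_def up lo_def[symmetric] algebra_simps)
    also have "(\<Sum>j<n. if j < k then q j * (2 * lo j + d j) * z j else 0) = (\<Sum>j<k. q j * (2 * lo j + d j) * z j)"
      using k by (intro sum.mono_neutral_cong_right) auto
    finally have "(\<Sum>j<n. chord_slope l u g t j * z j) + K + (\<Sum>i<k. q i * ((z i - lo i) * (lo i + d i - z i)))
       = (\<Sum>j<n. h j * z j) + ((\<Sum>i<k. q i * lo i * (lo i + d i)) + (\<Sum>i<k. q i * ((z i - lo i) * (lo i + d i - z i)))
         - (\<Sum>j<k. q j * (2 * lo j + d j) * z j))" by (simp add: K_def)
    also have "(\<Sum>i<k. q i * lo i * (lo i + d i)) + (\<Sum>i<k. q i * ((z i - lo i) * (lo i + d i - z i)))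
         - (\<Sum>j<k. q j * (2 * lo j + d j) * z j) = (\<Sum>i<k. - (q i) * (z i)\<^sup>2)"
      unfolding sum.distrib[symmetric] sum_subtractf[symmetric]
      by (rule sum.cong) (simp_all add: power2_eq_square algebra_simps)
    finally show ?thesis by (simp add: f_def)
  qed
  have "(\<Sum>i<k. q i * ((x i - lo i) * (lo i + d i - x i))) \<le> chord_error l u g"
    unfolding chord_error_def d_def[symmetric]
    using x q by (intro sum_mono mult_left_mono parabola_bound) (auto simp: in_piece_def up lo_def less_imp_le)
  moreover have "0 \<le> (\<Sum>i<k. q i * ((y i - lo i) * (lo i + d i - y i)))"
    using y q by (intro sum_nonneg mult_nonneg_nonneg) (auto simp: in_piece_def up lo_def less_imp_le)
  ultimately show ?thesis using le unfolding eq[of x] eq[of y] by linarith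
qed

section \<open>Reading boundedness off the ranges of the quadratic variables\<close>

definition exact_bounds :: "(nat \<Rightarrow> int) \<Rightarrow> (nat \<Rightarrow> int) \<Rightarrow> bool" where
  "exact_bounds l u \<longleftrightarrow> (\<forall>i<k. (\<exists>x. feas x \<and> x i = l i) \<and> (\<exists>x. feas x \<and> x i = u i) \<and>
     (\<forall>y. feas y \<and> in_box B y \<longrightarrow> l i \<le> y i \<and> y i \<le> u i))"

definition small_bounds :: "(nat \<Rightarrow> int) \<Rightarrow> (nat \<Rightarrow> int) \<Rightarrow> bool" where
  "small_bounds l u \<longleftrightarrow> (\<forall>i<k. \<bar>l i\<bar> \<le> \<beta> \<and> \<bar>u i\<bar> \<le> \<beta>)"

text \<open>With good rays every feasible point reduces to radius \<beta> without changing its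
  quadratic coordinates, so an attained end of a range cannot lie farther out.\<close>

lemma large_bounds_not_good:
  assumes lu: "exact_bounds l u" and large: "\<not> small_bounds l u"
  shows "\<not> rays_good"
proof
  assume good: rays_good
  obtain i where i: "i < k" "\<bar>l i\<bar> > \<beta> \<or> \<bar>u i\<bar> > \<beta>" using large by (force simp: small_bounds_def)
  then obtain x where x: "feas x" "\<bar>x i\<bar> > \<beta>" using lu unfolding exact_bounds_def by metis
  have "\<forall>g. ray g \<longrightarrow> (\<forall>i<k. g i = 0)" using good unfolding rays_good_def by blast
  then obtain y where y: "in_box \<beta> y" "\<forall>i<k. y i = x i"
    using x(1) by (rule reduce_fixed)
  moreover have "i < n" using i(1) k by simp
  ultimately have "\<bar>y i\<bar> \<le> \<beta>" unfolding in_box_def by blast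
  moreover have "y i = x i" using y(2) i(1) by blast
  ultimately show False using x(2) by simp
qed

text \<open>K steps along the ray from a point of radius \<beta> stay in the box of radius
  \<open>B\<close>, where the ranges are valid; a moving coordinate would change by more than 2
  \<beta>.\<close>

lemma small_bounds_rays:
  assumes lu: "exact_bounds l u" and small: "small_bounds l u" and x0: "feas x0"
    and g: "ray g" and i: "i < k"
  shows "g i = 0"
proof (rule ccontr)
  assume gi: "g i \<noteq> 0"
  define K where "K = 3 * T + 2 * \<beta> + 1"
  obtain x where x: "feas x" "in_box \<beta> x" using reduce_small[OF x0] by blast
  have "in_box B (\<lambda>j. x j + K * g j)" unfolding K_def by (rule box_ray[OF x(2) g])
  moreover have "feas (\<lambda>j. x j + K * g j)"
    by (rule feas_ray[OF x(1) g]) (use T_nonneg \<beta>_nonneg in \<open>simp add: K_def\<close>)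
  ultimately have "l i \<le> x i + K * g i \<and> x i + K * g i \<le> u i" using lu i unfolding exact_bounds_def by blast
  then have "\<bar>x i + K * g i\<bar> \<le> \<beta>" using small i unfolding small_bounds_def by (smt (verit))
  moreover have "\<bar>x i\<bar> \<le> \<beta>" using x(2) i k by (simp add: in_box_def)
  moreover have "g i = 1 \<or> g i = - 1" using g gi i k by (auto simp: ray_def) (smt (verit) order_less_le_trans)
  ultimately show False using T_nonneg \<beta>_nonneg unfolding K_def by auto
qed

text \<open>The ranges are known only inside the box. Small ranges make all rays fix the quadratic
  coordinates, so every feasible point has a counterpart in the box with the same ones.\<close>

lemma small_bounds_cover:
  assumes lu: "exact_bounds l u" and small: "small_bounds l u" and x: "feas x" and i: "i < k"
  shows "l i \<le> x i \<and> x i \<le> u i"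
proof -
  have "\<forall>g. ray g \<longrightarrow> (\<forall>i<k. g i = 0)" using small_bounds_rays[OF lu small x] by blast
  then obtain y where y: "feas y" "in_box \<beta> y" "\<forall>i<k. y i = x i"
    using x by (rule reduce_fixed)
  then have "l i \<le> y i \<and> y i \<le> u i" using lu i small_box unfolding exact_bounds_def by blast
  then show ?thesis using y(3) i by simp
qed

text \<open>A small range is at most 2 \<beta> wide, so a quarter of the squared piece width is at
  most \<beta>^2, and the first summand in the bound for \<open>T\<close> covers the sum.\<close>

lemma chord_error_le:
  assumes lu: "exact_bounds l u" and small: "small_bounds l u" and x0: "feas x0" and g: "g \<ge> 1"
  shows "chord_error l u g \<le> T"
proof -
  have "((u i - l i) div g)\<^sup>2 div 4 \<le> \<beta>\<^sup>2" if i: "i < k" for i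
  proof -
    have D: "0 \<le> u i - l i" "u i - l i \<le> 2 * \<beta>"
      using small_bounds_cover[OF lu small x0 i] small i unfolding small_bounds_def by (smt (verit))+
    have "(u i - l i) div g \<le> u i - l i" using D(1) g by (smt (verit) int_div_less_self div_by_1 div_0)
    moreover have "0 \<le> (u i - l i) div g" using D(1) g by (simp add: pos_imp_zdiv_nonneg_iff)
    ultimately have "((u i - l i) div g)\<^sup>2 \<le> (2 * \<beta>)\<^sup>2" using D by (intro power_mono) auto
    then show ?thesis by (simp add: power_mult_distrib)
  qed
  then have "chord_error l u g \<le> (\<Sum>i<k. q i * \<beta>\<^sup>2)"
    unfolding chord_error_def using q by (intro sum_mono mult_left_mono) (auto simp: less_imp_le)
  then show ?thesis using T_ge by (simp add: sum_distrib_right)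
qed

definition near_optimal :: "(nat \<Rightarrow> int) \<Rightarrow> (nat \<Rightarrow> int) \<Rightarrow> int \<Rightarrow> int \<Rightarrow> bool" where
  "near_optimal l u g v \<longleftrightarrow> (\<forall>y. feas y \<and> in_box B y \<longrightarrow> v \<le> f y + chord_error l u g)"

lemma good_lower_bound:
  assumes rays_good "feas x"
  shows "- T \<le> f x"
proof -
  obtain y where "in_box \<beta> y" "f y \<le> f x" using reduce_good[OF assms] by blast
  then show ?thesis using f_small_box[of y] by linarith
qed

text \<open>With small ranges only the linear part changes along a ray, and a bad ray lowers it by
  at least 1 per step. More than 3 T steps from a value at most T lead below -2 T, and the chord
  error adds at most T. With \<open>good_lower_bound\<close>, the threshold -T separates the bounded
  case from the unbounded one.\<close>

lemma not_good_value:
  assumes lu: "exact_bounds l u" and small: "small_bounds l u" and x0: "feas x0" and g: "g \<ge> 1"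
    and near: "near_optimal l u g v" and bad: "\<not> rays_good"
  shows "v < - T"
proof -
  obtain r where r: "ray r" "(\<exists>i<k. r i \<noteq> 0) \<or> (\<Sum>j<n. h j * r j) < 0"
    using bad unfolding rays_good_def by fastforce
  have rk: "r i = 0" if "i < k" for i by (rule small_bounds_rays[OF lu small x0 r(1) that])
  then have hr: "(\<Sum>j<n. h j * r j) \<le> - 1" using r(2) by force
  define K where "K = 3 * T + 2 * \<beta> + 1"
  have K: "K \<ge> 0" "K > 3 * T" using T_nonneg \<beta>_nonneg by (simp_all add: K_def)
  obtain x where x: "feas x" "in_box \<beta> x" using reduce_small[OF x0] by blast
  have "in_box B (\<lambda>j. x j + K * r j)" unfolding K_def by (rule box_ray[OF x(2) r(1)])
  moreover have "feas (\<lambda>j. x j + K * r j)" by (rule feas_ray[OF x(1) r(1) K(1)])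
  ultimately have "v \<le> f (\<lambda>j. x j + K * r j) + chord_error l u g" using near unfolding near_optimal_def by blast
  also have "f (\<lambda>j. x j + K * r j) = f x + K * (\<Sum>j<n. h j * r j)" unfolding f_add_mult by (simp add: rk)
  finally have "v \<le> f x + K * (\<Sum>j<n. h j * r j) + chord_error l u g" .
  moreover have "K * (\<Sum>j<n. h j * r j) \<le> K * (- 1)" using K hr by (intro mult_left_mono) auto
  moreover have "f x \<le> T" using f_small_box[OF x(2)] by linarith
  moreover have "chord_error l u g \<le> T" by (rule chord_error_le[OF lu small x0 g])
  ultimately show ?thesis using K(2) by linarith
qed

text \<open>\<kappa> stands for the number of quadratic variables. The assumption on g gives
  \<epsilon> g^2 \<ge> \<kappa> (1 + \<epsilon>); what remains is D^2 \<le> (1 + \<epsilon>)(D^2 -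
  1), that is 1 + \<epsilon> \<le> \<epsilon> D^2, and this follows from D^2 \<ge> 4 g^2.\<close>

lemma error_ratio:
  fixes \<epsilon> g D \<kappa> :: real
  assumes "0 < \<epsilon>" "\<epsilon> \<le> 1" "\<kappa> \<ge> 1" "g\<^sup>2 \<ge> \<kappa> * (1 + 1 / \<epsilon>)" "D\<^sup>2 \<ge> 4 * g\<^sup>2"
  shows "\<kappa> * D\<^sup>2 \<le> \<epsilon> * g\<^sup>2 * (D\<^sup>2 - 1)"
proof -
  have E: "\<epsilon> * g\<^sup>2 \<ge> \<kappa> * (\<epsilon> + 1)"
    using mult_left_mono[OF assms(4), of \<epsilon>] assms(1) by (simp add: algebra_simps)
  have "\<epsilon> * D\<^sup>2 \<ge> 4 * (\<epsilon> * g\<^sup>2)" using mult_left_mono[OF assms(5), of \<epsilon>] assms(1) by simp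
  moreover have "\<kappa> * (\<epsilon> + 1) \<ge> \<epsilon> + 1" using mult_right_mono[OF assms(3), of "\<epsilon> + 1"] assms(1) by simp
  ultimately have F: "\<epsilon> * D\<^sup>2 \<ge> 1 + \<epsilon>" using E assms(1) by linarith
  then have "D\<^sup>2 \<ge> 1" using assms(1) by (smt (verit) mult_less_cancel_left2)
  then have "\<epsilon> * g\<^sup>2 * (D\<^sup>2 - 1) \<ge> \<kappa> * (\<epsilon> + 1) * (D\<^sup>2 - 1)" using E by (intro mult_right_mono) auto
  moreover have "\<kappa> * ((\<epsilon> + 1) * (D\<^sup>2 - 1)) \<ge> \<kappa> * D\<^sup>2"
    using F assms(3) by (intro mult_left_mono) (auto simp: algebra_simps)
  ultimately show ?thesis by (simp add: mult.assoc)
qed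

text \<open>Each variable may contribute \<epsilon> gap / k. \<open>midpoint_gap\<close>, applied to
  two points at the ends of its range, bounds q (D^2 - 1) by 4 gap. An arbitrary upper bound G
  instead of a maximum lets the supremum be inserted without a maximizer.\<close>

lemma near_optimal_approx:
  fixes \<epsilon> :: real
  assumes lu: "exact_bounds l u" and small: "small_bounds l u" and good: rays_good
    and x: "feas x" and near: "near_optimal l u g (f x)" and \<epsilon>: "0 < \<epsilon>" "\<epsilon> \<le> 1"
    and g: "g \<ge> 1" "(of_int g)\<^sup>2 \<ge> real k * (1 + 1 / \<epsilon>)"
  obtains xs where "feas xs" "\<And>y. feas y \<Longrightarrow> f xs \<le> f y"
    "\<And>G. (\<And>y. feas y \<Longrightarrow> of_int (f y) \<le> G) \<Longrightarrow> of_int (f x - f xs) \<le> \<epsilon> * (G - of_int (f xs))"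
proof -
  \<comment> \<open>A minimizer in the small box by well-foundedness, since f + cap-like shift
    \<open>T\<close> is nonnegative there.\<close>
  have "\<exists>xs. (feas xs \<and> in_box \<beta> xs) \<and> (\<forall>y. feas y \<and> in_box \<beta> y \<longrightarrow> nat (f xs + T) \<le> nat (f y + T))"
    using ex_has_least_nat[of "\<lambda>y. feas y \<and> in_box \<beta> y" _ "\<lambda>y. nat (f y + T)"] reduce_small[OF x] by metis
  then obtain xs where xs: "feas xs" "in_box \<beta> xs"
    and mn: "\<And>y. feas y \<Longrightarrow> in_box \<beta> y \<Longrightarrow> nat (f xs + T) \<le> nat (f y + T)" by blast
  have least: "f xs \<le> f y" if y: "feas y" for y
  proof -
    obtain y' where y': "feas y'" "in_box \<beta> y'" "f y' \<le> f y" using reduce_good[OF good y] by blast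
    have "f xs \<le> f y'" using mn[OF y'(1,2)] f_small_box[OF y'(2)] f_small_box[OF xs(2)] by linarith
    then show ?thesis using y'(3) by simp
  qed
  have "of_int (f x - f xs) \<le> \<epsilon> * (G - of_int (f xs))" if G: "\<And>y. feas y \<Longrightarrow> of_int (f y) \<le> G" for G
  proof -
    define gap where "gap = G - of_int (f xs)"
    have gap0: "gap \<ge> 0" using G[OF xs(1)] by (simp add: gap_def)
    have "of_int (q i * (((u i - l i) div g)\<^sup>2 div 4)) \<le> \<epsilon> * gap / real k" if i: "i < k" for i
    proof -
      define D where "D = u i - l i"
      have D: "D \<ge> 0" using small_bounds_cover[OF lu small x i] by (simp add: D_def)
      have dg: "0 \<le> D div g" using D g(1) by (simp add: pos_imp_zdiv_nonneg_iff)
      show ?thesis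
      proof (cases "D div g \<le> 1")
        \<comment> \<open>Pieces of width at most 1 contribute no error, so the estimate below may
          assume D \<ge> 2 g.\<close>
        case True
        then have "D div g = 0 \<or> D div g = 1" using dg by linarith
        then have "(D div g)\<^sup>2 div 4 = 0" by auto
        then show ?thesis using gap0 \<epsilon> by (simp add: D_def)
      next
        case False
        have gD: "g * (D div g) \<le> D" using g(1) by (smt (verit) minus_mult_div_eq_mod pos_mod_sign)
        have "g * 2 \<le> g * (D div g)" using False g(1) by (intro mult_left_mono) auto
        with gD have "g * 2 \<le> D" by linarith
        then have "(g * 2)\<^sup>2 \<le> D\<^sup>2" using g(1) by (intro power_mono) auto
        then have "real_of_int ((g * 2)\<^sup>2) \<le> of_int (D\<^sup>2)" by (simp only: of_int_le_iff)
        then have D4: "4 * (real_of_int g)\<^sup>2 \<le> (real_of_int D)\<^sup>2" by (simp add: power_mult_distrib)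
        obtain a b where ab: "feas a" "a i = l i" "feas b" "b i = u i" using lu i unfolding exact_bounds_def by blast
        obtain z where z: "feas z" "4 * f z \<ge> 2 * (f b + f a) + q i * ((b i - a i)\<^sup>2 - 1)"
          using midpoint_gap[OF ab(3,1) i] by blast
        have "4 * f z \<ge> 4 * f xs + q i * (D\<^sup>2 - 1)" using z(2) least[OF ab(1)] least[OF ab(3)] ab by (simp add: D_def)
        then have "real_of_int (4 * f z) \<ge> of_int (4 * f xs + q i * (D\<^sup>2 - 1))" by (simp only: of_int_le_iff)
        then have "4 * real_of_int (f z) \<ge> 4 * of_int (f xs) + of_int (q i) * ((of_int D)\<^sup>2 - 1)" by simp
        then have gap4: "4 * gap \<ge> of_int (q i) * ((of_int D)\<^sup>2 - 1)" using G[OF z(1)] by (simp add: gap_def)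
        have k1: "real k \<ge> 1" using i by simp
        have rat: "real k * (of_int D)\<^sup>2 \<le> \<epsilon> * (of_int g)\<^sup>2 * ((of_int D)\<^sup>2 - 1)"
          by (rule error_ratio[OF \<epsilon> k1 g(2) D4])
        have "real_of_int (g * (D div g)) \<le> of_int D" using gD by (simp only: of_int_le_iff)
        then have "of_int (D div g) * real_of_int g \<le> of_int D" by (simp add: mult.commute)
        then have "(of_int (D div g) * real_of_int g)\<^sup>2 \<le> (of_int D)\<^sup>2" using dg g(1) by (intro power_mono) auto
        then have sq: "(of_int (D div g))\<^sup>2 * (real_of_int g)\<^sup>2 \<le> (of_int D)\<^sup>2" by (simp add: power_mult_distrib)
        have "real k * (of_int (D div g))\<^sup>2 * (real_of_int g)\<^sup>2 \<le> real k * (of_int D)\<^sup>2"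
          using sq by (simp add: mult.assoc mult_left_mono)
        also note rat
        finally have "(real k * (of_int (D div g))\<^sup>2) * (real_of_int g)\<^sup>2 \<le> (\<epsilon> * ((of_int D)\<^sup>2 - 1)) * (real_of_int g)\<^sup>2"
          by (simp add: mult_ac)
        then have "real k * (of_int (D div g))\<^sup>2 \<le> \<epsilon> * ((of_int D)\<^sup>2 - 1)"
          by (rule mult_right_le_imp_le) (use g(1) in simp)
        then have "of_int (q i) * (real k * (of_int (D div g))\<^sup>2) \<le> of_int (q i) * (\<epsilon> * ((of_int D)\<^sup>2 - 1))"
          using q[OF i] by (intro mult_left_mono) auto
        also have "\<dots> = \<epsilon> * (of_int (q i) * ((of_int D)\<^sup>2 - 1))" by simp
        also have "\<dots> \<le> \<epsilon> * (4 * gap)" using gap4 \<epsilon> by (intro mult_left_mono) auto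
        finally have main: "real k * (of_int (q i) * (of_int (D div g))\<^sup>2) \<le> 4 * (\<epsilon> * gap)" by (simp add: mult_ac)
        have "4 * ((D div g)\<^sup>2 div 4) \<le> (D div g)\<^sup>2" by linarith
        then have "q i * (4 * ((D div g)\<^sup>2 div 4)) \<le> q i * (D div g)\<^sup>2" using q[OF i] by (intro mult_left_mono) auto
        then have "real_of_int (q i * (4 * ((D div g)\<^sup>2 div 4))) \<le> of_int (q i * (D div g)\<^sup>2)" by (simp only: of_int_le_iff)
        then have "4 * real_of_int (q i * ((D div g)\<^sup>2 div 4)) \<le> of_int (q i) * (of_int (D div g))\<^sup>2" by simp
        then have "real k * (4 * real_of_int (q i * ((D div g)\<^sup>2 div 4))) \<le> 4 * (\<epsilon> * gap)"
          using main k1 by (smt (verit) mult_left_mono)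
        then show ?thesis using k1 by (simp add: D_def field_simps)
      qed
    qed
    then have "real_of_int (chord_error l u g) \<le> (\<Sum>i<k. \<epsilon> * gap / real k)"
      unfolding chord_error_def of_int_sum by (intro sum_mono) simp
    also have "\<dots> \<le> \<epsilon> * gap" using gap0 \<epsilon> by simp
    finally have "of_int (chord_error l u g) \<le> \<epsilon> * gap" .
    moreover have "f x \<le> f xs + chord_error l u g" using near xs small_box unfolding near_optimal_def by blast
    ultimately show ?thesis unfolding gap_def by (smt (verit) of_int_add of_int_diff of_int_le_iff)
  qed
  then show ?thesis using that xs(1) least by blast
qed

end

section \<open>Encoding lengths and magnitudes\<close>

lemma int_size_le: "\<bar>z\<bar> < 2 ^ X \<Longrightarrow> int_size z \<le> X + 1"
  using bitlen_le_iff_power[of "\<bar>z\<bar>" "int X"] by (simp add: int_size_def nat_le_iff)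

lemma int_size_gt: "\<bar>z\<bar> < 2 ^ (int_size z - 1)"
  using bitlen_bounds[of "\<bar>z\<bar>"] by (cases "z = 0") (auto simp: int_size_def nat_diff_distrib)

text \<open>By x + y \<le> 2 x y for x, y \<ge> 1, where the factor 2 is paid by the sign bit. Hence
  the sum of all input numbers needs no more bits than the whole input.\<close>

lemma sum_abs_less: "sum_list (map abs zs) < 2 ^ code_size zs"
proof (induction zs)
  case (Cons z zs)
  have a: "int_size z = Suc (int_size z - 1)" by (simp add: int_size_def)
  have "\<bar>z\<bar> + 1 \<le> 2 ^ (int_size z - 1)" using int_size_gt[of z] by simp
  moreover have "sum_list (map abs zs) + 1 \<le> 2 ^ code_size zs" using Cons by simp
  moreover have "(2::int) ^ (int_size z - 1) + 2 ^ code_size zs \<le> 2 * (2 ^ (int_size z - 1) * 2 ^ code_size zs)"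
  proof -
    have "x + y \<le> 2 * (x * y)" if "1 \<le> x" "1 \<le> y" for x y :: int
      using mult_nonneg_nonneg[of "x - 1" "y - 1"] that by (simp add: algebra_simps)
    then show ?thesis by simp
  qed
  moreover have "(2::int) ^ code_size (z # zs) = 2 * (2 ^ (int_size z - 1) * 2 ^ code_size zs)"
    by (subst (1) code_size_def) (simp add: power_add code_size_def[symmetric], subst a, simp)
  ultimately show ?case by simp
qed simp

lemma length_le_code_size: "length zs \<le> code_size zs"
  by (induction zs) (auto simp: code_size_def int_size_def)

lemma code_size_le: "(\<And>z. z \<in> set zs \<Longrightarrow> \<bar>z\<bar> < 2 ^ X) \<Longrightarrow> code_size zs \<le> length zs * (X + 1)"
proof (induction zs)
  case (Cons z zs)
  have "int_size z \<le> X + 1" by (rule int_size_le) (simp add: Cons.prems)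
  moreover have "code_size zs \<le> length zs * (X + 1)" by (rule Cons.IH) (simp add: Cons.prems)
  ultimately show ?case by (simp add: code_size_def)
qed (simp add: code_size_def)

section \<open>Cost of expressions\<close>

text \<open>A node count that charges 9 bits to a constant, enough for 200. If all cells have S
  bits, then a value has at most (S + 1) \<open>weight e\<close> bits, because every operation adds
  at most one bit to the sum of the lengths.\<close>

fun weight :: "expr \<Rightarrow> nat" where
  "weight (Const z) = 9"
| "weight (Cell a) = 1 + weight a"
| "weight (Add a b) = 1 + weight a + weight b"
| "weight (Sub a b) = 1 + weight a + weight b"
| "weight (Mul a b) = 1 + weight a + weight b"
| "weight (Quot a b) = 1 + weight a + weight b"
| "weight (Cut a b) = 1 + weight a + weight b"

fun small_consts :: "expr \<Rightarrow> bool" where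
  "small_consts (Const z) \<longleftrightarrow> \<bar>z\<bar> \<le> 200"
| "small_consts (Cell a) \<longleftrightarrow> small_consts a"
| "small_consts (Add a b) \<longleftrightarrow> small_consts a \<and> small_consts b"
| "small_consts (Sub a b) \<longleftrightarrow> small_consts a \<and> small_consts b"
| "small_consts (Mul a b) \<longleftrightarrow> small_consts a \<and> small_consts b"
| "small_consts (Quot a b) \<longleftrightarrow> small_consts a \<and> small_consts b"
| "small_consts (Cut a b) \<longleftrightarrow> small_consts a \<and> small_consts b"

text \<open>Generous limits that every expression of the program meets; they make the cost of an
  expression linear in S.\<close>

definition modest :: "expr \<Rightarrow> bool" where
  "modest e \<longleftrightarrow> small_consts e \<and> weight e \<le> 200"

lemma two_powers: "x < 2 ^ X \<Longrightarrow> y < 2 ^ Y \<Longrightarrow> X + Y + 1 \<le> V \<Longrightarrow> x + y < (2::int) ^ V"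
proof -
  assume a: "x < 2 ^ X" "y < 2 ^ Y" "X + Y + 1 \<le> V"
  have "(2::int) ^ X \<le> 2 ^ (X + Y)" "(2::int) ^ Y \<le> 2 ^ (X + Y)" by simp_all
  moreover have "(2::int) ^ (X + Y) + 2 ^ (X + Y) \<le> 2 ^ V"
    using power_increasing[of "X + Y + 1" V "2::int"] a(3) by simp
  ultimately show ?thesis using a by linarith
qed

lemma abs_div_le: "\<bar>(x::int) div y\<bar> \<le> \<bar>x\<bar>"
proof -
  have pos: "\<bar>x div y\<bar> \<le> \<bar>x\<bar>" if y: "y > 0" for x y :: int
  proof -
    have x: "x = (x div y) * y + x mod y" by simp
    have r: "0 \<le> x mod y" "x mod y < y" using y by simp_all
    show ?thesis
    proof (cases "x div y \<ge> 0")
      case True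
      then have "(x div y) * 1 \<le> (x div y) * y" using y by (intro mult_left_mono) auto
      then show ?thesis using True x r by linarith
    next
      case False
      then have "(x div y + 1) * y \<le> (x div y + 1) * 1" using y by (intro mult_left_mono_neg) auto
      then have "(x div y) * y + y \<le> x div y + 1" by (simp add: algebra_simps)
      then show ?thesis using False x r by linarith
    qed
  qed
  consider "y = 0" | "y > 0" | "- y > 0" by linarith
  then show ?thesis
  proof cases
    case 3 then show ?thesis using pos[OF 3, of "- x"] by simp
  qed (use pos in simp_all)
qed

lemma eval_bound:
  assumes "\<And>x. \<bar>s x\<bar> < 2 ^ S" "small_consts e"
  shows "\<bar>eval \<epsilon> s e\<bar> < 2 ^ ((S + 1) * weight e)"
  using assms(2)
proof (induction e)
  case (Const z)
  then have "\<bar>z\<bar> < 2 ^ 9" by simp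
  also have "(2::int) ^ 9 \<le> 2 ^ ((S + 1) * 9)" by (rule power_increasing) auto
  finally show ?case by simp
next
  case (Cell a)
  have "\<bar>s (eval \<epsilon> s a)\<bar> < 2 ^ S" by (rule assms(1))
  also have "(2::int) ^ S \<le> 2 ^ ((S + 1) * weight (Cell a))" by (rule power_increasing) auto
  finally show ?case by simp
next
  case (Add a b)
  then have "\<bar>eval \<epsilon> s a\<bar> + \<bar>eval \<epsilon> s b\<bar> < 2 ^ ((S + 1) * weight (Add a b))"
    by (intro two_powers[where X = "(S + 1) * weight a" and Y = "(S + 1) * weight b"]) (simp_all add: algebra_simps)
  then show ?case by simp
next
  case (Sub a b)
  then have "\<bar>eval \<epsilon> s a\<bar> + \<bar>eval \<epsilon> s b\<bar> < 2 ^ ((S + 1) * weight (Sub a b))"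
    by (intro two_powers[where X = "(S + 1) * weight a" and Y = "(S + 1) * weight b"]) (simp_all add: algebra_simps)
  then show ?case by simp
next
  case (Mul a b)
  then have "\<bar>eval \<epsilon> s a\<bar> * \<bar>eval \<epsilon> s b\<bar> < 2 ^ ((S + 1) * weight a) * 2 ^ ((S + 1) * weight b)"
    by (intro mult_strict_mono') simp_all
  also have "\<dots> = (2::int) ^ ((S + 1) * weight a + (S + 1) * weight b)" by (simp add: power_add)
  also have "\<dots> \<le> 2 ^ ((S + 1) * weight (Mul a b))" by (rule power_increasing) (simp_all add: algebra_simps)
  finally show ?case by (simp add: abs_mult)
next
  case (Quot a b)
  then have "\<bar>eval \<epsilon> s a\<bar> < 2 ^ ((S + 1) * weight a)" by simp
  also have "(2::int) ^ ((S + 1) * weight a) \<le> 2 ^ ((S + 1) * weight (Quot a b))"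
    by (rule power_increasing) (simp_all add: algebra_simps)
  finally show ?case using abs_div_le[of "eval \<epsilon> s a" "eval \<epsilon> s b"] by simp
next
  case (Cut a b)
  have "(1::int) < 2 ^ ((S + 1) * weight (Cut a b))" by (rule one_less_power) simp_all
  moreover have "\<bar>eval \<epsilon> s (Cut a b)\<bar> \<le> 1" by simp
  ultimately show ?case by linarith
qed

text \<open>There are at most \<open>weight e\<close> nodes, each with a value of about (S + 1)
  \<open>weight e\<close> bits. In the induction (1 + u + v) + u^2 + v^2 \<le> (1 + u + v)^2 absorbs
  the root.\<close>

lemma cost_bound:
  assumes b: "\<And>x. \<bar>s x\<bar> < 2 ^ S" and c: "small_consts e"
  shows "cost \<epsilon> s e \<le> (S + 1) * (weight e)\<^sup>2 + weight e"
proof -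
  have size: "int_size (eval \<epsilon> s e) \<le> (S + 1) * weight e + 1" if "small_consts e" for e
    by (rule int_size_le[OF eval_bound[OF b that]])
  have bin: "x + (y + z) \<le> (S + 1) * (1 + u + v)\<^sup>2 + (1 + u + v)"
    if "x \<le> (S + 1) * (1 + u + v) + 1" "y \<le> (S + 1) * u\<^sup>2 + u" "z \<le> (S + 1) * v\<^sup>2 + v" for x y z u v :: nat
  proof -
    have "(1 + u + v) + (u\<^sup>2 + v\<^sup>2) \<le> (1 + u + v)\<^sup>2" by (simp add: power2_eq_square algebra_simps)
    then have "(S + 1) * ((1 + u + v) + (u\<^sup>2 + v\<^sup>2)) \<le> (S + 1) * (1 + u + v)\<^sup>2" by (rule mult_le_mono2)
    then show ?thesis using that unfolding add_mult_distrib2 by linarith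
  qed
  show ?thesis
    using c
  proof (induction e)
    case (Const z)
    then show ?case using size[of "Const z"] by simp
  next
    case (Cell a)
    then show ?case using size[of "Cell a"] bin[of "int_size (eval \<epsilon> s (Cell a))" "weight a" 0 "cost \<epsilon> s a" 0] by simp
  next
    case (Add a b)
    then show ?case using size[of "Add a b"] bin[of "int_size (eval \<epsilon> s (Add a b))" "weight a" "weight b" "cost \<epsilon> s a" "cost \<epsilon> s b"]
      by (simp del: eval.simps cost.simps add: cost.simps[of _ _ "Add a b"])
  next
    case (Sub a b)
    then show ?case using size[of "Sub a b"] bin[of "int_size (eval \<epsilon> s (Sub a b))" "weight a" "weight b" "cost \<epsilon> s a" "cost \<epsilon> s b"]
      by (simp del: eval.simps cost.simps add: cost.simps[of _ _ "Sub a b"])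
  next
    case (Mul a b)
    then show ?case using size[of "Mul a b"] bin[of "int_size (eval \<epsilon> s (Mul a b))" "weight a" "weight b" "cost \<epsilon> s a" "cost \<epsilon> s b"]
      by (simp del: eval.simps cost.simps add: cost.simps[of _ _ "Mul a b"])
  next
    case (Quot a b)
    then show ?case using size[of "Quot a b"] bin[of "int_size (eval \<epsilon> s (Quot a b))" "weight a" "weight b" "cost \<epsilon> s a" "cost \<epsilon> s b"]
      by (simp del: eval.simps cost.simps add: cost.simps[of _ _ "Quot a b"])
  next
    case (Cut a b)
    then show ?case using size[of "Cut a b"] bin[of "int_size (eval \<epsilon> s (Cut a b))" "weight a" "weight b" "cost \<epsilon> s a" "cost \<epsilon> s b"]
      by (simp del: eval.simps cost.simps add: cost.simps[of _ _ "Cut a b"])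
  qed
qed

lemma cost_modest:
  assumes b: "\<And>x. \<bar>s x\<bar> < 2 ^ S" and c: "modest e"
  shows "cost \<epsilon> s e \<le> 50000 * (S + 1)"
proof -
  have w: "weight e \<le> 200" using c by (simp add: modest_def)
  have "cost \<epsilon> s e \<le> (S + 1) * (weight e)\<^sup>2 + weight e"
    using c by (intro cost_bound[OF b]) (simp add: modest_def)
  also have "\<dots> \<le> (S + 1) * 200\<^sup>2 + 200" using w by (intro add_mono mult_le_mono2 power_mono) auto
  finally show ?thesis by simp
qed

section \<open>Weakest preconditions with resource bounds\<close>

text \<open>N bounds the number of executed instructions, r the number of linear programs. Every
  instruction costs at most U as long as all cells stay below 2^S.\<close>

locale machine =
  fixes solve :: lp_oracle and \<epsilon> :: real and S U :: nat and ok :: "lp \<Rightarrow> bool"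
  assumes U: "100000 * (S + 1) \<le> U"
begin

definition bounded :: "memory \<Rightarrow> bool" where
  "bounded s \<longleftrightarrow> (\<forall>x. \<bar>s x\<bar> < 2 ^ S)"

text \<open>Executions are unique, so the existence of one amounts to total correctness. Boundedness
  of the memory is assumed before and guaranteed after, which keeps it out of the loop
  invariants.\<close>

definition wp :: "cmd \<Rightarrow> nat \<Rightarrow> nat \<Rightarrow> (memory \<Rightarrow> bool) \<Rightarrow> memory \<Rightarrow> bool" where
  "wp c N r Q s \<longleftrightarrow> (bounded s \<longrightarrow> (\<exists>t Ps s'. exec solve \<epsilon> c s t Ps s' \<and> t \<le> N * U \<and> length Ps \<le> r \<and>
     (\<forall>P\<in>set Ps. ok P) \<and> bounded s' \<and> Q s'))"

text \<open>The factor 2 lets one unit pay for the two expressions of an assignment.\<close>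

lemma cost_U: "bounded s \<Longrightarrow> modest e \<Longrightarrow> 2 * cost \<epsilon> s e \<le> U"
  using cost_modest[of s S e \<epsilon>] U by (force simp: bounded_def)

lemma wp_bounded: "(bounded s \<Longrightarrow> wp c N r Q s) \<Longrightarrow> wp c N r Q s"
  by (simp add: wp_def)

lemma wp_mono:
  assumes "wp c N r Q s" "\<And>s'. bounded s' \<Longrightarrow> Q s' \<Longrightarrow> Q' s'" "N \<le> N'" "r \<le> r'"
  shows "wp c N' r' Q' s"
proof (rule wp_bounded)
  assume "bounded s"
  then obtain t Ps s' where e: "exec solve \<epsilon> c s t Ps s'" "t \<le> N * U" "length Ps \<le> r" "\<forall>P\<in>set Ps. ok P" "bounded s'" "Q s'"
    using assms(1) unfolding wp_def by blast
  have "N * U \<le> N' * U" using assms(3) by simp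
  then have "t \<le> N' * U" using e(2) by linarith
  then show ?thesis unfolding wp_def using e assms(2,4) by (meson order_trans)
qed

lemma wp_Seq:
  assumes "wp c N1 r1 (wp d N2 r2 Q) s" "N1 + N2 \<le> N" "r1 + r2 \<le> r"
  shows "wp (Seq c d) N r Q s"
proof -
  have "wp (Seq c d) (N1 + N2) (r1 + r2) Q s"
  proof (rule wp_bounded)
    assume "bounded s"
    then obtain t Ps s' where c: "exec solve \<epsilon> c s t Ps s'" "t \<le> N1 * U" "length Ps \<le> r1" "\<forall>P\<in>set Ps. ok P" "bounded s'" "wp d N2 r2 Q s'"
      using assms(1) unfolding wp_def[of c] by blast
    then obtain t' Ps' s'' where d: "exec solve \<epsilon> d s' t' Ps' s''" "t' \<le> N2 * U" "length Ps' \<le> r2" "\<forall>P\<in>set Ps'. ok P" "bounded s''" "Q s''"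
      unfolding wp_def by blast
    have "exec solve \<epsilon> (Seq c d) s (t + t') (Ps @ Ps') s''" by (rule exec.Seq[OF c(1) d(1)])
    moreover have "t + t' \<le> (N1 + N2) * U" using c d by (simp add: add_mult_distrib)
    moreover have "length (Ps @ Ps') \<le> r1 + r2" using c d by simp
    ultimately show ?thesis unfolding wp_def using c(4) d(4,5,6) by (metis Un_iff set_append)
  qed
  then show ?thesis by (rule wp_mono[OF _ _ assms(2,3)])
qed

lemma wp_Assign:
  assumes "modest a" "modest e" "1 \<le> N" "\<bar>eval \<epsilon> s e\<bar> < 2 ^ S" "Q (s(eval \<epsilon> s a := eval \<epsilon> s e))"
  shows "wp (Assign a e) N r Q s"
proof (rule wp_bounded)
  assume b: "bounded s"
  have "cost \<epsilon> s a + cost \<epsilon> s e \<le> U" using cost_U[OF b assms(1)] cost_U[OF b assms(2)] by linarith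
  also have "\<dots> \<le> N * U" using assms(3) by simp
  finally have "cost \<epsilon> s a + cost \<epsilon> s e \<le> N * U" .
  moreover have "bounded (s(eval \<epsilon> s a := eval \<epsilon> s e))" using b assms(4) by (simp add: bounded_def)
  ultimately show ?thesis unfolding wp_def using exec.Assign[of solve \<epsilon> a e s] assms(5)
    by (intro impI exI[of _ "cost \<epsilon> s a + cost \<epsilon> s e"] exI[of _ "[]"] exI[of _ "s(eval \<epsilon> s a := eval \<epsilon> s e)"]) simp
qed

lemma wp_step:
  assumes "modest a" "modest e" "1 \<le> N" "\<bar>eval \<epsilon> s e\<bar> < 2 ^ S" "wp d (N - 1) r Q (s(eval \<epsilon> s a := eval \<epsilon> s e))"
  shows "wp (Seq (Assign a e) d) N r Q s"
  by (rule wp_Seq[of _ 1 0 _ "N - 1" r]) (use assms in \<open>auto intro: wp_Assign\<close>)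

lemma wp_If:
  assumes e: "modest e" "1 \<le> N"
    and T: "eval \<epsilon> s e > 0 \<Longrightarrow> wp c (N - 1) r Q s" and F: "eval \<epsilon> s e \<le> 0 \<Longrightarrow> wp d (N - 1) r Q s"
  shows "wp (IfPos e c d) N r Q s"
proof (rule wp_bounded)
  assume b: "bounded s"
  have ce: "cost \<epsilon> s e \<le> U" using cost_U[OF b e(1)] by linarith
  have N: "U + (N - 1) * U = N * U" using e(2) by (cases N) auto
  show ?thesis
  proof (cases "eval \<epsilon> s e > 0")
    case True
    then obtain t Ps s' where c: "exec solve \<epsilon> c s t Ps s'" "t \<le> (N - 1) * U" "length Ps \<le> r" "\<forall>P\<in>set Ps. ok P" "bounded s'" "Q s'"
      using T b unfolding wp_def by blast
    have "exec solve \<epsilon> (IfPos e c d) s (cost \<epsilon> s e + t) Ps s'" by (rule exec.IfTrue[OF True c(1)])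
    moreover have "cost \<epsilon> s e + t \<le> N * U" using c(2) ce N by linarith
    ultimately show ?thesis unfolding wp_def using c by blast
  next
    case False
    then obtain t Ps s' where c: "exec solve \<epsilon> d s t Ps s'" "t \<le> (N - 1) * U" "length Ps \<le> r" "\<forall>P\<in>set Ps. ok P" "bounded s'" "Q s'"
      using F b unfolding wp_def by (meson not_less)
    have "exec solve \<epsilon> (IfPos e c d) s (cost \<epsilon> s e + t) Ps s'" by (rule exec.IfFalse[OF _ c(1)]) (use False in simp)
    moreover have "cost \<epsilon> s e + t \<le> N * U" using c(2) ce N by linarith
    ultimately show ?thesis unfolding wp_def using c by blast
  qed
qed

lemma wp_While:
  assumes e: "modest e"
    and step: "\<And>j s. j < L \<Longrightarrow> Inv j s \<Longrightarrow> bounded s \<Longrightarrow> eval \<epsilon> s e > 0 \<and> wp c N r (Inv (Suc j)) s"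
    and stop: "\<And>s. Inv L s \<Longrightarrow> bounded s \<Longrightarrow> eval \<epsilon> s e \<le> 0 \<and> Q s"
    and init: "Inv 0 s" and "L * (N + 1) + 1 \<le> N'" "L * r \<le> r'"
  shows "wp (WhilePos e c) N' r' Q s"
proof -
  have "wp (WhilePos e c) ((L - j) * (N + 1) + 1) ((L - j) * r) Q s" if "j \<le> L" "Inv j s" for j s
    using that
  proof (induction "L - j" arbitrary: j s)
    case 0
    then have j: "j = L" by simp
    show ?case
    proof (rule wp_bounded)
      assume b: "bounded s"
      have *: "eval \<epsilon> s e \<le> 0" "Q s" using stop b 0 j by auto
      have "cost \<epsilon> s e \<le> 1 * U" using cost_U[OF b e] by linarith
      then show ?thesis unfolding wp_def j using exec.WhileFalse[OF *(1), of solve c] *(2) by fastforce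
    qed
  next
    case (Suc d)
    then have j: "j < L" by simp
    show ?case
    proof (rule wp_bounded)
      assume b: "bounded s"
      have *: "eval \<epsilon> s e > 0" "wp c N r (Inv (Suc j)) s" using step[OF j Suc.prems(2) b] by auto
      then obtain t Ps s' where c: "exec solve \<epsilon> c s t Ps s'" "t \<le> N * U" "length Ps \<le> r" "\<forall>P\<in>set Ps. ok P" "bounded s'" "Inv (Suc j) s'"
        using b unfolding wp_def by blast
      have "wp (WhilePos e c) ((L - Suc j) * (N + 1) + 1) ((L - Suc j) * r) Q s'"
        by (rule Suc.hyps(1)) (use Suc.hyps(2) j c(6) in auto)
      then obtain t' Ps' s'' where d: "exec solve \<epsilon> (WhilePos e c) s' t' Ps' s''" "t' \<le> ((L - Suc j) * (N + 1) + 1) * U"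
        "length Ps' \<le> (L - Suc j) * r" "\<forall>P\<in>set Ps'. ok P" "bounded s''" "Q s''" using c(5) unfolding wp_def by blast
      have L: "L - j = Suc (L - Suc j)" using j by simp
      have "exec solve \<epsilon> (WhilePos e c) s (cost \<epsilon> s e + t + t') (Ps @ Ps') s''"
        by (rule exec.WhileTrue[OF *(1) c(1) d(1)])
      moreover have "cost \<epsilon> s e + t + t' \<le> ((L - j) * (N + 1) + 1) * U"
        using cost_U[OF b e] c(2) d(2) unfolding L by (simp add: algebra_simps)
      moreover have "length (Ps @ Ps') \<le> (L - j) * r" using c(3) d(3) unfolding L by simp
      ultimately show ?thesis unfolding wp_def using c(4) d(4,5,6) by (metis Un_iff set_append)
    qed
  qed
  from this[of 0 s] init have "wp (WhilePos e c) (L * (N + 1) + 1) (L * r) Q s" by simp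
  then show ?thesis by (rule wp_mono) (use assms in auto)
qed

end

definition for_loop :: "int \<Rightarrow> expr \<Rightarrow> cmd \<Rightarrow> cmd" where
  "for_loop i e c = Seq (Assign (Const i) (Const 0)) (WhilePos (Sub e (Cell (Const i)))
     (Seq c (Assign (Const i) (Add (Cell (Const i)) (Const 1)))))"

text \<open>The invariant is asserted for the memory after the counter has been increased, so a body
  only has to preserve the counter. A round is charged for the body, the increment and the
  test.\<close>

lemma (in machine) wp_for:
  assumes i: "\<bar>i\<bar> \<le> 200" and e: "small_consts e" "weight e \<le> 100"
    and lim: "\<And>j s. Inv j s \<Longrightarrow> eval \<epsilon> s e = int L"
    and body: "\<And>j s. j < L \<Longrightarrow> Inv j s \<Longrightarrow> s i = int j \<Longrightarrow> bounded s \<Longrightarrow>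
      wp c N r (\<lambda>s'. s' i = int j \<and> Inv (Suc j) (s'(i := int (Suc j)))) s"
    and init: "Inv 0 (s(i := 0))" and L: "int L < 2 ^ S"
    and fin: "\<And>s. Inv L s \<Longrightarrow> s i = int L \<Longrightarrow> bounded s \<Longrightarrow> Q s"
    and "L * (N + 2) + 2 \<le> N'" "L * r \<le> r'"
  shows "wp (for_loop i e c) N' r' Q s"
proof -
  have m: "modest (Const i)" "modest (Sub e (Cell (Const i)))" "modest (Add (Cell (Const i)) (Const 1))"
    using i e by (simp_all add: modest_def)
  have m0: "modest (Const 0)" by (simp add: modest_def)
  let ?J = "\<lambda>j s. Inv j s \<and> s i = int j"
  show ?thesis
    unfolding for_loop_def
  proof (rule wp_step[OF m(1) m0])
    show "wp (WhilePos (Sub e (Cell (Const i))) (Seq c (Assign (Const i) (Add (Cell (Const i)) (Const 1))))) (N' - 1) r' Q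
      (s(eval \<epsilon> s (Const i) := eval \<epsilon> s (Const 0)))"
    proof (rule wp_While[OF m(2), of L ?J])
      fix j s assume j: "j < L" and J: "?J j s" and b: "bounded s"
      have "wp (Seq c (Assign (Const i) (Add (Cell (Const i)) (Const 1)))) (N + 1) r (?J (Suc j)) s"
      proof (rule wp_Seq[of _ N r _ 1 0])
        show "wp c N r (wp (Assign (Const i) (Add (Cell (Const i)) (Const 1))) 1 0 (?J (Suc j))) s"
        proof (rule wp_mono[OF body[OF j conjunct1[OF J] conjunct2[OF J] b]])
          fix s' assume s': "s' i = int j \<and> Inv (Suc j) (s'(i := int (Suc j)))"
          show "wp (Assign (Const i) (Add (Cell (Const i)) (Const 1))) 1 0 (?J (Suc j)) s'"
          proof (rule wp_Assign[OF m(1,3)])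
            have "int j + 1 < 2 ^ S" using j L by linarith
            then show "\<bar>eval \<epsilon> s' (Add (Cell (Const i)) (Const 1))\<bar> < 2 ^ S" using s' by simp
          qed (use s' in \<open>auto simp: add.commute\<close>)
        qed simp_all
      qed simp_all
      moreover have "eval \<epsilon> s (Sub e (Cell (Const i))) > 0" using lim[of j s] J j by simp
      ultimately show "eval \<epsilon> s (Sub e (Cell (Const i))) > 0 \<and> wp (Seq c (Assign (Const i) (Add (Cell (Const i)) (Const 1)))) (N + 1) r (?J (Suc j)) s"
        by simp
    next
      fix s assume "?J L s" "bounded s"
      then show "eval \<epsilon> s (Sub e (Cell (Const i))) \<le> 0 \<and> Q s" using lim[of L s] fin by simp
    qed (use assms in simp_all)
  qed (use assms in simp_all)
qed

section \<open>Memory blocks and counting of linear programs\<close>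

lemma holds_at_cong: "(\<And>x. a \<le> x \<Longrightarrow> x < a + int (length zs) \<Longrightarrow> s' x = s x) \<Longrightarrow> holds_at s a zs \<Longrightarrow> holds_at s' a zs"
  unfolding holds_at_def by simp

lemma holds_at_Nil [simp]: "holds_at s a []"
  by (simp add: holds_at_def)

lemma holds_at_Cons: "holds_at s a (z # zs) \<longleftrightarrow> s a = z \<and> holds_at s (a + 1) zs"
  using holds_at_append[of s a "[z]" zs] by (simp add: holds_at_def)

lemma holds_at_store: "holds_at (store s a zs) a zs"
  by (simp add: holds_at_def store_def)

lemma holds_at_map: "holds_at s a (map f [0..<n]) \<longleftrightarrow> (\<forall>j<n. s (a + int j) = f j)"
  by (simp add: holds_at_def)

lemma length_pairs: "length (concat (map (\<lambda>j. [f j, g j]) [0..<n])) = 2 * n"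
  by (induction n) auto

lemma holds_at_pairs:
  "holds_at s a (concat (map (\<lambda>j. [f j, g j]) [0..<n])) \<longleftrightarrow>
    (\<forall>j<n. s (a + 2 * int j) = f j \<and> s (a + 2 * int j + 1) = g j)"
proof (induction n)
  case (Suc n)
  show ?case
    unfolding upt_Suc_append[OF le0] map_append concat_append holds_at_append length_pairs Suc.IH
    by (auto simp: holds_at_Cons less_Suc_eq)
qed simp

lemma list_of_vec_vec: "list_of_vec (vec n f) = map f [0..<n]"
  by (simp add: list_of_vec_map)

lemma list_of_vec_index: "list_of_vec v = map (\<lambda>j. v $ j) [0..<dim_vec v]"
  by (simp add: list_of_vec_map)

text \<open>In the factor 3 + g, the g extends the grid by a coordinate and the 3 absorbs the two
  additional range programs. For k \<ge> 1 the number k (1 + 1/\<epsilon>) exceeds 1, so the rounded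
  up root is at least 2.\<close>

lemma two_k_power_le: "g \<ge> 2 \<or> k = 0 \<Longrightarrow> 2 * k + g ^ k \<le> (3 + g :: nat) ^ k"
proof (induction k)
  case (Suc k)
  then have g: "g \<ge> 2" by simp
  have "2 * Suc k + g ^ Suc k \<le> (3 + g) * (2 * k + g ^ k)"
  proof -
    have "1 \<le> g ^ k" using g by simp
    then have "2 * Suc k + g * g ^ k \<le> 3 * (2 * k) + 3 * g ^ k + g * g ^ k" by simp
    also have "\<dots> \<le> (3 + g) * (2 * k + g ^ k)" by (simp add: algebra_simps)
    finally show ?thesis by simp
  qed
  also have "\<dots> \<le> (3 + g) * (3 + g) ^ k" using Suc.IH g by (intro mult_le_mono2) simp
  finally show ?case by simp
qed simp

lemma sum_list_map_upt: "sum_list (map f [0..<N]) = (\<Sum>j<N. f j)"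
  by (simp add: interv_sum_list_conv_sum_set_nat atLeast0LessThan)

section \<open>Sizes of the numbers and linear programs\<close>

locale iqp_run =
  fixes I :: iqp and \<epsilon> :: real and solve :: lp_oracle
  assumes tu_iqp: "tu_iqp I" and \<epsilon>: "0 < \<epsilon>" "\<epsilon> \<le> 1" and solver: "lp_solver solve"
begin

abbreviation "n \<equiv> iqp_vars I"
abbreviation "m \<equiv> iqp_ineqs I"
abbreviation "k \<equiv> iqp_k I"
abbreviation "\<sigma> \<equiv> iqp_size I"
abbreviation "lpc \<equiv> lp_count k \<epsilon>"

definition coef :: "nat \<Rightarrow> nat \<Rightarrow> int" where "coef i j = iqp_W I $$ (i, j)"
definition rhs :: "nat \<Rightarrow> int" where "rhs i = iqp_w I $ i"
definition quad :: "nat \<Rightarrow> int" where "quad i = iqp_q I $ i"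
definition lin :: "nat \<Rightarrow> int" where "lin j = iqp_h I $ j"
text \<open>Obtained in one pass over the input, and at least as large as each coefficient sum. It
  serves as \<beta>, and \<open>cap\<close> as \<open>T\<close>.\<close>

definition mass :: int where "mass = sum_list (map abs (iqp_code I))"
definition cap :: int where "cap = mass ^ 3 + mass ^ 2"
definition cells :: nat where "cells = n * m + m"
definition start :: nat where "start = 3 + k + n + cells"
text \<open>An LP code has two dimensions, n costs, the matrix with its right-hand side, and 2 n
  bounds of two numbers each; the solver's answer comes directly behind it.\<close>

definition answer :: nat where "answer = start + 2 + 5 * n + cells"
text \<open>Matrix and right-hand side are adjacent in the code of the quadratic program and in that
  of every LP, so this block is copied once for all LPs.\<close>

definition body :: "int list" where "body = mat_code (iqp_W I) @ list_of_vec (iqp_w I)"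

lemma dims: "dim_vec (iqp_w I) = m" "dim_vec (iqp_h I) = n" "dim_vec (iqp_q I) = k" "k \<le> n"
  "dim_row (iqp_W I) = m" "dim_col (iqp_W I) = n" "totally_unimodular (iqp_W I)"
  using tu_iqp by (auto simp: tu_iqp_def iqp_k_def iqp_vars_def iqp_ineqs_def)

lemma code_eq: "iqp_code I = [int n, int m, int k] @ map quad [0..<k] @ map lin [0..<n] @ body"
  by (simp add: iqp_code_def body_def list_of_vec_index dims quad_def[abs_def] lin_def[abs_def])

lemma length_body: "length body = cells"
  by (simp add: body_def mat_code_length dims cells_def)

lemma length_code: "length (iqp_code I) = start"
  by (simp add: code_eq length_body start_def)

lemma start_le: "start \<le> \<sigma>"
  using length_le_code_size[of "iqp_code I"] by (simp add: iqp_size_def length_code)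

lemma \<sigma>_ge: "3 \<le> \<sigma>"
  using start_le by (simp add: start_def)

lemma mass_less: "mass < 2 ^ \<sigma>"
  using sum_abs_less by (simp add: mass_def iqp_size_def)

lemma mass_nonneg: "0 \<le> mass"
  unfolding mass_def by (rule sum_list_nonneg) auto

lemma abs_code: "z \<in> set (iqp_code I) \<Longrightarrow> \<bar>z\<bar> \<le> mass"
  unfolding mass_def by (rule member_le_sum_list) auto

lemma mass_parts: "(\<Sum>i<k. \<bar>quad i\<bar>) + (\<Sum>j<n. \<bar>lin j\<bar>) + (\<Sum>i<m. \<bar>rhs i\<bar>) \<le> mass"
proof -
  have "mass = int n + int m + int k + (\<Sum>i<k. \<bar>quad i\<bar>) + (\<Sum>j<n. \<bar>lin j\<bar>)
      + sum_list (map abs (mat_code (iqp_W I))) + (\<Sum>i<m. \<bar>rhs i\<bar>)"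
    by (simp add: mass_def code_eq body_def list_of_vec_index dims o_def sum_list_map_upt rhs_def)
  moreover have "0 \<le> sum_list (map abs (mat_code (iqp_W I)))" by (rule sum_list_nonneg) auto
  ultimately show ?thesis by linarith
qed

lemma parts: "(\<Sum>i<k. \<bar>quad i\<bar>) \<le> mass" "(\<Sum>j<n. \<bar>lin j\<bar>) \<le> mass" "(\<Sum>i<m. \<bar>rhs i\<bar>) \<le> mass"
proof -
  have "0 \<le> (\<Sum>i<k. \<bar>quad i\<bar>)" "0 \<le> (\<Sum>j<n. \<bar>lin j\<bar>)" "0 \<le> (\<Sum>i<m. \<bar>rhs i\<bar>)" by (simp_all add: sum_nonneg)
  with mass_parts show "(\<Sum>i<k. \<bar>quad i\<bar>) \<le> mass" "(\<Sum>j<n. \<bar>lin j\<bar>) \<le> mass" "(\<Sum>i<m. \<bar>rhs i\<bar>) \<le> mass"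
    by linarith+
qed

lemma quad_pos: "i < k \<Longrightarrow> quad i > 0"
  using tu_iqp by (simp add: tu_iqp_def quad_def)

lemma cap_ge: "(\<Sum>i<k. quad i) * mass\<^sup>2 + (\<Sum>j<n. \<bar>lin j\<bar>) * mass \<le> cap"
proof -
  have "(\<Sum>i<k. quad i) = (\<Sum>i<k. \<bar>quad i\<bar>)" by (rule sum.cong) (auto dest: quad_pos)
  then have "(\<Sum>i<k. quad i) * mass\<^sup>2 \<le> mass * mass\<^sup>2" using parts by (intro mult_right_mono) auto
  moreover have "(\<Sum>j<n. \<bar>lin j\<bar>) * mass \<le> mass * mass" using parts mass_nonneg by (intro mult_right_mono) auto
  ultimately show ?thesis by (simp add: cap_def power2_eq_square power3_eq_cube)
qed

sublocale concave_iqp m n coef rhs k quad lin mass cap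
proof unfold_locales
  show "tu_family m n coef"
    using tu_family_mat[OF dims(7)] by (simp add: dims coef_def[abs_def])
qed (use dims quad_pos parts cap_ge in auto)

text \<open>The two bounds of a variable differ by at most 2 B in every LP, so coordinate
  differences are digits in this base.\<close>

definition base :: int where "base = 2 * B + 1"
definition lead :: int where "lead = base ^ n"
text \<open>The maximum with 1 matters for k = 0, where the root is 0 and there is a single
  piece.\<close>

definition grid :: nat where "grid = max 1 (nat \<lceil>sqrt (real k * (1 + 1 / \<epsilon>))\<rceil>)"
definition pieces :: nat where "pieces = grid ^ k"
text \<open>Independent of \<epsilon>: \<open>lead\<close> has up to (3 \<sigma> + 5) \<sigma> bits
  and the unperturbed costs up to 4 \<sigma> + 6. \<open>bits\<close> adds \<open>lpc\<close> for
  the grid size, the piece numbers and uncapped piece ends, which enter the program's arithmetic but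
  not the LPs.\<close>

definition lpbits :: nat where "lpbits = 3 * \<sigma>\<^sup>2 + 10 * \<sigma> + 20"
definition bits :: nat where "bits = lpbits + lpc + 5"
definition lp_bound :: nat where "lp_bound = (2 + 6 * \<sigma>) * (lpbits + 1)"
definition unit :: nat where "unit = 100000 * (bits + 1) + lp_bound + (1 + 2 * \<sigma>) * (lpbits + 1)"
definition admissible :: "lp \<Rightarrow> bool" where
  "admissible P \<longleftrightarrow> lp_A P = iqp_W I \<and> code_size (lp_code P) \<le> lp_bound"

sublocale machine solve \<epsilon> bits unit admissible
  by unfold_locales (simp add: unit_def)

lemma B_ge: "1 \<le> B" "mass \<le> B" "cap \<le> B"
  using T_nonneg mass_nonneg by (simp_all add: B_def)

lemma base_ge: "1 \<le> base"
  using B_ge by (simp add: base_def)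

lemma lead_ge: "1 \<le> lead"
  using base_ge by (simp add: lead_def)

lemma cap_le: "cap \<le> 2 * 2 ^ (3 * \<sigma>)"
proof -
  have "mass ^ 3 \<le> (2 ^ \<sigma>) ^ 3" "mass ^ 2 \<le> (2 ^ \<sigma>) ^ 2"
    using mass_less mass_nonneg by (auto intro!: power_mono)
  moreover have "((2::int) ^ \<sigma>) ^ 3 = 2 ^ (3 * \<sigma>)" "((2::int) ^ \<sigma>) ^ 2 = 2 ^ (2 * \<sigma>)"
    by (simp_all add: power_mult[symmetric] mult.commute)
  moreover have "(2::int) ^ (2 * \<sigma>) \<le> 2 ^ (3 * \<sigma>)" by (rule power_increasing) auto
  ultimately show ?thesis unfolding cap_def by linarith
qed

lemma B_le: "B \<le> 10 * 2 ^ (3 * \<sigma>)"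
proof -
  have "(2::int) ^ \<sigma> \<le> 2 ^ (3 * \<sigma>)" by (rule power_increasing) auto
  moreover have "(1::int) \<le> 2 ^ (3 * \<sigma>)" by simp
  ultimately show ?thesis using cap_le mass_less unfolding B_def by linarith
qed

lemma base_le: "base \<le> 2 ^ (3 * \<sigma> + 5)"
proof -
  have "(2::int) ^ (3 * \<sigma> + 5) = 32 * 2 ^ (3 * \<sigma>)" by (simp add: power_add)
  moreover have "(1::int) \<le> 2 ^ (3 * \<sigma>)" by simp
  ultimately show ?thesis using B_le unfolding base_def by linarith
qed

lemma power_base_le: "j \<le> n \<Longrightarrow> base ^ j \<le> lead"
  unfolding lead_def using base_ge by (rule power_increasing[rotated])

lemma lead_le: "lead \<le> 2 ^ ((3 * \<sigma> + 5) * \<sigma>)"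
proof -
  have "n \<le> \<sigma>" using start_le by (simp add: start_def)
  have "lead \<le> (2 ^ (3 * \<sigma> + 5)) ^ n" unfolding lead_def using base_le base_ge by (intro power_mono) auto
  also have "\<dots> \<le> (2 ^ (3 * \<sigma> + 5)) ^ \<sigma>" using \<open>n \<le> \<sigma>\<close> by (intro power_increasing) auto
  finally show ?thesis by (simp add: power_mult)
qed

lemma three_B_less: "3 * B < 2 ^ lpbits"
proof -
  have "(2::int) ^ (3 * \<sigma> + 5) = 32 * 2 ^ (3 * \<sigma>)" by (simp add: power_add)
  moreover have "(1::int) \<le> 2 ^ (3 * \<sigma>)" by simp
  ultimately have "3 * B \<le> 2 ^ (3 * \<sigma> + 5)" using B_le by linarith
  also have "\<dots> < 2 ^ lpbits" by (rule power_strict_increasing) (simp_all add: lpbits_def)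
  finally show ?thesis .
qed

lemma objective_less:
  assumes "\<bar>c\<bar> \<le> mass + mass * (4 * B)" "j \<le> n"
  shows "\<bar>lead * c + base ^ j\<bar> < 2 ^ lpbits"
proof -
  have "mass * (4 * B) \<le> 2 ^ \<sigma> * (4 * (10 * 2 ^ (3 * \<sigma>)))"
    using mass_less B_le B_ge mass_nonneg by (intro mult_mono) auto
  also have "\<dots> = 40 * 2 ^ (4 * \<sigma>)" by (simp add: power_add[symmetric])
  finally have "mass * (4 * B) \<le> 40 * 2 ^ (4 * \<sigma>)" .
  moreover have "(2::int) ^ \<sigma> \<le> 2 ^ (4 * \<sigma>)" "(1::int) \<le> 2 ^ (4 * \<sigma>)" by (simp_all add: power_increasing)
  moreover have "(2::int) ^ (4 * \<sigma> + 6) = 64 * 2 ^ (4 * \<sigma>)" by (simp add: power_add)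
  ultimately have c: "\<bar>c\<bar> + 1 \<le> 2 ^ (4 * \<sigma> + 6)" using assms(1) mass_less by linarith
  have "\<bar>lead * c + base ^ j\<bar> \<le> lead * \<bar>c\<bar> + base ^ j"
    using lead_ge base_ge by (intro order_trans[OF abs_triangle_ineq]) (simp add: abs_mult)
  also have "\<dots> \<le> lead * (\<bar>c\<bar> + 1)" using power_base_le[OF assms(2)] by (simp add: algebra_simps)
  also have "\<dots> \<le> 2 ^ ((3 * \<sigma> + 5) * \<sigma>) * 2 ^ (4 * \<sigma> + 6)" using lead_le c lead_ge by (intro mult_mono) auto
  also have "\<dots> = (2::int) ^ ((3 * \<sigma> + 5) * \<sigma> + (4 * \<sigma> + 6))" by (rule power_add[symmetric])
  also have "\<dots> < 2 ^ lpbits"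
    by (rule power_strict_increasing) (simp_all add: lpbits_def power2_eq_square algebra_simps)
  finally show ?thesis .
qed

text \<open>For evaluating the objective at LP solutions, whose coordinates are at most 3 B in
  absolute value: a lower bound of size at most B plus a width of at most 2 B.\<close>

lemma value_less:
  "mass * (3 * B) + mass * (9 * B\<^sup>2) + 1 < 2 ^ lpbits"
proof -
  have m: "mass * (3 * B) \<le> 2 ^ \<sigma> * (3 * (10 * 2 ^ (3 * \<sigma>)))"
    using mass_less B_le B_ge mass_nonneg by (intro mult_mono) auto
  have "B\<^sup>2 \<le> (10 * 2 ^ (3 * \<sigma>))\<^sup>2" using B_le B_ge by (intro power_mono) auto
  then have "mass * (9 * B\<^sup>2) \<le> 2 ^ \<sigma> * (9 * (10 * 2 ^ (3 * \<sigma>))\<^sup>2)"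
    using mass_less mass_nonneg by (intro mult_mono) auto
  also have "\<dots> = 900 * 2 ^ (7 * \<sigma>)" by (simp add: power_mult_distrib power_add[symmetric] power_mult[symmetric])
  finally have "mass * (9 * B\<^sup>2) \<le> 900 * 2 ^ (7 * \<sigma>)" .
  moreover have "(2::int) ^ \<sigma> * (3 * (10 * 2 ^ (3 * \<sigma>))) = 30 * 2 ^ (4 * \<sigma>)" by (simp add: power_add[symmetric])
  moreover have "(2::int) ^ (4 * \<sigma>) \<le> 2 ^ (7 * \<sigma>)" "(1::int) \<le> 2 ^ (7 * \<sigma>)" by (simp_all add: power_increasing)
  moreover have "(2::int) ^ (7 * \<sigma> + 10) = 1024 * 2 ^ (7 * \<sigma>)" by (simp add: power_add)
  ultimately have "mass * (3 * B) + mass * (9 * B\<^sup>2) + 1 \<le> 2 ^ (7 * \<sigma> + 10)" using m by linarith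
  also have "\<dots> < 2 ^ lpbits" by (rule power_strict_increasing) (simp_all add: lpbits_def)
  finally show ?thesis .
qed

lemma index_less:
  assumes "x \<le> 9 * \<sigma> + 3"
  shows "int x < 2 ^ lpbits"
proof -
  have "x < lpbits" using assms by (simp add: lpbits_def)
  then have "x < 2 ^ lpbits" using less_exp[of lpbits] by linarith
  then show ?thesis by (metis of_nat_less_iff of_nat_numeral of_nat_power)
qed

lemma answer_le: "answer + 2 * n + 2 \<le> 9 * \<sigma> + 3"
  using start_le by (simp add: answer_def start_def)

lemma lpbits_le: "(2::int) ^ lpbits \<le> 2 ^ bits"
  by (simp add: bits_def)

lemma lpc_less: "int lpc < 2 ^ bits"
proof -
  have "lpc < 2 ^ lpc" by (rule less_exp)
  also have "\<dots> \<le> 2 ^ bits" by (rule power_increasing) (simp_all add: bits_def)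
  finally show ?thesis by (metis of_nat_less_iff of_nat_numeral of_nat_power)
qed

lemma sqrt_grid: "(real x)\<^sup>2 \<ge> real k * (1 + 1 / \<epsilon>) \<longleftrightarrow> nat \<lceil>sqrt (real k * (1 + 1 / \<epsilon>))\<rceil> \<le> x"
proof -
  have "nat \<lceil>sqrt (real k * (1 + 1 / \<epsilon>))\<rceil> \<le> x \<longleftrightarrow> sqrt (real k * (1 + 1 / \<epsilon>)) \<le> real x"
    by (simp add: nat_le_iff ceiling_le_iff)
  also have "\<dots> \<longleftrightarrow> sqrt (real k * (1 + 1 / \<epsilon>)) \<le> sqrt ((real x)\<^sup>2)" by simp
  also have "\<dots> \<longleftrightarrow> real k * (1 + 1 / \<epsilon>) \<le> (real x)\<^sup>2" by (rule real_sqrt_le_iff)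
  finally show ?thesis by simp
qed

lemma grid_sq: "(of_int (int grid))\<^sup>2 \<ge> real k * (1 + 1 / \<epsilon>)"
  using sqrt_grid[of grid] by (simp add: grid_def)

lemma grid_ge: "1 \<le> grid"
  by (simp add: grid_def)

lemma grid_k: "k \<ge> 1 \<Longrightarrow> 2 \<le> nat \<lceil>sqrt (real k * (1 + 1 / \<epsilon>))\<rceil> \<and> grid = nat \<lceil>sqrt (real k * (1 + 1 / \<epsilon>))\<rceil>"
proof -
  assume k: "k \<ge> 1"
  define r where "r = nat \<lceil>sqrt (real k * (1 + 1 / \<epsilon>))\<rceil>"
  have "\<not> nat \<lceil>sqrt (real k * (1 + 1 / \<epsilon>))\<rceil> \<le> 1"
  proof
    assume "nat \<lceil>sqrt (real k * (1 + 1 / \<epsilon>))\<rceil> \<le> 1"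
    then have "real k * (1 + 1 / \<epsilon>) \<le> 1" using sqrt_grid[of 1] by simp
    moreover have "1 * (1 + 1 / \<epsilon>) \<le> real k * (1 + 1 / \<epsilon>)" using k \<epsilon> by (intro mult_right_mono) auto
    ultimately have "1 * (1 + 1 / \<epsilon>) \<le> 1" by (rule order_trans[rotated])
    moreover have "1 / \<epsilon> > 0" using \<epsilon> by simp
    ultimately show False by simp
  qed
  then have "2 \<le> r" unfolding r_def[symmetric] by linarith
  then show ?thesis unfolding grid_def r_def[symmetric] by simp
qed

lemma count: "2 * k + pieces \<le> lpc"
proof (cases "k = 0")
  case True
  then show ?thesis by (simp add: pieces_def lp_count_def)
next
  case False
  then show ?thesis using grid_k two_k_power_le[of grid k] by (simp add: pieces_def lp_count_def)
qed

lemma grid_le: "grid \<le> lpc"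
proof (cases "k = 0")
  case True
  then show ?thesis by (simp add: grid_def lp_count_def)
next
  case False
  then obtain k' where k': "k = Suc k'" by (cases k) auto
  have "grid \<le> grid ^ k" unfolding k' using grid_ge by simp
  then show ?thesis using count by (simp add: pieces_def)
qed

text \<open>W and w stay as they are, so the dimensions and total unimodularity are inherited. All
  bounds are present, which excludes unbounded LPs.\<close>

definition the_lp :: "(nat \<Rightarrow> int) \<Rightarrow> (nat \<Rightarrow> int) \<Rightarrow> (nat \<Rightarrow> int) \<Rightarrow> lp" where
  "the_lp c lo up = \<lparr>lp_A = iqp_W I, lp_b = iqp_w I, lp_c = vec n (\<lambda>j. lead * c j + base ^ j),
     lp_lo = vec n (\<lambda>j. Some (lo j)), lp_up = vec n (\<lambda>j. Some (up j))\<rparr>"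

lemma the_lp_vars: "lp_vars (the_lp c lo up) = n" "lp_ineqs (the_lp c lo up) = m"
  by (simp_all add: lp_vars_def lp_ineqs_def the_lp_def dims)

lemma wf_the_lp: "wf_lp (the_lp c lo up)"
proof -
  have "lp_b (the_lp c lo up) \<in> carrier_vec m" by (rule carrier_vecI) (simp add: the_lp_def dims(1))
  moreover have "lp_c (the_lp c lo up) \<in> carrier_vec n" "lp_lo (the_lp c lo up) \<in> carrier_vec n"
    "lp_up (the_lp c lo up) \<in> carrier_vec n" by (simp_all add: the_lp_def)
  ultimately show ?thesis unfolding wf_lp_def the_lp_vars by blast
qed

lemma the_lp_code: "lp_code (the_lp c lo up) = [int n, int m] @ map (\<lambda>j. lead * c j + base ^ j) [0..<n] @ body
    @ concat (map (\<lambda>j. [1, lo j]) [0..<n]) @ concat (map (\<lambda>j. [1, up j]) [0..<n])"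
  
  unfolding lp_code_def the_lp_vars
  unfolding the_lp_def lp.simps list_of_vec_vec body_def map_map o_def bound_code.simps append_assoc ..

definition in_bounds :: "(nat \<Rightarrow> int) \<Rightarrow> (nat \<Rightarrow> int) \<Rightarrow> (nat \<Rightarrow> int) \<Rightarrow> bool" where
  "in_bounds lo up x \<longleftrightarrow> (\<forall>j<n. lo j \<le> x j \<and> x j \<le> up j)"

lemma the_lp_feasible: "v \<in> lp_feasible (the_lp c lo up) \<longleftrightarrow>
    dim_vec v = n \<and> real_feas (\<lambda>j. v $ j) \<and> (\<forall>j<n. of_int (lo j) \<le> v $ j \<and> v $ j \<le> of_int (up j))"
proof (cases "dim_vec v = n")
  case True
  let ?A = "map_mat real_of_int (iqp_W I)"
  have rows: "(?A *\<^sub>v v) $ i = (\<Sum>j<n. of_int (coef i j) * v $ j)" if i: "i < m" for i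
  proof -
    have "(?A *\<^sub>v v) $ i = Matrix.row ?A i \<bullet> v" using i by (simp add: dims(5))
    also have "\<dots> = (\<Sum>j<n. Matrix.row ?A i $ j * v $ j)" by (simp add: scalar_prod_def True atLeast0LessThan)
    also have "\<dots> = (\<Sum>j<n. of_int (coef i j) * v $ j)"
      by (rule sum.cong) (use i in \<open>simp_all add: dims(5,6) coef_def\<close>)
    finally show ?thesis .
  qed
  have "?A *\<^sub>v v \<le> map_vec real_of_int (iqp_w I) \<longleftrightarrow> real_feas (\<lambda>j. v $ j)"
    using rows by (simp add: less_eq_vec_def dims(1,5) real_feas_def rhs_def)
  moreover have "(\<forall>l. lp_lo (the_lp c lo up) $ j = Some l \<longrightarrow> real_of_int l \<le> v $ j) \<longleftrightarrow> of_int (lo j) \<le> v $ j"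
    "(\<forall>l. lp_up (the_lp c lo up) $ j = Some l \<longrightarrow> v $ j \<le> real_of_int l) \<longleftrightarrow> v $ j \<le> of_int (up j)" if "j < n" for j
    using that by (simp_all add: the_lp_def)
  moreover have "lp_A (the_lp c lo up) = iqp_W I" "lp_b (the_lp c lo up) = iqp_w I" by (simp_all add: the_lp_def)
  ultimately show ?thesis unfolding lp_feasible_def the_lp_vars carrier_vec_def mem_Collect_eq using True by simp
next
  case False
  then show ?thesis unfolding lp_feasible_def the_lp_vars carrier_vec_def by simp
qed

lemma the_lp_objective: "dim_vec v = n \<Longrightarrow>
    lp_objective (the_lp c lo up) v = (\<Sum>j<n. of_int (lead * c j + base ^ j) * v $ j)"
  unfolding lp_objective_def scalar_prod_def atLeast0LessThan
  by (rule sum.cong) (simp_all add: the_lp_def)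

lemma the_lp_of_int: "vec n (\<lambda>j. of_int (x j)) \<in> lp_feasible (the_lp c lo up) \<longleftrightarrow> feas x \<and> in_bounds lo up x"
proof -
  have "real_feas (\<lambda>j. vec n (\<lambda>j. of_int (x j)) $ j) \<longleftrightarrow> real_feas (\<lambda>j. of_int (x j))"
    unfolding real_feas_def by simp
  then show ?thesis by (simp add: the_lp_feasible real_feas_of_int in_bounds_def)
qed

text \<open>The bounds rule out the answer \<open>Unbounded\<close>. Any optimal answer is integral
  by \<open>unique_optimum_integral\<close> for the perturbed costs, and
  \<open>perturbed_functional\<close> carries its optimality over to \<open>c\<close>.\<close>

lemma solve_the_lp:
  assumes width: "\<And>j. j < n \<Longrightarrow> up j - lo j \<le> 2 * B"
  shows "(solve (the_lp c lo up) = Infeasible \<and> (\<forall>y. feas y \<longrightarrow> \<not> in_bounds lo up y)) \<or>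
    (\<exists>x. solve (the_lp c lo up) = Solution (vec n (\<lambda>j. of_int (x j))) \<and> feas x \<and> in_bounds lo up x \<and>
      (\<forall>y. feas y \<and> in_bounds lo up y \<longrightarrow> (\<Sum>j<n. c j * x j) \<le> (\<Sum>j<n. c j * y j)))"
proof -
  define P where "P = the_lp c lo up"
  define c' where "c' j = base ^ n * c j + base ^ j" for j
  have c': "lead * c j + base ^ j = c' j" for j by (simp add: c'_def lead_def)
  have correct: "correct_outcome optimal (lp_objective P) (lp_feasible P) (map_outcome (map_vec real_of_rat) (solve P))"
    using solver wf_the_lp unfolding lp_solver_def P_def by blast
  have diff: "\<bar>x j - y j\<bar> \<le> base - 1" if "in_bounds lo up x" "in_bounds lo up y" "j < n" for x y j
    using that width[OF that(3)] unfolding in_bounds_def base_def by (smt (verit))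
  show ?thesis
  proof (cases "solve P")
    case Infeasible
    then have "lp_feasible P = {}" using correct by simp
    then have "\<forall>y. feas y \<longrightarrow> \<not> in_bounds lo up y" using the_lp_of_int[of _ c lo up] unfolding P_def by blast
    then show ?thesis using Infeasible unfolding P_def by blast
  next
    case Unbounded
    have "bdd_below (lp_objective P ` lp_feasible P)"
    proof (rule bdd_belowI2)
      fix v assume "v \<in> lp_feasible P"
      then have v: "dim_vec v = n" "\<forall>j<n. of_int (lo j) \<le> v $ j \<and> v $ j \<le> of_int (up j)"
        unfolding P_def the_lp_feasible by auto
      have "\<bar>\<Sum>j<n. of_int (c' j) * v $ j\<bar> \<le> (\<Sum>j<n. of_int \<bar>c' j\<bar> * (of_int \<bar>lo j\<bar> + of_int \<bar>up j\<bar>))"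
      proof (rule order_trans[OF sum_abs], rule sum_mono)
        fix j assume "j \<in> {..<n}"
        then have "\<bar>v $ j\<bar> \<le> of_int \<bar>lo j\<bar> + of_int \<bar>up j\<bar>" using v(2)[rule_format, of j] by auto
        then show "\<bar>of_int (c' j) * v $ j\<bar> \<le> of_int \<bar>c' j\<bar> * (of_int \<bar>lo j\<bar> + of_int \<bar>up j\<bar>)"
          by (simp add: abs_mult mult_left_mono)
      qed
      then show "- (\<Sum>j<n. of_int \<bar>c' j\<bar> * (of_int \<bar>lo j\<bar> + of_int \<bar>up j\<bar>)) \<le> lp_objective P v"
        unfolding P_def the_lp_objective[OF v(1)] c' by linarith
    qed
    then show ?thesis using correct Unbounded by simp
  next
    case (Solution v)
    define u where "u = map_vec real_of_rat v"
    have opt: "u \<in> lp_feasible P" "\<And>y. y \<in> lp_feasible P \<Longrightarrow> lp_objective P u \<le> lp_objective P y"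
      using correct Solution by (auto simp: u_def optimal_def)
    have u: "dim_vec u = n" "real_feas (\<lambda>j. u $ j)" "\<forall>j<n. of_int (lo j) \<le> u $ j \<and> u $ j \<le> of_int (up j)"
      using opt(1) unfolding P_def the_lp_feasible by auto
    have opt_int: "(\<Sum>j<n. of_int (c' j) * u $ j) \<le> of_int (\<Sum>j<n. c' j * y j)" if "feas y" "in_bounds lo up y" for y
    proof -
      have "vec n (\<lambda>j. of_int (y j)) \<in> lp_feasible P" using that by (simp add: P_def the_lp_of_int)
      from opt(2)[OF this] show ?thesis
        by (simp add: P_def the_lp_objective u(1) c')
    qed
    have "\<exists>x. feas x \<and> (\<forall>j<n. u $ j = of_int (x j))"
    proof (rule unique_optimum_integral[where v = "\<lambda>j. u $ j" and lo = lo and up = up and c = c'])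
      show "real_feas (\<lambda>j. u $ j)" by (rule u(2))
      show "of_int (lo j) \<le> u $ j \<and> u $ j \<le> of_int (up j)" if "j < n" for j using u(3) that by blast
      show "(\<Sum>j<n. of_int (c' j) * u $ j) \<le> of_int (\<Sum>j<n. c' j * x j)"
        if "feas x" "\<And>j. j < n \<Longrightarrow> lo j \<le> x j \<and> x j \<le> up j" for x
        by (rule opt_int[OF that(1)]) (use that(2) in \<open>simp add: in_bounds_def\<close>)
      show "x j = y j" if "\<And>j. j < n \<Longrightarrow> lo j \<le> x j \<and> x j \<le> up j" "\<And>j. j < n \<Longrightarrow> lo j \<le> y j \<and> y j \<le> up j"
          "(\<Sum>j<n. c' j * x j) = (\<Sum>j<n. c' j * y j)" "j < n" for x y j
        by (rule perturbed_functional(1)[OF base_ge _ that(3)[unfolded c'_def] that(4)])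
           (use that(1,2) diff in \<open>simp add: in_bounds_def\<close>)
    qed blast
    then obtain x where x: "feas x" "\<forall>j<n. u $ j = of_int (x j)" by blast
    have xb: "in_bounds lo up x" using u(3) x(2) unfolding in_bounds_def by (metis of_int_le_iff)
    have ux: "(\<Sum>j<n. of_int (c' j) * u $ j) = of_int (\<Sum>j<n. c' j * x j)" using x(2) by simp
    have "(\<Sum>j<n. c j * x j) \<le> (\<Sum>j<n. c j * y j)" if y: "feas y" "in_bounds lo up y" for y
    proof (rule perturbed_functional(2)[OF base_ge])
      show "\<bar>x j - y j\<bar> \<le> base - 1" if "j < n" for j by (rule diff[OF xb y(2) that])
      show "(\<Sum>j<n. (base ^ n * c j + base ^ j) * x j) \<le> (\<Sum>j<n. (base ^ n * c j + base ^ j) * y j)"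
        using opt_int[OF y] unfolding ux of_int_le_iff by (simp only: c'_def)
    qed
    moreover have "v = vec n (\<lambda>j. of_int (x j))"
    proof (rule eq_vecI)
      show "dim_vec v = dim_vec (vec n (\<lambda>j. rat_of_int (x j)))" using u(1) by (simp add: u_def)
      fix j assume j: "j < dim_vec (vec n (\<lambda>j. rat_of_int (x j)))"
      then have "real_of_rat (v $ j) = real_of_rat (of_int (x j))" using x(2) u(1) by (simp add: u_def)
      then show "v $ j = vec n (\<lambda>j. of_int (x j)) $ j" using j by (simp only: of_rat_eq_iff) simp
    qed
    ultimately show ?thesis using Solution x(1) xb unfolding P_def by blast
  qed
qed

lemma in_body: "z \<in> set body \<Longrightarrow> \<bar>z\<bar> \<le> mass"
  by (rule abs_code) (simp add: code_eq)

lemma the_lp_admissible: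
  assumes "\<And>j. j < n \<Longrightarrow> \<bar>c j\<bar> \<le> mass + mass * (4 * B)" "\<And>j. j < n \<Longrightarrow> \<bar>lo j\<bar> \<le> 3 * B" "\<And>j. j < n \<Longrightarrow> \<bar>up j\<bar> \<le> 3 * B"
  shows "admissible (the_lp c lo up)"
proof -
  have "\<bar>z\<bar> < 2 ^ lpbits" if "z \<in> set (lp_code (the_lp c lo up))" for z
  proof -
    have one: "(1::int) < 2 ^ lpbits" using three_B_less B_ge by linarith
    have "int n < 2 ^ lpbits" "int m < 2 ^ lpbits"
      using start_le index_less[of n] index_less[of m] by (simp_all add: start_def cells_def)
    moreover have "\<bar>z\<bar> < 2 ^ lpbits" if "z \<in> set body" for z
      using in_body[OF that] B_ge three_B_less by linarith
    moreover have "\<bar>lead * c j + base ^ j\<bar> < 2 ^ lpbits" if "j < n" for j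
      using objective_less assms(1) that by simp
    moreover have "\<bar>lo j\<bar> < 2 ^ lpbits" "\<bar>up j\<bar> < 2 ^ lpbits" if "j < n" for j
      using assms(2,3)[OF that] three_B_less by linarith+
    ultimately show ?thesis using that one unfolding the_lp_code by (auto split: if_splits)
  qed
  then have "code_size (lp_code (the_lp c lo up)) \<le> length (lp_code (the_lp c lo up)) * (lpbits + 1)"
    by (rule code_size_le)
  moreover have "length (lp_code (the_lp c lo up)) \<le> 2 + 6 * \<sigma>"
  proof -
    have "length (lp_code (the_lp c lo up)) = 2 + n + cells + 2 * n + 2 * n"
      unfolding the_lp_code by (simp add: length_body length_pairs)
    then show ?thesis using start_le by (simp add: start_def)
  qed
  ultimately have "code_size (lp_code (the_lp c lo up)) \<le> lp_bound"
    unfolding lp_bound_def by (meson mult_le_mono1 order_trans)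
  then show ?thesis by (simp add: admissible_def the_lp_def)
qed

end

section \<open>The program\<close>

declare modest_def [simp]

abbreviation cell :: "int \<Rightarrow> expr" where "cell x \<equiv> Cell (Const x)"
abbreviation put :: "int \<Rightarrow> expr \<Rightarrow> cmd" where "put x e \<equiv> Assign (Const x) e"
abbreviation seq :: "cmd \<Rightarrow> cmd \<Rightarrow> cmd" (infixr ";;" 60) where "c ;; d \<equiv> Seq c d"

text \<open>The input occupies the cells from 0 on, followed by the linear program at vstart and the
  answer of the solver at vanswer. The ranges found for the quadratic variables are stored in the
  cells -100, -102, ... and the best point found so far in the cells -101, -103, ...\<close>

abbreviation "vn \<equiv> (- 1 :: int)"
abbreviation "vm \<equiv> (- 2 :: int)"
abbreviation "vk \<equiv> (- 3 :: int)"
abbreviation "vstart \<equiv> (- 4 :: int)"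
abbreviation "vcells \<equiv> (- 5 :: int)"
abbreviation "vanswer \<equiv> (- 6 :: int)"
abbreviation "vmass \<equiv> (- 7 :: int)"
abbreviation "vcap \<equiv> (- 8 :: int)"
abbreviation "vB \<equiv> (- 9 :: int)"
abbreviation "vbase \<equiv> (- 10 :: int)"
abbreviation "vlead \<equiv> (- 11 :: int)"
abbreviation "vgrid \<equiv> (- 12 :: int)"
abbreviation "vpieces \<equiv> (- 13 :: int)"
abbreviation "vt \<equiv> (- 14 :: int)"
abbreviation "vflag \<equiv> (- 15 :: int)"
abbreviation "vempty \<equiv> (- 16 :: int)"
abbreviation "vbest \<equiv> (- 17 :: int)"
abbreviation "vj \<equiv> (- 18 :: int)"
abbreviation "vpower \<equiv> (- 19 :: int)"
abbreviation "vslope \<equiv> (- 20 :: int)"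
abbreviation "vlo \<equiv> (- 21 :: int)"
abbreviation "vup \<equiv> (- 22 :: int)"
abbreviation "vrest \<equiv> (- 23 :: int)"
abbreviation "vvalue \<equiv> (- 24 :: int)"
abbreviation "vx \<equiv> (- 25 :: int)"

text \<open>The language has no empty command; \<open>vup\<close> is written again before it is next
  read.\<close>

definition skip :: cmd where "skip = put vup (Const 0)"

text \<open>The bounds of a linear program are always present, so that each of them is encoded by 1 and its value.\<close>

definition emit :: cmd where
  "emit =
     Assign (Add (cell vstart) (Add (Const 2) (cell vj))) (Add (Mul (cell vlead) (cell vslope)) (cell vpower)) ;;
     put vpower (Mul (cell vpower) (cell vbase)) ;;
     put vx (Add (cell vstart) (Add (Const 2) (Add (cell vn) (Add (cell vcells) (Mul (Const 2) (cell vj)))))) ;;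
     Assign (cell vx) (Const 1) ;;
     Assign (Add (cell vx) (Const 1)) (cell vlo) ;;
     put vx (Add (cell vx) (Mul (Const 2) (cell vn))) ;;
     Assign (cell vx) (Const 1) ;;
     Assign (Add (cell vx) (Const 1)) (cell vup)"

definition build :: "cmd \<Rightarrow> cmd" where
  "build fill =
     put vpower (Const 1) ;;
     for_loop vj (cell vn) (fill ;; emit) ;;
     SolveLP (cell vstart) (cell vanswer)"

text \<open>One unit pays for the two addresses, the other for reading the LP and writing the
  answer.\<close>

lemma (in machine) wp_SolveLP:
  assumes "wf_lp P" "holds_at s (eval \<epsilon> s a) (lp_code P)" "modest a" "modest d" "ok P" "1 \<le> r" "2 \<le> N"
    and size: "code_size (lp_code P) + code_size (outcome_code rat_code (solve P)) \<le> U"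
    and ans: "\<And>z. z \<in> set (outcome_code rat_code (solve P)) \<Longrightarrow> \<bar>z\<bar> < 2 ^ S"
    and Q: "Q (store s (eval \<epsilon> s d) (outcome_code rat_code (solve P)))"
  shows "wp (SolveLP a d) N r Q s"
proof (rule wp_bounded)
  assume b: "bounded s"
  let ?t = "cost \<epsilon> s a + cost \<epsilon> s d + code_size (lp_code P) + code_size (outcome_code rat_code (solve P))"
  let ?s = "store s (eval \<epsilon> s d) (outcome_code rat_code (solve P))"
  have "exec solve \<epsilon> (SolveLP a d) s ?t [P] ?s" by (rule exec.SolveLP[OF assms(1,2) refl])
  moreover have "?t \<le> 2 * U" using cost_U[OF b assms(3)] cost_U[OF b assms(4)] size by linarith
  then have "?t \<le> N * U" using assms(7) by (meson mult_le_mono1 order_trans)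
  moreover have "bounded ?s" using b ans by (auto simp: bounded_def store_def)
  ultimately show ?thesis unfolding wp_def using assms(5,6) Q
    by (intro impI exI[of _ ?t] exI[of _ "[P]"] exI[of _ ?s]) simp
qed

section \<open>Memory invariants and the construction of a linear program\<close>

context iqp_run
begin

text \<open>What the setup establishes and both LP phases leave alone, including the part of the LP
  code that all LPs share.\<close>

definition glob :: "memory \<Rightarrow> bool" where
  "glob s \<longleftrightarrow> s vn = int n \<and> s vm = int m \<and> s vk = int k \<and> s vstart = int start \<and> s vcells = int cells \<and>
     s vanswer = int answer \<and> s vmass = mass \<and> s vcap = cap \<and> s vB = B \<and> s vbase = base \<and> s vlead = lead \<and>
     s vgrid = int grid \<and> s vpieces = int pieces \<and> holds_at s 0 (iqp_code I) \<and>
     s (int start) = int n \<and> s (int start + 1) = int m \<and> holds_at s (int start + 2 + int n) body"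

text \<open>Frame conditions: \<open>protected\<close> covers the cells of \<open>glob\<close>,
  \<open>kept\<close> the tables and loop cells that survive the construction and solution of an LP,
  \<open>scratch\<close> the cells that a \<open>fill\<close> command may change.\<close>

definition protected :: "int \<Rightarrow> bool" where
  "protected x \<longleftrightarrow> - 13 \<le> x \<and> x < int start + 2 \<or> int start + 2 + int n \<le> x \<and> x < int start + 2 + int n + int cells"

definition kept :: "int \<Rightarrow> bool" where
  "kept x \<longleftrightarrow> x \<le> - 100 \<or> - 17 \<le> x \<and> x \<le> - 14"

definition scratch :: "int \<Rightarrow> bool" where
  "scratch x \<longleftrightarrow> - 25 \<le> x \<and> x \<le> - 20"

lemma glob_frame:
  assumes g: "glob s" and eq: "\<And>x. protected x \<Longrightarrow> s' x = s x"
  shows "glob s'"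
proof -
  have "s' x = s x" if "- 13 \<le> x" "x < int start + 2" for x using eq[of x] that by (simp add: protected_def)
  moreover have "holds_at s' 0 (iqp_code I)"
    by (rule holds_at_cong[of _ _ _ s]) (use g eq in \<open>auto simp: glob_def protected_def length_code\<close>)
  moreover have "holds_at s' (int start + 2 + int n) body"
    by (rule holds_at_cong[of _ _ _ s]) (use g eq in \<open>auto simp: glob_def protected_def length_body\<close>)
  ultimately show ?thesis using g unfolding glob_def by simp
qed

lemma glob_upd: "glob s \<Longrightarrow> \<not> protected x \<Longrightarrow> glob (s(x := v))"
  by (erule glob_frame) auto

lemma globD:
  assumes "glob s"
  shows "s vn = int n" "s vm = int m" "s vk = int k" "s vstart = int start" "s vcells = int cells"
     "s vanswer = int answer" "s vmass = mass" "s vcap = cap" "s vB = B" "s vbase = base" "s vlead = lead"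
     "s vgrid = int grid" "s vpieces = int pieces"
  using assms by (simp_all add: glob_def)

lemma code_quad: assumes "holds_at s 0 (iqp_code I)" "i < k" shows "s (3 + int i) = quad i"
  using assms unfolding code_eq by (simp add: holds_at_append holds_at_Cons holds_at_map)

lemma code_lin: assumes "holds_at s 0 (iqp_code I)" "j < n" shows "s (3 + int k + int j) = lin j"
  using assms unfolding code_eq by (simp add: holds_at_append holds_at_Cons holds_at_map add.assoc)

lemma int_start: "int start = 3 + int k + int n + int cells"
  by (simp add: start_def)

lemma int_answer: "int answer = int start + 2 + 5 * int n + int cells"
  by (simp add: answer_def)

lemma address_less: "0 \<le> z \<Longrightarrow> z \<le> int answer + 2 * int n + 2 \<Longrightarrow> \<bar>z\<bar> < 2 ^ bits"
proof -
  assume "0 \<le> z" "z \<le> int answer + 2 * int n + 2"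
  moreover have "int (answer + 2 * n + 2) < 2 ^ lpbits" by (rule index_less[OF answer_le])
  then have "int answer + 2 * int n + 2 < 2 ^ lpbits" by simp
  ultimately show ?thesis using lpbits_le by linarith
qed

lemma box_less: "\<bar>z\<bar> \<le> 3 * B \<Longrightarrow> \<bar>z\<bar> < 2 ^ bits"
  using three_B_less lpbits_le by linarith

lemma objective_less': "\<bar>c\<bar> \<le> mass + mass * (4 * B) \<Longrightarrow> j \<le> n \<Longrightarrow> \<bar>lead * c + base ^ j\<bar> < 2 ^ bits"
  using objective_less lpbits_le by (meson less_le_trans)

lemma power_less: "j \<le> n \<Longrightarrow> \<bar>base ^ j\<bar> < 2 ^ bits"
  using objective_less'[of 0 j] B_ge mass_nonneg by simp

lemma grid_less: "0 \<le> z \<Longrightarrow> z \<le> int lpc \<Longrightarrow> \<bar>z\<bar> < 2 ^ bits"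
  using lpc_less by linarith

lemma value_less': "\<bar>z\<bar> \<le> mass * (3 * B) + mass * (9 * B\<^sup>2) + 1 \<Longrightarrow> \<bar>z\<bar> < 2 ^ bits"
  using value_less lpbits_le by linarith

lemma one_less_bits: "(1::int) < 2 ^ bits"
  using box_less[of 1] B_ge by simp

text \<open>R is the value of vrest before each coordinate: the part of the piece number whose digits have
  not been read yet.\<close>

definition fills :: "cmd \<Rightarrow> nat \<Rightarrow> (nat \<Rightarrow> int) \<Rightarrow> (nat \<Rightarrow> int) \<Rightarrow> (nat \<Rightarrow> int) \<Rightarrow> (nat \<Rightarrow> int) \<Rightarrow> memory \<Rightarrow> bool" where
  "fills fill N R c lo up s0 \<longleftrightarrow> (\<forall>j s. j < n \<and> bounded s \<and> glob s \<and> s vj = int j \<and> s vrest = R j \<and> (\<forall>x. kept x \<longrightarrow> s x = s0 x) \<longrightarrow>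
     wp fill N 0 (\<lambda>s'. s' vslope = c j \<and> s' vlo = lo j \<and> s' vup = up j \<and> s' vrest = R (Suc j) \<and> (\<forall>x. \<not> scratch x \<longrightarrow> s' x = s x)) s)"

text \<open>A rational takes two cells, and at integral points the denominator is 1; so coordinate j
  stands at offset 1 + 2 j.\<close>

definition answered :: "(nat \<Rightarrow> int) \<Rightarrow> (nat \<Rightarrow> int) \<Rightarrow> (nat \<Rightarrow> int) \<Rightarrow> memory \<Rightarrow> bool" where
  "answered c lo up s \<longleftrightarrow> (s (int answer) = 1 \<and> (\<forall>y. feas y \<longrightarrow> \<not> in_bounds lo up y)) \<or>
     (\<exists>x. s (int answer) = 0 \<and> (\<forall>j<n. s (int answer + 1 + 2 * int j) = x j) \<and> feas x \<and> in_bounds lo up x \<and>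
      (\<forall>y. feas y \<and> in_bounds lo up y \<longrightarrow> (\<Sum>j<n. c j * x j) \<le> (\<Sum>j<n. c j * y j)))"

text \<open>The ends of a piece are at most B and 3 B in absolute value; their sum, at most 4 B,
  enters the chord slopes.\<close>

definition modest_lp :: "(nat \<Rightarrow> int) \<Rightarrow> (nat \<Rightarrow> int) \<Rightarrow> (nat \<Rightarrow> int) \<Rightarrow> bool" where
  "modest_lp c lo up \<longleftrightarrow> (\<forall>j<n. \<bar>c j\<bar> \<le> mass + mass * (4 * B) \<and> \<bar>lo j\<bar> \<le> 3 * B \<and> \<bar>up j\<bar> \<le> 3 * B \<and> up j - lo j \<le> 2 * B)"

definition loaded :: "(nat \<Rightarrow> int) \<Rightarrow> (nat \<Rightarrow> int) \<Rightarrow> (nat \<Rightarrow> int) \<Rightarrow> nat \<Rightarrow> memory \<Rightarrow> bool" where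
  "loaded c lo up j s \<longleftrightarrow> (\<forall>i<j. s (int start + 2 + int i) = lead * c i + base ^ i \<and>
     (let z = int start + 2 + int n + int cells + 2 * int i in
        s z = 1 \<and> s (z + 1) = lo i \<and> s (z + 2 * int n) = 1 \<and> s (z + 2 * int n + 1) = up i))"

lemma loaded_code:
  assumes g: "glob s" and l: "loaded c lo up n s"
  shows "holds_at s (int start) (lp_code (the_lp c lo up))"
proof -
  have "holds_at s (int start + 2) (map (\<lambda>j. lead * c j + base ^ j) [0..<n])"
    using l by (simp add: holds_at_map loaded_def)
  moreover have "holds_at s (int start + 2 + int n + int cells) (concat (map (\<lambda>j. [1, lo j]) [0..<n]))"
    "holds_at s (int start + 2 + int n + int cells + 2 * int n) (concat (map (\<lambda>j. [1, up j]) [0..<n]))"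
    using l by (simp_all add: holds_at_pairs loaded_def Let_def algebra_simps)
  ultimately show ?thesis
    using g unfolding the_lp_code
    by (simp add: holds_at_append holds_at_Cons glob_def length_body length_pairs add.assoc add.commute add.left_commute)
qed

lemma solve_answered:
  assumes g: "glob s" and l: "loaded c lo up n s" and md: "modest_lp c lo up"
    and Q: "\<And>s'. glob s' \<Longrightarrow> (\<And>x. kept x \<Longrightarrow> s' x = s x) \<Longrightarrow> answered c lo up s' \<Longrightarrow> Q s'"
  shows "wp (SolveLP (cell vstart) (cell vanswer)) 2 1 Q s"
proof -
  define P where "P = the_lp c lo up"
  define ans where "ans = outcome_code rat_code (solve P)"
  have adm: "admissible P" unfolding P_def by (rule the_lp_admissible) (use md in \<open>auto simp: modest_lp_def\<close>)
  have sol: "(solve P = Infeasible \<and> (\<forall>y. feas y \<longrightarrow> \<not> in_bounds lo up y)) \<or>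
    (\<exists>x. solve P = Solution (vec n (\<lambda>j. of_int (x j))) \<and> feas x \<and> in_bounds lo up x \<and>
      (\<forall>y. feas y \<and> in_bounds lo up y \<longrightarrow> (\<Sum>j<n. c j * x j) \<le> (\<Sum>j<n. c j * y j)))"
    unfolding P_def by (rule solve_the_lp) (use md in \<open>auto simp: modest_lp_def\<close>)
  have code: "ans = 0 # concat (map (\<lambda>j. [x j, 1]) [0..<n])" if "solve P = Solution (vec n (\<lambda>j. of_int (x j)))" for x
    unfolding ans_def that by (simp add: list_of_vec_vec o_def rat_code_def)
  have small: "\<bar>z\<bar> < 2 ^ lpbits" if "z \<in> set ans" for z
    using sol
  proof (elim disjE exE conjE)
    assume "solve P = Infeasible"
    then have "z = 1" using that by (simp add: ans_def)
    then show ?thesis using three_B_less B_ge by simp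
  next
    fix x assume x: "solve P = Solution (vec n (\<lambda>j. of_int (x j)))" "in_bounds lo up x"
    have "\<bar>x j\<bar> \<le> 3 * B" if "j < n" for j
      using x(2) md that unfolding in_bounds_def modest_lp_def by (smt (verit))
    then show ?thesis using that three_B_less B_ge unfolding code[OF x(1)] by (force split: if_splits)
  qed
  have len: "length ans \<le> 1 + 2 * n"
    using sol
  proof (elim disjE exE conjE)
    assume "solve P = Infeasible"
    then show ?thesis by (simp add: ans_def)
  next
    fix x assume "solve P = Solution (vec n (\<lambda>j. of_int (x j)))"
    from code[OF this] show ?thesis by (simp add: length_pairs)
  qed
  have "code_size ans \<le> length ans * (lpbits + 1)" by (rule code_size_le) (rule small)
  also have "\<dots> \<le> (1 + 2 * \<sigma>) * (lpbits + 1)"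
    using len start_le by (intro mult_le_mono1) (simp add: start_def)
  finally have size: "code_size (lp_code P) + code_size ans \<le> unit"
    using adm unfolding admissible_def unit_def by linarith
  let ?s = "store s (int answer) ans"
  have low: "?s x = s x" if "x < int answer" for x using that by (simp add: store_def)
  have h: "holds_at ?s (int answer) ans" by (rule holds_at_store)
  have "Q ?s"
  proof (rule Q)
    show "glob ?s"
      by (rule glob_frame[OF g], rule low) (auto simp: protected_def int_answer)
    show "?s x = s x" if "kept x" for x by (rule low) (use that in \<open>auto simp: kept_def\<close>)
    show "answered c lo up ?s"
      using sol
    proof (elim disjE exE conjE)
      assume "solve P = Infeasible" "\<forall>y. feas y \<longrightarrow> \<not> in_bounds lo up y"
      then show ?thesis using h by (simp add: answered_def ans_def holds_at_Cons)
    next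
      fix x assume x: "solve P = Solution (vec n (\<lambda>j. of_int (x j)))" "feas x" "in_bounds lo up x"
        "\<forall>y. feas y \<and> in_bounds lo up y \<longrightarrow> (\<Sum>j<n. c j * x j) \<le> (\<Sum>j<n. c j * y j)"
      have "?s (int answer) = 0 \<and> (\<forall>j<n. ?s (int answer + 1 + 2 * int j) = x j)"
        using h unfolding code[OF x(1)] by (simp add: holds_at_Cons holds_at_pairs)
      then show ?thesis using x unfolding answered_def by blast
    qed
  qed
  moreover have "\<bar>z\<bar> < 2 ^ bits" if "z \<in> set ans" for z using small[OF that] lpbits_le by linarith
  ultimately show ?thesis
    using g l size
    by (intro wp_SolveLP[of P]) (auto simp: P_def wf_the_lp globD loaded_code modest_def ans_def adm[unfolded P_def])
qed

lemma wp_emit: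
  assumes g: "glob s" and j: "j < n" and v: "s vj = int j" "s vslope = c" "s vlo = l" "s vup = u" "s vpower = p"
    and b: "\<bar>lead * c + p\<bar> < 2 ^ bits" "\<bar>p * base\<bar> < 2 ^ bits" "\<bar>l\<bar> < 2 ^ bits" "\<bar>u\<bar> < 2 ^ bits"
    and z: "z = int start + (2 + (int n + (int cells + 2 * int j)))"
    and Q: "Q (s(int start + (2 + int j) := lead * c + p, vpower := p * base, vx := z, z := 1, z + 1 := l,
           vx := z + 2 * int n, z + 2 * int n := 1, z + 2 * int n + 1 := u))"
  shows "wp emit 8 0 Q s"
proof -
  have zb: "\<bar>z\<bar> < 2 ^ bits" "\<bar>z + 2 * int n\<bar> < 2 ^ bits"
    by (rule address_less; use j in \<open>simp add: z int_answer int_start\<close>)+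
  have ne: "- y \<noteq> z" "y + z \<noteq> 0" "z \<noteq> - y" "z + 2 * int n \<noteq> - y" "z + (1 + 2 * int n) \<noteq> - y" if "y > 0" for y :: int
    using that by (simp_all add: z)
  have ne0: "int start + (2 + int j) \<noteq> - y" if "y > 0" for y using that by simp
  note gd = globD[OF g]
  show ?thesis
    unfolding emit_def
    apply (rule wp_step, simp, simp, simp, simp add: gd v b, simp add: gd v)
    apply (rule wp_step, simp, simp, simp, simp add: gd v b ne0, simp add: gd v ne0)
    apply (rule wp_step, simp, simp, simp, simp add: gd v z[symmetric] zb ne0, simp add: gd v ne0 z[symmetric])
    apply (rule wp_step, simp, simp, simp, simp add: one_less_bits, simp)
    apply (rule wp_step, simp, simp, simp, simp add: ne ne0 v b, simp add: ne ne0 v)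
    apply (rule wp_step, simp, simp, simp, simp add: ne ne0 v gd zb, simp add: ne ne0 v gd)
    apply (rule wp_step, simp, simp, simp, simp add: one_less_bits, simp)
    apply (rule wp_Assign, simp, simp, simp, simp add: ne ne0 v b)
    using Q apply (simp add: ne ne0 v)
    done
qed

text \<open>A coordinate is charged N steps for \<open>fill\<close>, 8 for \<open>emit\<close> and 2
  for the loop; the 5 are shared by the initial power, the loop overhead and the LP.\<close>

lemma wp_build:
  assumes fill: "fills fill N R c lo up s0" and md: "modest_lp c lo up" and g: "glob s0" and r: "s0 vrest = R 0"
    and Q: "\<And>s. bounded s \<Longrightarrow> glob s \<Longrightarrow> (\<And>x. kept x \<Longrightarrow> s x = s0 x) \<Longrightarrow> answered c lo up s \<Longrightarrow> Q s"
    and N': "n * (N + 10) + 5 \<le> N'"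
  shows "wp (build fill) N' 1 Q s0"
proof -
  define Inv where "Inv j s \<longleftrightarrow> glob s \<and> s vpower = base ^ j \<and> s vrest = R j \<and> (\<forall>x. kept x \<longrightarrow> s x = s0 x) \<and> loaded c lo up j s" for j s
  have loop: "wp (for_loop vj (cell vn) (fill ;; emit)) (n * (N + 10) + 2) 0
     (wp (SolveLP (cell vstart) (cell vanswer)) 2 1 Q) (s0(vpower := 1))"
  proof (rule wp_for[where Inv = Inv and L = n and N = "N + 8" and r = 0])
    show "eval \<epsilon> s (cell vn) = int n" if "Inv j s" for j s using that by (simp add: Inv_def globD)
    show "Inv 0 ((s0(vpower := 1))(vj := 0))"
      using g r by (auto simp: Inv_def loaded_def kept_def protected_def intro!: glob_upd)
    show "int n < 2 ^ bits" using address_less[of "int n"] by (simp add: int_answer int_start)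
    fix s assume "Inv n s" "s vj = int n" "bounded s"
    then show "wp (SolveLP (cell vstart) (cell vanswer)) 2 1 Q s"
      by (intro wp_bounded[OF wp_mono[OF solve_answered[OF _ _ md, where Q = "\<lambda>s'. glob s' \<and> (\<forall>x. kept x \<longrightarrow> s' x = s x) \<and> answered c lo up s'"]]])
         (auto simp: Inv_def intro!: Q)
  next
    fix j s assume j: "j < n" and inv: "Inv j s" and sj: "s vj = int j" and b: "bounded s"
    note inv' = inv[unfolded Inv_def]
    show "wp (fill ;; emit) (N + 8) 0
      (\<lambda>s'. s' vj = int j \<and> Inv (Suc j) (s'(vj := int (Suc j)))) s"
    proof (rule wp_Seq[of _ N 0 _ 8 0])
      have "wp fill N 0 (\<lambda>s'. s' vslope = c j \<and> s' vlo = lo j \<and> s' vup = up j \<and> s' vrest = R (Suc j) \<and> (\<forall>x. \<not> scratch x \<longrightarrow> s' x = s x)) s"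
        using fill j b inv' sj unfolding fills_def by blast
      then show "wp fill N 0 (wp emit 8 0 (\<lambda>s'. s' vj = int j \<and> Inv (Suc j) (s'(vj := int (Suc j))))) s"
      proof (rule wp_mono)
        fix s1 assume s1: "s1 vslope = c j \<and> s1 vlo = lo j \<and> s1 vup = up j \<and> s1 vrest = R (Suc j) \<and> (\<forall>x. \<not> scratch x \<longrightarrow> s1 x = s x)"
        then have eq: "s1 x = s x" if "\<not> scratch x" for x using that by blast
        have g1: "glob s1" by (rule glob_frame[of s]) (use inv' eq in \<open>auto simp: protected_def scratch_def\<close>)
        have vals: "s1 vpower = base ^ j" "s1 vj = int j" using eq[of vpower] eq[of vj] inv' sj by (simp_all add: scratch_def)
        note gd = globD[OF g1]
        define z where "z = int start + 2 + int n + int cells + 2 * int j"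
        have z: "int start + (2 + (int n + (int cells + 2 * int j))) = z" by (simp add: z_def)
        have zb: "\<bar>z\<bar> < 2 ^ bits" "\<bar>z + 2 * int n\<bar> < 2 ^ bits"
          by (rule address_less; use j in \<open>simp add: z_def int_answer int_start\<close>)+
        have ob: "\<bar>lead * c j + base ^ j\<bar> < 2 ^ bits" using objective_less' md j by (simp add: modest_lp_def)
        have pb: "\<bar>base ^ j * base\<bar> < 2 ^ bits" using power_less[of "Suc j"] j by (simp add: mult.commute)
        have lb: "\<bar>lo j\<bar> < 2 ^ bits" "\<bar>up j\<bar> < 2 ^ bits" using box_less md j by (auto simp: modest_lp_def)
        have ne: "z \<noteq> - 18" "z \<noteq> - 19" "z \<noteq> - 25" "z + 1 \<noteq> - 25" "z \<ge> 0" by (simp_all add: z_def)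
        define s2 where "s2 = s1(int start + (2 + int j) := lead * c j + base ^ j, vpower := base ^ j * base, vx := z, z := 1, z + 1 := lo j,
           vx := z + 2 * int n, z + 2 * int n := 1, z + 2 * int n + 1 := up j)"
        have fin: "s2 vj = int j \<and> Inv (Suc j) (s2(vj := int (Suc j)))"
        proof
          have lo_add: "int start + (2 + int j) \<ge> 0" by simp
          show "s2 vj = int j" using ne vals by (simp add: s2_def)
          have eq2: "s2 x = s1 x" if "x \<noteq> int start + 2 + int j" "x \<noteq> vpower" "x \<noteq> vx"
              "x \<noteq> z" "x \<noteq> z + 1" "x \<noteq> z + 2 * int n" "x \<noteq> z + 2 * int n + 1" for x
            unfolding s2_def using that by (simp add: add.assoc)
          have zn: "z \<ge> int start + 2 + int n + int cells" by (simp add: z_def)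
          have neg: "s2 x = s1 x" if "x < 0" "x \<noteq> vpower" "x \<noteq> vx" for x
            by (rule eq2) (use that zn in linarith)+
          have "s2 x = s1 x" if "protected x" for x
            by (rule eq2) (use that zn j in \<open>unfold protected_def, linarith\<close>)+
          then have "glob s2" by (rule glob_frame[OF g1])
          then have "glob (s2(vj := int (Suc j)))" by (rule glob_upd) (simp add: protected_def)
          moreover have "s2 vpower = base ^ Suc j" using ne by (simp add: s2_def mult.commute)
          moreover have "s2 vrest = R (Suc j)" using neg[of vrest] s1 by simp
          moreover have "s2 x = s0 x" if "kept x" for x
          proof -
            have "s2 x = s1 x" by (rule neg) (use that in \<open>auto simp: kept_def\<close>)
            then show ?thesis using eq[of x] inv' that by (auto simp: kept_def scratch_def)
          qed
          moreover have "loaded c lo up (Suc j) s2"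
            unfolding loaded_def
          proof (intro allI impI)
            fix i assume i: "i < Suc j"
            show "s2 (int start + 2 + int i) = lead * c i + base ^ i \<and> (let z = int start + 2 + int n + int cells + 2 * int i in
                s2 z = 1 \<and> s2 (z + 1) = lo i \<and> s2 (z + 2 * int n) = 1 \<and> s2 (z + 2 * int n + 1) = up i)"
            proof (cases "i = j")
              case True
              have "int start + 2 + int j < z" using zn j by linarith
              then show ?thesis using j ne unfolding Let_def True z_def[symmetric] s2_def by (simp add: add.assoc)
            next
              case False
              then have ij: "i < j" using i by simp
              define y where "y = int start + 2 + int n + int cells + 2 * int i"
              have yz: "y + 2 \<le> z" "y > int start + 2 + int j" "z < y + 2 * int n" using ij j by (simp_all add: y_def z_def)
              have y0: "y \<ge> 0" by (simp add: y_def)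
              have s1i: "s1 x = s x" if "x \<ge> 0" for x using eq[of x] that by (simp add: scratch_def)
              have upd: "s2 (int start + 2 + int i) = s1 (int start + 2 + int i)" "s2 y = s1 y" "s2 (y + 1) = s1 (y + 1)"
                "s2 (y + 2 * int n) = s1 (y + 2 * int n)" "s2 (y + 2 * int n + 1) = s1 (y + 2 * int n + 1)"
                by (rule eq2; use yz y0 ij j in \<open>unfold z_def y_def, linarith\<close>)+
              have "s (int start + 2 + int i) = lead * c i + base ^ i \<and>
                s y = 1 \<and> s (y + 1) = lo i \<and> s (y + 2 * int n) = 1 \<and> s (y + 2 * int n + 1) = up i"
                using inv' ij unfolding loaded_def Let_def y_def by blast
              then show ?thesis
                using y0 unfolding Let_def y_def[symmetric] upd by (simp add: s1i)
            qed
          qed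
          ultimately show "Inv (Suc j) (s2(vj := int (Suc j)))"
            unfolding Inv_def by (auto simp: kept_def loaded_def Let_def)
        qed
        show "wp emit 8 0 (\<lambda>s'. s' vj = int j \<and> Inv (Suc j) (s'(vj := int (Suc j)))) s1"
          by (rule wp_emit[OF g1 j vals(2) _ _ _ vals(1) ob pb lb z[symmetric]])
             (use s1 fin in \<open>simp_all only: s2_def\<close>)
      qed simp_all
    qed simp_all
  qed auto
  show ?thesis
    unfolding build_def
    by (rule wp_step, simp_all add: one_less_bits)
       (use N' in \<open>auto intro!: wp_Seq[OF loop[simplified]]\<close>)
qed

end

text \<open>The continuation is run separately after each branch, which spares a common
  postcondition of the branches.\<close>

lemma (in machine) wp_If_Seq:
  assumes e: "modest e" "1 \<le> N"
    and T: "eval \<epsilon> s e > 0 \<Longrightarrow> wp (c ;; rest) (N - 1) r Q s" and F: "eval \<epsilon> s e \<le> 0 \<Longrightarrow> wp (d ;; rest) (N - 1) r Q s"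
  shows "wp (IfPos e c d ;; rest) N r Q s"
proof (rule wp_bounded)
  assume b: "bounded s"
  have ce: "cost \<epsilon> s e \<le> U" using cost_U[OF b e(1)] by linarith
  have N: "U + (N - 1) * U = N * U" using e(2) by (cases N) auto
  define c' where "c' = (if eval \<epsilon> s e > 0 then c else d)"
  have "wp (c' ;; rest) (N - 1) r Q s" using T F by (simp add: c'_def)
  then obtain t Ps s' where x: "exec solve \<epsilon> (c' ;; rest) s t Ps s'" "t \<le> (N - 1) * U" "length Ps \<le> r" "\<forall>P\<in>set Ps. ok P" "bounded s'" "Q s'"
    using b unfolding wp_def by blast
  from x(1) obtain t1 Ps1 s1 t2 Ps2 where y: "t = t1 + t2" "Ps = Ps1 @ Ps2" "exec solve \<epsilon> c' s t1 Ps1 s1" "exec solve \<epsilon> rest s1 t2 Ps2 s'"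
    by (cases rule: exec.cases) auto
  have "exec solve \<epsilon> (IfPos e c d) s (cost \<epsilon> s e + t1) Ps1 s1"
  proof (cases "eval \<epsilon> s e > 0")
    case True
    then show ?thesis using exec.IfTrue[OF True, of solve c t1 Ps1 s1 d] y(3) by (simp add: c'_def del: cost.simps)
  next
    case False
    then have "eval \<epsilon> s e \<le> 0" by simp
    from exec.IfFalse[OF this, of solve d t1 Ps1 s1 c] show ?thesis using False y(3) by (simp add: c'_def del: cost.simps)
  qed
  from exec.Seq[OF this y(4)] have "exec solve \<epsilon> (IfPos e c d ;; rest) s (cost \<epsilon> s e + t1 + t2) Ps s'" using y(2) by simp
  moreover have "cost \<epsilon> s e + t1 + t2 \<le> N * U" using x(2) y(1) ce N by linarith
  ultimately show ?thesis unfolding wp_def using x by blast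
qed

section \<open>Ranges of the quadratic variables\<close>

text \<open>Without equality test or remainder, 1 div (1 + (j - t div 2)^2) is the indicator of j =
  t div 2, and 1 - 2 (t - 2 (t div 2)) is the sign for round t.\<close>

definition fill_bounds :: cmd where
  "fill_bounds =
     put vslope (Mul (Sub (Const 1) (Mul (Const 2) (Sub (cell vt) (Mul (Const 2) (Quot (cell vt) (Const 2))))))
       (Quot (Const 1) (Add (Const 1) (Mul (Sub (cell vj) (Quot (cell vt) (Const 2))) (Sub (cell vj) (Quot (cell vt) (Const 2))))))) ;;
     put vlo (Sub (Const 0) (cell vB)) ;;
     put vup (cell vB)"

text \<open>Squares stand in for absolute values.\<close>

abbreviation "flag_large \<equiv> IfPos (Sub (Mul (cell vx) (cell vx)) (Mul (cell vmass) (cell vmass))) (put vflag (Const 1)) skip"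
abbreviation "store_bound \<equiv> Assign (Sub (Const (- 100)) (Mul (Const 2) (cell vt))) (cell vx) ;; flag_large"
abbreviation "read_bound \<equiv> put vx (Cell (Add (cell vanswer) (Add (Const 1) (Mul (Const 2) (Quot (cell vt) (Const 2))))))"
abbreviation "lp_solved \<equiv> Sub (Const 1) (Cell (cell vanswer))"

text \<open>If the box holds no feasible point, 0 is recorded; the flag stays down, and the pieces
  then reveal infeasibility.\<close>

definition bounds_step :: cmd where
  "bounds_step =
     build fill_bounds ;;
     IfPos lp_solved
       read_bound
       (put vx (Const 0)) ;;
     store_bound"

definition bounds_phase :: cmd where
  "bounds_phase = for_loop vt (Mul (Const 2) (cell vk)) bounds_step"

context iqp_run
begin

definition bound_sign :: "nat \<Rightarrow> int" where
  "bound_sign t = 1 - 2 * (int t mod 2)"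

text \<open>Even t minimizes the coordinate t div 2, odd t maximizes it.\<close>

definition bound_value :: "nat \<Rightarrow> int \<Rightarrow> bool" where
  "bound_value t v \<longleftrightarrow> (if \<exists>y. feas y \<and> in_box B y
     then \<exists>x. feas x \<and> in_box B x \<and> x (t div 2) = v \<and>
       (\<forall>y. feas y \<and> in_box B y \<longrightarrow> bound_sign t * v \<le> bound_sign t * y (t div 2))
     else v = 0)"

lemma in_bounds_box: "in_bounds (\<lambda>_. - B) (\<lambda>_. B) x \<longleftrightarrow> in_box B x"
  by (auto simp: in_bounds_def in_box_def abs_le_iff)

lemma bound_value_le: "bound_value t v \<Longrightarrow> t div 2 < n \<Longrightarrow> \<bar>v\<bar> \<le> B"
  using B_ge unfolding bound_value_def in_box_def by (auto split: if_splits)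

lemma fill_bounds_fills:
  assumes t: "s0 vt = int t"
  shows "fills fill_bounds 3 (\<lambda>_. s0 vrest) (\<lambda>j. bound_sign t * (if j = t div 2 then 1 else 0)) (\<lambda>_. - B) (\<lambda>_. B) s0"
  unfolding fills_def
proof (intro allI impI, elim conjE)
  fix j s assume j: "j < n" and g: "glob s" and v: "s vj = int j" "s vrest = s0 vrest" "\<forall>x. kept x \<longrightarrow> s x = s0 x"
  have st: "s vt = int t" using v(3) t by (simp add: kept_def)
  note gd = globD[OF g]
  have sign: "1 - 2 * (int t - 2 * (int t div 2)) = bound_sign t"
    by (simp add: bound_sign_def minus_mult_div_eq_mod)
  have ind: "1 div (1 + (int j - int t div 2) * (int j - int t div 2)) = (if j = t div 2 then 1 else 0)"
  proof (cases "j = t div 2")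
    case True
    then show ?thesis by (simp add: zdiv_int)
  next
    case False
    then have "int j - int t div 2 \<noteq> 0" by (metis eq_iff_diff_eq_0 of_nat_eq_iff of_nat_numeral zdiv_int)
    then have "(int j - int t div 2) * (int j - int t div 2) > 0" using not_square_less_zero by (metis mult_eq_0_iff linorder_neqE)
    then show ?thesis using False by simp
  qed
  define c where "c = bound_sign t * (if j = t div 2 then 1 else 0)"
  have c: "\<bar>c\<bar> < 2 ^ bits"
    using one_less_bits by (simp add: c_def bound_sign_def) linarith
  have Bb: "\<bar>B\<bar> < 2 ^ bits" using box_less[of B] B_ge by simp
  show "wp fill_bounds 3 0 (\<lambda>s'. s' vslope = bound_sign t * (if j = t div 2 then 1 else 0) \<and> s' vlo = - B \<and> s' vup = B \<and>
      s' vrest = s0 vrest \<and> (\<forall>x. \<not> scratch x \<longrightarrow> s' x = s x)) s"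
    unfolding fill_bounds_def c_def[symmetric]
    apply (rule wp_step, simp, simp, simp)
     apply (simp only: eval.simps st v sign ind c c_def[symmetric])
    apply (simp only: eval.simps st v sign ind c_def[symmetric])
    apply (rule wp_step, simp, simp, simp, simp add: gd Bb, simp add: gd)
    apply (rule wp_Assign, simp, simp, simp, simp add: gd Bb)
    apply (auto simp: gd v scratch_def)
    done
qed

lemma bounds_lp_modest: "modest_lp (\<lambda>j. bound_sign t * (if j = t div 2 then 1 else 0)) (\<lambda>_. - B) (\<lambda>_. B)"
proof -
  have "\<bar>bound_sign t * (if j = t div 2 then 1 else 0)\<bar> \<le> mass + mass * (4 * B)" if "j < n" for j
  proof -
    have "int n \<in> set (iqp_code I)" by (simp add: code_eq)
    from abs_code[OF this] have "1 \<le> mass" using that by simp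
    moreover have "0 \<le> mass * (4 * B)" using B_ge mass_nonneg by simp
    moreover have "\<bar>bound_sign t * (if j = t div 2 then 1 else 0)\<bar> \<le> 1" by (simp add: bound_sign_def) linarith
    ultimately show ?thesis by linarith
  qed
  then show ?thesis using B_ge by (simp add: modest_lp_def)
qed

lemma answered_bound:
  assumes a: "answered (\<lambda>j. bound_sign t * (if j = t div 2 then 1 else 0)) (\<lambda>_. - B) (\<lambda>_. B) s" and t: "t div 2 < n"
  shows "(s (int answer) = 0 \<and> bound_value t (s (int answer + 1 + 2 * int (t div 2)))) \<or> (s (int answer) = 1 \<and> bound_value t 0)"
proof -
  have sum: "(\<Sum>j<n. bound_sign t * (if j = t div 2 then 1 else 0) * x j) = bound_sign t * x (t div 2)" for x
  proof -
    have "(\<Sum>j<n. bound_sign t * (if j = t div 2 then 1 else 0) * x j) = (\<Sum>j<n. if j = t div 2 then bound_sign t * x j else 0)"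
      by (rule sum.cong) auto
    then show ?thesis using t by simp
  qed
  from a show ?thesis
    unfolding answered_def sum in_bounds_box
  proof (elim disjE exE conjE)
    assume "s (int answer) = 1" "\<forall>y. feas y \<longrightarrow> \<not> in_box B y"
    then show ?thesis by (auto simp: bound_value_def)
  next
    fix x assume "s (int answer) = 0" "\<forall>j<n. s (int answer + 1 + 2 * int j) = x j" "feas x" "in_box B x"
      "\<forall>y. feas y \<and> in_box B y \<longrightarrow> bound_sign t * x (t div 2) \<le> bound_sign t * y (t div 2)"
    then show ?thesis using t unfolding bound_value_def by auto
  qed
qed

definition bounds_inv :: "nat \<Rightarrow> memory \<Rightarrow> bool" where
  "bounds_inv t s \<longleftrightarrow> glob s \<and> s vempty = 1 \<and> s vbest = 0 \<and> (\<forall>i<t. bound_value i (s (- 100 - 2 * int i))) \<and>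
     s vflag = (if \<exists>i<t. \<bar>s (- 100 - 2 * int i)\<bar> > mass then 1 else 0)"

lemma wp_bounds_step:
  assumes t: "t < 2 * k" and inv: "bounds_inv t s" and st: "s vt = int t"
  shows "wp bounds_step (n * 13 + 10) 1 (\<lambda>s'. s' vt = int t \<and> bounds_inv (Suc t) (s'(vt := int (Suc t)))) s"
proof -
  have tn: "t div 2 < n" using t dims(4) by linarith
  have g: "glob s" using inv by (simp add: bounds_inv_def)
  define Q where "Q = (\<lambda>s'. s' vt = int t \<and> bounds_inv (Suc t) (s'(vt := int (Suc t))))"
  have "wp bounds_step (n * 13 + 10) 1 Q s"
    unfolding bounds_step_def
  proof (rule wp_Seq[of _ "n * 13 + 5" 1 _ 5 0])
    show "wp (build fill_bounds) (n * 13 + 5) 1 (wp (IfPos lp_solved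
       read_bound
       (put vx (Const 0)) ;;
     store_bound) 5 0 Q) s"
    proof (rule wp_build[OF fill_bounds_fills[where t = t] bounds_lp_modest g refl])
      fix s1 assume b1: "bounded s1" and g1: "glob s1" and kp: "\<And>x. kept x \<Longrightarrow> s1 x = s x"
        and ans: "answered (\<lambda>j. bound_sign t * (if j = t div 2 then 1 else 0)) (\<lambda>_. - B) (\<lambda>_. B) s1"
      note gd = globD[OF g1]
      have st1: "s1 vt = int t" using kp[of vt] st by (simp add: kept_def)
      have tail: "wp store_bound 3 0 Q (s1(vx := v))"
        if v: "bound_value t v" for v
      proof -
        have vB: "\<bar>v\<bar> < 2 ^ bits" using bound_value_le[OF v tn] B_ge by (intro box_less) linarith
        have sq: "v * v - mass * mass > 0 \<longleftrightarrow> \<bar>v\<bar> > mass"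
          using abs_le_square_iff[of v mass] mass_nonneg by (auto simp: power2_eq_square)
        have fin: "Q s2" if w: "w = (if \<bar>v\<bar> > mass then 1 else s1 vflag)"
          and e: "\<And>x. x \<noteq> vup \<Longrightarrow> s2 x = (s1(vx := v, - 100 - 2 * int t := v, vflag := w)) x" for w s2
        proof -
          define z where "z = s2(vt := int (Suc t))"
          have "glob z" unfolding z_def by (rule glob_frame[OF g1]) (auto simp: protected_def e)
          moreover have old: "z (- 100 - 2 * int i) = (if i = t then v else s (- 100 - 2 * int i))" if "i \<le> t" for i
            using kp[of "- 100 - 2 * int i"] that by (auto simp: kept_def z_def e)
          moreover have "z vempty = 1 \<and> z vbest = 0 \<and> s1 vflag = s vflag \<and> z vflag = w"
            using kp inv by (simp add: kept_def bounds_inv_def z_def e)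
          moreover have "(\<exists>i<Suc t. \<bar>z (- 100 - 2 * int i)\<bar> > mass) \<longleftrightarrow> \<bar>v\<bar> > mass \<or> (\<exists>i<t. \<bar>s (- 100 - 2 * int i)\<bar> > mass)"
            using old by (auto simp: less_Suc_eq)
          ultimately have "bounds_inv (Suc t) z"
            using inv v w unfolding bounds_inv_def by (auto simp: less_Suc_eq)
          then show ?thesis using st1 unfolding Q_def z_def by (simp add: e)
        qed
        show ?thesis
          apply (rule wp_step, simp, simp, simp, simp add: vB, simp add: st1)
          apply (rule wp_If, simp, simp)
           apply (rule wp_Assign, simp, simp, simp, simp add: one_less_bits)
           apply (rule fin[of 1]; use sq in \<open>simp add: gd\<close>)
          apply (simp only: skip_def)
          apply (rule wp_Assign, simp, simp, simp, simp)
          apply (rule fin[of "s1 vflag"]; use sq in \<open>simp add: gd\<close>)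
          done
      qed
      have cases: "(s1 (int answer) = 0 \<and> bound_value t (s1 (int answer + 1 + 2 * int (t div 2)))) \<or> (s1 (int answer) = 1 \<and> bound_value t 0)"
        by (rule answered_bound[OF ans tn])
      show "wp (IfPos lp_solved
         read_bound
         (put vx (Const 0)) ;;
       store_bound) 5 0 Q s1"
      proof (rule wp_If_Seq, simp, simp)
        assume "eval \<epsilon> s1 lp_solved > 0"
        then have v: "bound_value t (s1 (int answer + 1 + 2 * int (t div 2)))" using cases gd by auto
        have ad: "int answer + (1 + 2 * (int t div 2)) = int answer + 1 + 2 * int (t div 2)" by (simp add: zdiv_int)
        have "\<bar>s1 (int answer + 1 + 2 * int (t div 2))\<bar> < 2 ^ bits" using b1 by (simp add: bounded_def)
        then show "wp (read_bound ;;
           store_bound) (5 - 1) 0 Q s1"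
          using tail[OF v]
          by (rule_tac wp_step) (simp_all add: gd st1 ad del: of_nat_add)
      next
        assume "eval \<epsilon> s1 lp_solved \<le> 0"
        then have v: "bound_value t 0" using cases gd by auto
        show "wp (put vx (Const 0) ;;
           store_bound) (5 - 1) 0 Q s1"
          using tail[OF v] by (rule_tac wp_step) simp_all
      qed
    qed (use st in simp_all)
  qed simp_all
  then show ?thesis by (simp only: Q_def)
qed

lemma wp_bounds_phase:
  assumes g: "glob s" and v: "s vflag = 0" "s vempty = 1" "s vbest = 0"
    and Q: "\<And>s. bounds_inv (2 * k) s \<Longrightarrow> Q s" and N: "2 * k * (n * 13 + 10 + 2) + 2 \<le> N"
  shows "wp bounds_phase N (2 * k) Q s"
  unfolding bounds_phase_def
proof (rule wp_for[where Inv = bounds_inv and L = "2 * k" and N = "n * 13 + 10" and r = 1])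
  show "eval \<epsilon> s (Mul (Const 2) (cell vk)) = int (2 * k)" if "bounds_inv t s" for t s
    using that globD(3)[of s] by (simp add: bounds_inv_def)
  show "bounds_inv 0 (s(vt := 0))"
    using g v by (auto simp: bounds_inv_def protected_def intro!: glob_upd)
  have "int (2 * k) \<le> int lpc" using count by linarith
  then show "int (2 * k) < 2 ^ bits" using lpc_less by linarith
  show "wp bounds_step (n * 13 + 10) 1 (\<lambda>s'. s' vt = int t \<and> bounds_inv (Suc t) (s'(vt := int (Suc t)))) s"
    if "t < 2 * k" "bounds_inv t s" "s vt = int t" for t s using that by (rule wp_bounds_step)
qed (use Q N in simp_all)

text \<open>Rounds 2 i and 2 i + 1 leave the two ends of range i in the cells -100 - 4 i and -102 -
  4 i.\<close>

lemma bounds_inv_end: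
  assumes inv: "bounds_inv (2 * k) s"
  defines "l \<equiv> \<lambda>i. s (- 100 - 4 * int i)" and "u \<equiv> \<lambda>i. s (- 102 - 4 * int i)"
  shows "i < k \<Longrightarrow> \<bar>l i\<bar> \<le> B \<and> \<bar>u i\<bar> \<le> B \<and> l i \<le> u i"
    and "\<exists>y. feas y \<and> in_box B y \<Longrightarrow> exact_bounds l u"
    and "s vflag = (if small_bounds l u then 0 else 1)"
proof -
  have bv: "bound_value (2 * i) (l i)" "bound_value (2 * i + 1) (u i)" if "i < k" for i
  proof -
    have "bound_value j (s (- 100 - 2 * int j))" if "j < 2 * k" for j using inv that by (simp add: bounds_inv_def)
    from this[of "2 * i"] this[of "2 * i + 1"] that show "bound_value (2 * i) (l i)" "bound_value (2 * i + 1) (u i)"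
      by (simp_all add: l_def u_def)
  qed
  have sg: "bound_sign (2 * i) = 1" "bound_sign (2 * i + 1) = - 1" for i
    unfolding bound_sign_def by simp_all
  have dv: "(2 * i) div 2 = i" "(2 * i + 1) div 2 = i" for i :: nat by simp_all
  show "\<bar>l i\<bar> \<le> B \<and> \<bar>u i\<bar> \<le> B \<and> l i \<le> u i" if i: "i < k" for i
  proof -
    have "\<bar>l i\<bar> \<le> B" "\<bar>u i\<bar> \<le> B" using bound_value_le[OF bv(1)[OF i]] bound_value_le[OF bv(2)[OF i]] i dims(4) by simp_all
    moreover have "l i \<le> u i"
    proof (cases "\<exists>y. feas y \<and> in_box B y")
      case True
      then show ?thesis using bv[OF i] unfolding bound_value_def sg dv by auto
    next
      case False
      then show ?thesis using bv[OF i] unfolding bound_value_def by auto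
    qed
    ultimately show ?thesis by blast
  qed
  show "exact_bounds l u" if ex: "\<exists>y. feas y \<and> in_box B y"
    unfolding exact_bounds_def
  proof (intro allI impI)
    fix i assume i: "i < k"
    from bv[OF i] ex
    show "(\<exists>x. feas x \<and> x i = l i) \<and> (\<exists>x. feas x \<and> x i = u i) \<and> (\<forall>y. feas y \<and> in_box B y \<longrightarrow> l i \<le> y i \<and> y i \<le> u i)"
      unfolding bound_value_def sg dv by auto
  qed
  have "(\<exists>j<2 * k. \<bar>s (- 100 - 2 * int j)\<bar> > mass) \<longleftrightarrow> \<not> small_bounds l u"
  proof
    assume "\<exists>j<2 * k. \<bar>s (- 100 - 2 * int j)\<bar> > mass"
    then obtain j where j: "j < 2 * k" "\<bar>s (- 100 - 2 * int j)\<bar> > mass" by blast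
    have "j div 2 < k" using j by linarith
    moreover have "- 100 - 2 * int j = - 100 - 4 * int (j div 2) \<or> - 100 - 2 * int j = - 102 - 4 * int (j div 2)" by presburger
    ultimately show "\<not> small_bounds l u" using j(2) unfolding small_bounds_def l_def u_def by (metis not_less)
  next
    assume "\<not> small_bounds l u"
    then obtain i where i: "i < k" "\<bar>l i\<bar> > mass \<or> \<bar>u i\<bar> > mass" unfolding small_bounds_def by (metis not_less)
    from i(2) show "\<exists>j<2 * k. \<bar>s (- 100 - 2 * int j)\<bar> > mass"
    proof
      assume "\<bar>l i\<bar> > mass"
      then show ?thesis using i(1) by (intro exI[of _ "2 * i"]) (simp add: l_def)
    next
      assume "\<bar>u i\<bar> > mass"
      then show ?thesis using i(1) by (intro exI[of _ "2 * i + 1"]) (simp add: u_def)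
    qed
  qed
  then show "s vflag = (if small_bounds l u then 0 else 1)" using inv by (simp add: bounds_inv_def)
qed

end

lemma (in machine) wp_skip_Seq: "1 \<le> N \<Longrightarrow> wp d (N - 1) r Q (s(vup := 0)) \<Longrightarrow> wp (skip ;; d) N r Q s"
  unfolding skip_def by (rule wp_step) simp_all

section \<open>Pieces\<close>

definition quad_at :: expr where "quad_at = Cell (Add (Const 3) (cell vj))"
definition lin_at :: expr where "lin_at = Cell (Add (Const 3) (Add (cell vk) (cell vj)))"
definition point_at :: expr where "point_at = Cell (Add (cell vanswer) (Add (Const 1) (Mul (Const 2) (cell vj))))"
definition upper_at :: expr where "upper_at = Cell (Sub (Const (- 102)) (Mul (Const 4) (cell vj)))"

abbreviation "chord_end \<equiv> put vup (Add (cell vlo) (cell vx)) ;; put vslope (Sub lin_at (Mul quad_at (Add (cell vlo) (cell vup)))) ;; put vrest (Quot (cell vrest) (cell vgrid))"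
text \<open>The lowest digit of \<open>vrest\<close> in base \<open>vgrid\<close> selects the part
  of the range, and \<open>chord_end\<close> divides it off, so no power of the grid size is
  computed.\<close>

abbreviation "fill_chord \<equiv> put vvalue (Cell (Sub (Const (- 100)) (Mul (Const 4) (cell vj)))) ;;
      put vx (Quot (Sub upper_at (cell vvalue)) (cell vgrid)) ;;
      put vlo (Add (cell vvalue)
        (Mul (Sub (cell vrest) (Mul (cell vgrid) (Quot (cell vrest) (cell vgrid)))) (Add (cell vx) (Const 1)))) ;;
      IfPos (Sub (cell vlo) upper_at) (put vlo upper_at) skip ;;
      chord_end"
abbreviation "fill_line \<equiv> put vslope lin_at ;; put vlo (Sub (Const 0) (cell vB)) ;; put vup (cell vB)"

definition fill_piece :: cmd where
  "fill_piece = IfPos (Sub (cell vk) (cell vj))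
     fill_chord
     fill_line"

abbreviation "copy_best \<equiv> for_loop vj (cell vn) (Assign (Sub (Const (- 101)) (Mul (Const 2) (cell vj))) point_at)"
abbreviation "record_best \<equiv> IfPos (Sub (cell vbest) (cell vvalue)) (copy_best ;; put vbest (cell vvalue) ;; put vempty (Const 0)) skip"
text \<open>For the first point found, the best value is set just above its own, so that one strict
  comparison covers both situations.\<close>

abbreviation "compare_best \<equiv> IfPos (cell vempty) (put vbest (Add (cell vvalue) (Const 1))) skip ;; record_best"
abbreviation "add_squares \<equiv> for_loop vj (cell vk) (put vvalue (Sub (cell vvalue) (Mul quad_at (Mul point_at point_at))))"

text \<open>Points are compared by their true objective values and not by chords, whose omitted
  constants differ between pieces.\<close>

definition accept :: cmd where
  "accept =
     put vvalue (Const 0) ;;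
     for_loop vj (cell vn) (put vvalue (Add (cell vvalue) (Mul lin_at point_at))) ;;
     add_squares ;;
     compare_best"

definition piece_step :: cmd where
  "piece_step = put vrest (cell vt) ;; build fill_piece ;; IfPos lp_solved accept skip"

definition piece_phase :: cmd where
  "piece_phase = for_loop vt (cell vpieces) piece_step"

context iqp_run
begin

lemma quad_le: "i < k \<Longrightarrow> \<bar>quad i\<bar> \<le> mass"
  by (rule abs_code) (simp add: code_eq)

lemma lin_le: "j < n \<Longrightarrow> \<bar>lin j\<bar> \<le> mass"
  by (rule abs_code) (simp add: code_eq)

definition best_at :: "memory \<Rightarrow> nat \<Rightarrow> int" where
  "best_at s j = s (- 101 - 2 * int j)"

context
  fixes l u :: "nat \<Rightarrow> int"
  assumes lu: "\<forall>i<k. \<bar>l i\<bar> \<le> B \<and> \<bar>u i\<bar> \<le> B \<and> l i \<le> u i"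
begin

definition lo_at :: "nat \<Rightarrow> nat \<Rightarrow> int" where
  "lo_at t j = (if j < k then piece_lo l u (int grid) (int t) j else - B)"

definition up_at :: "nat \<Rightarrow> nat \<Rightarrow> int" where
  "up_at t j = (if j < k then piece_up l u (int grid) (int t) j else B)"

text \<open>Linear variables consume no digit, hence the minimum with k.\<close>

definition rest_at :: "nat \<Rightarrow> nat \<Rightarrow> int" where
  "rest_at t j = int t div int grid ^ min j k"

lemma in_bounds_piece: "in_piece l u (int grid) (int t) y \<Longrightarrow> in_box B y \<Longrightarrow> in_bounds (lo_at t) (up_at t) y"
  by (simp add: in_piece_def in_box_def in_bounds_def lo_at_def up_at_def abs_le_iff minus_le_iff)

lemma in_bounds_in_piece: "in_bounds (lo_at t) (up_at t) y \<Longrightarrow> in_piece l u (int grid) (int t) y"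
  unfolding in_piece_def
proof (intro allI impI)
  fix i assume b: "in_bounds (lo_at t) (up_at t) y" and i: "i < k"
  then have "lo_at t i \<le> y i \<and> y i \<le> up_at t i" using dims(4) by (simp add: in_bounds_def)
  then show "piece_lo l u (int grid) (int t) i \<le> y i \<and> y i \<le> piece_up l u (int grid) (int t) i"
    using i by (simp add: lo_at_def up_at_def)
qed

lemma step_bounds: "i < k \<Longrightarrow> 0 \<le> (u i - l i) div int grid \<and> (u i - l i) div int grid \<le> 2 * B"
proof -
  assume i: "i < k"
  have "0 \<le> (u i - l i) div int grid" using lu[rule_format, OF i] grid_ge by (simp add: pos_imp_zdiv_nonneg_iff)
  moreover have "\<bar>(u i - l i) div int grid\<bar> \<le> \<bar>u i - l i\<bar>" by (rule abs_div_le)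
  ultimately show ?thesis using lu[rule_format, OF i] by linarith
qed

lemma lo_at_bounds: "i < k \<Longrightarrow> - B \<le> lo_at t i \<and> lo_at t i \<le> B"
proof -
  assume i: "i < k"
  have "0 \<le> (int t div int grid ^ i) mod int grid" using grid_ge by simp
  then have "0 \<le> ((int t div int grid ^ i) mod int grid) * ((u i - l i) div int grid + 1)"
    using step_bounds[OF i] by (intro mult_nonneg_nonneg) auto
  then show ?thesis using lu[rule_format, OF i] i unfolding lo_at_def piece_lo_def min_def by auto
qed

lemma up_at_eq: "i < k \<Longrightarrow> up_at t i = lo_at t i + (u i - l i) div int grid"
  by (simp add: up_at_def lo_at_def piece_up_def)

lemma piece_lp_modest: "modest_lp (chord_slope l u (int grid) (int t)) (lo_at t) (up_at t)"
  unfolding modest_lp_def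
proof (intro allI impI)
  fix j assume j: "j < n"
  show "\<bar>chord_slope l u (int grid) (int t) j\<bar> \<le> mass + mass * (4 * B) \<and> \<bar>lo_at t j\<bar> \<le> 3 * B \<and>
      \<bar>up_at t j\<bar> \<le> 3 * B \<and> up_at t j - lo_at t j \<le> 2 * B"
  proof (cases "j < k")
    case True
    have b: "- B \<le> lo_at t j" "lo_at t j \<le> B" "0 \<le> (u j - l j) div int grid" "(u j - l j) div int grid \<le> 2 * B"
      using lo_at_bounds[OF True] step_bounds[OF True] by auto
    note up = up_at_eq[OF True, of t]
    have "\<bar>lo_at t j + up_at t j\<bar> \<le> 4 * B" using b up by linarith
    then have "\<bar>quad j * (lo_at t j + up_at t j)\<bar> \<le> mass * (4 * B)"
      unfolding abs_mult using quad_le[OF True] mass_nonneg by (intro mult_mono) auto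
    moreover have "chord_slope l u (int grid) (int t) j = lin j - quad j * (lo_at t j + up_at t j)"
      using True by (simp add: chord_slope_def lo_at_def up_at_def)
    ultimately have "\<bar>chord_slope l u (int grid) (int t) j\<bar> \<le> mass + mass * (4 * B)" using lin_le[OF j] by linarith
    then show ?thesis using b up B_ge by linarith
  next
    case False
    have "0 \<le> mass * (4 * B)" using mass_nonneg B_ge by simp
    then have "\<bar>lin j\<bar> \<le> mass + mass * (4 * B)" using lin_le[OF j] by linarith
    then show ?thesis using B_ge False by (simp add: chord_slope_def lo_at_def up_at_def)
  qed
qed

text \<open>Before the cap is applied, the left end of a piece may grow with the grid size; the
  summand \<open>lpc\<close> in \<open>bits\<close> makes room for it.\<close>

lemma uncapped_less:
  assumes i: "i < k"
  shows "\<bar>l i + ((r mod int grid) * ((u i - l i) div int grid + 1))\<bar> < 2 ^ bits"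
proof -
  have r: "0 \<le> r mod int grid" "r mod int grid \<le> int lpc" using grid_ge grid_le pos_mod_bound[of "int grid" r] by (simp_all, linarith)
  have d: "0 \<le> (u i - l i) div int grid + 1" "(u i - l i) div int grid + 1 \<le> 2 * B + 1" using step_bounds[OF i] by auto
  have "(r mod int grid) * ((u i - l i) div int grid + 1) \<le> int lpc * (2 * B + 1)"
    using r d by (intro mult_mono) auto
  also have "\<dots> \<le> 2 ^ lpc * 2 ^ lpbits"
  proof (rule mult_mono)
    show "int lpc \<le> 2 ^ lpc" using less_exp[of lpc] by (metis less_imp_le of_nat_le_iff of_nat_numeral of_nat_power)
    show "2 * B + 1 \<le> 2 ^ lpbits" using three_B_less B_ge by linarith
  qed (use B_ge in auto)
  also have "\<dots> = 2 ^ (lpbits + lpc)" by (simp add: power_add)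
  finally have "(r mod int grid) * ((u i - l i) div int grid + 1) \<le> 2 ^ (lpbits + lpc)" .
  moreover have "0 \<le> (r mod int grid) * ((u i - l i) div int grid + 1)" using r d by simp
  moreover have "\<bar>l i\<bar> < 2 ^ lpbits" using lu[rule_format, OF i] three_B_less B_ge by linarith
  moreover have "(2::int) ^ lpbits \<le> 2 ^ (lpbits + lpc)" by simp
  moreover have "(2::int) ^ (lpbits + lpc) + 2 ^ (lpbits + lpc) \<le> 2 ^ bits"
    using power_increasing[of "lpbits + lpc + 1" bits "2::int"] by (simp add: bits_def)
  ultimately show ?thesis by linarith
qed

lemma fill_piece_fills:
  assumes t: "t < pieces" and mem: "\<And>i. i < k \<Longrightarrow> s0 (- 100 - 4 * int i) = l i \<and> s0 (- 102 - 4 * int i) = u i"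
  shows "fills fill_piece 9 (rest_at t) (chord_slope l u (int grid) (int t)) (lo_at t) (up_at t) s0"
  unfolding fills_def
proof (intro allI impI, elim conjE)
  fix j s assume j: "j < n" and b: "bounded s" and g: "glob s" and v: "s vj = int j" "s vrest = rest_at t j" "\<forall>x. kept x \<longrightarrow> s x = s0 x"
  note gd = globD[OF g]
  have hold: "holds_at s 0 (iqp_code I)" using g by (simp add: glob_def)
  have L: "s (3 + (int k + int j)) = lin j" using code_lin[OF hold j] by (simp add: add.assoc)
  have mdl: "\<bar>lo_at t j\<bar> < 2 ^ bits" "\<bar>up_at t j\<bar> < 2 ^ bits" using piece_lp_modest[of t] j by (auto simp: modest_lp_def intro: box_less)
  have cs: "\<bar>chord_slope l u (int grid) (int t) j\<bar> < 2 ^ bits"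
  proof -
    have "\<bar>chord_slope l u (int grid) (int t) j\<bar> \<le> mass + mass * (4 * B)" using piece_lp_modest[of t] j by (simp add: modest_lp_def)
    moreover have "mass + mass * (4 * B) \<le> mass * (3 * B) + mass * (9 * B\<^sup>2)"
    proof -
      have "B \<le> B\<^sup>2" using B_ge by (simp add: power2_eq_square)
      then have "mass * (9 * B) \<le> mass * (9 * B\<^sup>2)" using mass_nonneg by (intro mult_left_mono) auto
      moreover have "mass * 1 \<le> mass * B" using B_ge mass_nonneg by (intro mult_left_mono) auto
      ultimately show ?thesis using B_ge mass_nonneg by (simp add: algebra_simps)
    qed
    ultimately show ?thesis by (intro value_less') linarith
  qed
  define Q where "Q = (\<lambda>s'. s' vslope = chord_slope l u (int grid) (int t) j \<and> s' vlo = lo_at t j \<and> s' vup = up_at t j \<and>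
      s' vrest = rest_at t (Suc j) \<and> (\<forall>x. \<not> scratch x \<longrightarrow> s' x = s x))"
  have "wp fill_piece 9 0 Q s"
    unfolding fill_piece_def
  proof (rule wp_If, simp, simp)
    assume "eval \<epsilon> s (Sub (cell vk) (cell vj)) > 0"
    then have jk: "j < k" by (simp add: gd v)
    have lm: "s (- 100 - 4 * int j) = l j" "s (- 102 - 4 * int j) = u j"
      using v(3) mem[OF jk] by (simp_all add: kept_def)
    have qm: "s (3 + int j) = quad j" by (rule code_quad[OF hold jk])
    have mj: "min j k = j" "min (Suc j) k = Suc j" using jk by simp_all
    define r where "r = rest_at t j"
    have rm: "r - int grid * (r div int grid) = r mod int grid" by (simp add: minus_mult_div_eq_mod)
    define d where "d = (u j - l j) div int grid"
    define w where "w = l j + (r mod int grid) * (d + 1)"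
    have lo: "lo_at t j = (if w - u j > 0 then u j else w)"
      using jk by (simp add: lo_at_def piece_lo_def w_def d_def r_def rest_at_def mj min_def)
    have up: "up_at t j = lo_at t j + d" using up_at_eq[OF jk] by (simp add: d_def)
    have slope: "lin j - quad j * (lo_at t j + up_at t j) = chord_slope l u (int grid) (int t) j"
      using jk by (simp add: chord_slope_def lo_at_def up_at_def)
    have next_r: "r div int grid = rest_at t (Suc j)"
      unfolding r_def rest_at_def mj power_Suc2 using grid_ge by (simp add: zdiv_zmult2_eq)
    have lb: "\<bar>l j\<bar> < 2 ^ bits" "\<bar>u j\<bar> < 2 ^ bits" using lu[rule_format, OF jk] B_ge by (auto intro!: box_less)
    have db: "\<bar>d\<bar> < 2 ^ bits" using step_bounds[OF jk] B_ge by (intro box_less) (auto simp: d_def)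
    have wb: "\<bar>w\<bar> < 2 ^ bits" unfolding w_def d_def by (rule uncapped_less[OF jk])
    have rb: "\<bar>r div int grid\<bar> < 2 ^ bits"
    proof -
      have "\<bar>r\<bar> < 2 ^ bits" using b v(2) unfolding bounded_def r_def by metis
      then show ?thesis using abs_div_le[of r "int grid"] by linarith
    qed
    note sv = v(1) v(2)[folded r_def]
    have tail: "wp chord_end 3 0 Q s1"
      if s1: "s1 vlo = lo_at t j" "s1 vx = d" "s1 vrest = r" "\<And>x. \<not> scratch x \<Longrightarrow> s1 x = s x" for s1
    proof -
      have e: "s1 vk = int k" "s1 vj = int j" "s1 vgrid = int grid" "s1 (3 + (int k + int j)) = lin j" "s1 (3 + int j) = quad j"
        using s1(4) by (simp_all add: scratch_def gd v L qm)
      show ?thesis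
        apply (rule wp_step, simp, simp, simp, simp add: s1 up[symmetric] mdl, simp add: s1 up[symmetric])
        apply (rule wp_step, simp, simp add: lin_at_def quad_at_def, simp,
          (simp add: lin_at_def quad_at_def e s1 slope cs; fail), simp add: lin_at_def quad_at_def e s1 slope)
        apply (rule wp_Assign, simp, simp, simp, simp add: s1 e rb)
        apply (simp add: Q_def s1 e next_r scratch_def)
        done
    qed
    have frame: "(s(vvalue := a, vx := a', vlo := c, vup := c')) x = s x" if "\<not> scratch x" for x a a' c c'
      using that by (auto simp: scratch_def)
    show "wp fill_chord (9 - 1) 0 Q s"
      apply (rule wp_step, simp, simp, simp, simp add: sv lm lb, simp add: sv lm)
      apply (rule wp_step, simp, simp add: upper_at_def, simp,
        simp add: upper_at_def sv lm gd d_def[symmetric] db, simp add: upper_at_def sv lm gd d_def[symmetric])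
      apply (rule wp_step, simp, simp, simp,
        simp add: sv gd rm w_def[symmetric] wb, simp add: sv gd rm w_def[symmetric])
      apply (rule wp_If_Seq, simp, simp)
       apply (rule wp_step, simp, simp, simp, simp add: sv lm lb, simp add: sv lm)
       apply (rule tail; auto simp: sv lo lm scratch_def)
      apply (simp only: skip_def)
      apply (rule wp_step, simp, simp, simp, simp, simp)
      apply (rule tail; auto simp: sv lo lm scratch_def)
      done
  next
    assume "eval \<epsilon> s (Sub (cell vk) (cell vj)) \<le> 0"
    then have jk: "\<not> j < k" by (simp add: gd v)
    have Bb: "\<bar>B\<bar> < 2 ^ bits" using box_less[of B] B_ge by simp
    have eqs: "chord_slope l u (int grid) (int t) j = lin j" "lo_at t j = - B" "up_at t j = B" "rest_at t (Suc j) = rest_at t j"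
      using jk by (simp_all add: chord_slope_def lo_at_def up_at_def rest_at_def min_def)
    show "wp fill_line (9 - 1) 0 Q s"
      apply (rule wp_step, simp, simp add: lin_at_def, simp,
        simp add: lin_at_def gd v L cs[unfolded eqs], simp add: lin_at_def gd v L)
      apply (rule wp_step, simp, simp, simp, simp add: gd Bb, simp add: gd)
      apply (rule wp_Assign, simp, simp, simp, simp add: gd Bb)
      apply (simp add: Q_def eqs gd v scratch_def)
      done
  qed
  then show "wp fill_piece 9 0 (\<lambda>s'. s' vslope = chord_slope l u (int grid) (int t) j \<and> s' vlo = lo_at t j \<and> s' vup = up_at t j \<and>
      s' vrest = rest_at t (Suc j) \<and> (\<forall>x. \<not> scratch x \<longrightarrow> s' x = s x)) s" by (simp only: Q_def)
qed

text \<open>e = 1 means that no point has been found. The last clause does two things: a feasible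
  box point in a processed piece refutes e = 1, and v is nearly optimal on those pieces.\<close>

definition progress :: "nat \<Rightarrow> int \<Rightarrow> int \<Rightarrow> (nat \<Rightarrow> int) \<Rightarrow> bool" where
  "progress t e v x \<longleftrightarrow> (e = 1 \<and> v = 0 \<or> e = 0 \<and> feas x \<and> v = f x \<and> in_box (3 * B) x) \<and>
     (\<forall>i<t. \<forall>y. feas y \<and> in_piece l u (int grid) (int i) y \<and> in_box B y \<longrightarrow>
       e = 0 \<and> v \<le> f y + chord_error l u (int grid))"

definition pieces_inv :: "int \<Rightarrow> nat \<Rightarrow> memory \<Rightarrow> bool" where
  "pieces_inv fl t s \<longleftrightarrow> glob s \<and> s vflag = fl \<and> (\<forall>i<k. s (- 100 - 4 * int i) = l i \<and> s (- 102 - 4 * int i) = u i) \<and>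
     progress t (s vempty) (s vbest) (best_at s)"

lemma progress_cong: "(\<And>j. j < n \<Longrightarrow> x j = y j) \<Longrightarrow> progress t e v x = progress t e v y"
  unfolding progress_def using feas_cong[of x y] f_cong[of x y] by (simp add: in_box_def)

text \<open>The parity condition separates the two tables: even cells hold the ranges and must stay,
  odd cells hold the best point. \<open>new\<close> tells whether x replaces it.\<close>

lemma wp_accept:
  assumes g: "glob s" and x: "\<And>j. j < n \<Longrightarrow> s (int answer + 1 + 2 * int j) = x j" and box: "in_box (3 * B) x"
    and e: "s vempty = 1 \<and> s vbest = 0 \<or> s vempty = 0"
    and Q: "\<And>s' new. glob s' \<Longrightarrow> (\<And>z. kept z \<Longrightarrow> z \<noteq> vempty \<Longrightarrow> z \<noteq> vbest \<Longrightarrow> even z \<or> z > - 100 \<Longrightarrow> s' z = s z) \<Longrightarrow>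
      new = (s vempty = 1 \<or> s vbest > f x) \<Longrightarrow>
      s' vempty = 0 \<Longrightarrow> s' vbest = (if new then f x else s vbest) \<Longrightarrow>
      (\<And>j. j < n \<Longrightarrow> best_at s' j = (if new then x j else best_at s j)) \<Longrightarrow> Q s'"
  shows "wp accept (9 * n + 13) 0 Q s"
proof -
  \<comment> \<open>Partial sums of the linear and then of the quadratic part, because every
    intermediate value of the accumulator has to be bounded.\<close>
  define Ql where "Ql i = (\<Sum>j<i. lin j * x j)" for i
  define Qq where "Qq i = Ql n + (\<Sum>j<i. - (quad j) * (x j)\<^sup>2)" for i
  have xb: "\<bar>x j\<bar> \<le> 3 * B" if "j < n" for j using box that by (simp add: in_box_def)
  have lin_sum: "\<bar>Ql i\<bar> \<le> mass * (3 * B)" if "i \<le> n" for i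
  proof -
    have "\<bar>Ql i\<bar> \<le> (\<Sum>j<i. \<bar>lin j\<bar> * (3 * B))" unfolding Ql_def
      using xb that by (intro order_trans[OF sum_abs] sum_mono) (simp add: abs_mult mult_left_mono)
    also have "\<dots> \<le> (\<Sum>j<n. \<bar>lin j\<bar> * (3 * B))" using that B_ge by (intro sum_mono2) auto
    also have "\<dots> \<le> mass * (3 * B)" unfolding sum_distrib_right[symmetric] using parts B_ge by (intro mult_right_mono) auto
    finally show ?thesis .
  qed
  have quad_sum: "\<bar>Qq i\<bar> \<le> mass * (3 * B) + mass * (9 * B\<^sup>2)" if "i \<le> k" for i
  proof -
    have "(x j)\<^sup>2 \<le> 9 * B\<^sup>2" if "j < k" for j
    proof -
      have "(x j)\<^sup>2 \<le> (3 * B)\<^sup>2" using xb[of j] that dims(4) B_ge by (intro abs_le_square_iff[THEN iffD1]) auto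
      then show ?thesis by (simp add: power_mult_distrib)
    qed
    then have "\<bar>\<Sum>j<i. - (quad j) * (x j)\<^sup>2\<bar> \<le> (\<Sum>j<i. \<bar>quad j\<bar> * (9 * B\<^sup>2))"
      using that by (intro order_trans[OF sum_abs] sum_mono) (simp add: abs_mult mult_left_mono)
    also have "\<dots> \<le> (\<Sum>j<k. \<bar>quad j\<bar> * (9 * B\<^sup>2))" using that by (intro sum_mono2) auto
    also have "\<dots> \<le> mass * (9 * B\<^sup>2)" unfolding sum_distrib_right[symmetric] using parts by (intro mult_right_mono) auto
    finally show ?thesis using lin_sum[of n] unfolding Qq_def by linarith
  qed
  have fx: "Qq k = f x" by (simp add: Qq_def Ql_def f_def)
  have less: "\<bar>Ql i\<bar> < 2 ^ bits" if "i \<le> n" for i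
  proof (rule value_less')
    have "0 \<le> mass * (9 * B\<^sup>2)" using mass_nonneg by simp
    then show "\<bar>Ql i\<bar> \<le> mass * (3 * B) + mass * (9 * B\<^sup>2) + 1" using lin_sum[OF that] by linarith
  qed
  have less2: "\<bar>Qq i\<bar> < 2 ^ bits" "\<bar>Qq i + 1\<bar> < 2 ^ bits" if "i \<le> k" for i
    by (rule value_less', use quad_sum[OF that] in linarith)+
  have nk: "int n < 2 ^ bits" "int k < 2 ^ bits" using address_less[of "int n"] address_less[of "int k"] dims(4) by (simp_all add: int_answer int_start)
  define J where "J s1 \<longleftrightarrow> (\<forall>z. z \<noteq> vvalue \<longrightarrow> z \<noteq> vj \<longrightarrow> s1 z = s z)" for s1
  have Jg: "glob s1" if "J s1" for s1
    by (rule glob_frame[OF g]) (use that in \<open>auto simp: J_def protected_def\<close>)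
  have Jx: "s1 (int answer + (1 + 2 * int j)) = x j" if "J s1" "j < n" for s1 j
    using x[OF that(2)] that(1) by (simp add: J_def add.assoc)
  have Jl: "s1 (3 + (int k + int j)) = lin j" if "J s1" "j < n" for s1 j
    using code_lin[of s1 j] Jg[OF that(1)] that(2) by (simp add: glob_def add.assoc)
  have Jq: "s1 (3 + int j) = quad j" if "J s1" "j < k" for s1 j
    using code_quad[of s1 j] Jg[OF that(1)] that(2) by (simp add: glob_def)
  have last: "wp compare_best (3 * n + 7) 0 Q s1" if J1: "J s1" and v1: "s1 vvalue = f x" for s1
  proof -
    note gd = globD[OF Jg[OF J1]]
    have e1: "s1 vempty = s vempty" "s1 vbest = s vbest" using J1 by (simp_all add: J_def)
    define b0 where "b0 = (if s vempty = 1 then f x + 1 else s vbest)"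
    define new where "new = (s vempty = 1 \<or> s vbest > f x)"
    have rest: "wp record_best (3 * n + 5) 0 Q s2" if s2: "s2 vbest = b0" "\<And>z. z \<noteq> vbest \<Longrightarrow> z \<noteq> vup \<Longrightarrow> s2 z = s1 z" for s2
    proof (rule wp_If, simp, simp)
      have g2: "glob s2" by (rule glob_frame[OF Jg[OF J1]]) (auto simp: protected_def s2(2))
      have s2s: "s2 z = s z" if "z \<noteq> vbest" "z \<noteq> vup" "z \<noteq> vvalue" "z \<noteq> vj" for z
        using s2(2)[OF that(1,2)] J1 that(3,4) by (simp add: J_def)
      { assume "eval \<epsilon> s2 (Sub (cell vbest) (cell vvalue)) > 0"
        then have new: "new = True" using e s2 v1 by (auto simp: b0_def new_def split: if_splits)
        define Inv where "Inv i s3 \<longleftrightarrow> glob s3 \<and> s3 vvalue = f x \<and> (\<forall>j<n. s3 (int answer + (1 + 2 * int j)) = x j) \<and>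
            (\<forall>j<i. best_at s3 j = x j) \<and> (\<forall>z. kept z \<and> (even z \<or> z > - 100) \<longrightarrow> s3 z = s2 z)" for i s3
        show "wp (copy_best ;;
          put vbest (cell vvalue) ;; put vempty (Const 0)) (3 * n + 5 - 1) 0 Q s2"
        proof (rule wp_Seq[of _ "3 * n + 2" 0 _ 2 0])
          show "wp copy_best (3 * n + 2) 0
              (wp (put vbest (cell vvalue) ;; put vempty (Const 0)) 2 0 Q) s2"
          proof (rule wp_for[where Inv = Inv and L = n and N = 1 and r = 0])
            show "eval \<epsilon> s3 (cell vn) = int n" if "Inv i s3" for i s3 using that globD(1)[of s3] by (simp add: Inv_def)
            show "Inv 0 (s2(vj := 0))"
              using g2 s2(2) v1 Jx[OF J1] by (auto simp: Inv_def protected_def kept_def intro!: glob_upd)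
          next
            fix i s3 assume i: "i < n" and I: "Inv i s3" and vi: "s3 vj = int i"
            have p: "s3 (int answer + (1 + 2 * int i)) = x i" "glob s3" using I i by (simp_all add: Inv_def)
            have "\<bar>x i\<bar> < 2 ^ bits" using box_less xb[OF i] by blast
            moreover have "Inv (Suc i) ((s3(- 101 - 2 * int i := x i))(vj := int (Suc i)))"
              using I vi unfolding Inv_def best_at_def
              by (auto simp: protected_def kept_def less_Suc_eq intro!: glob_upd)
            ultimately show "wp (Assign (Sub (Const (- 101)) (Mul (Const 2) (cell vj))) point_at) 1 0
              (\<lambda>s'. s' vj = int i \<and> Inv (Suc i) (s'(vj := int (Suc i)))) s3"
              by (intro wp_Assign) (simp_all add: point_at_def vi globD[OF p(2)] p(1))
          next
            fix s3 assume I: "Inv n s3"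
            have fb: "\<bar>f x\<bar> < 2 ^ bits" using less2(1)[of k] fx by simp
            have v: "s3 vvalue = f x" using I by (simp add: Inv_def)
            have q: "Q (s3(vbest := f x, vempty := 0))"
            proof (rule Q[where new = new])
              show "glob (s3(vbest := f x, vempty := 0))" using I by (auto simp: Inv_def protected_def intro!: glob_upd)
              show "(s3(vbest := f x, vempty := 0)) z = s z" if "kept z" "z \<noteq> vempty" "z \<noteq> vbest" "even z \<or> z > - 100" for z
                using I that s2s[of z] by (auto simp: Inv_def kept_def)
              show "best_at (s3(vbest := f x, vempty := 0)) j = (if new then x j else best_at s j)" if "j < n" for j
                using I new that by (simp add: Inv_def best_at_def)
            qed (simp_all add: new, simp add: new_def[symmetric] new)
            show "wp (put vbest (cell vvalue) ;; put vempty (Const 0)) 2 0 Q s3"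
              apply (rule wp_step, simp, simp, simp, simp add: v fb, simp add: v)
              apply (rule wp_Assign, simp, simp, simp, simp)
              using q apply simp
              done
          qed (use nk in simp_all)
        qed simp_all }
      { assume "eval \<epsilon> s2 (Sub (cell vbest) (cell vvalue)) \<le> 0"
        then have new: "new = False" "s vempty = 0" using e s2 v1 by (auto simp: b0_def new_def split: if_splits)
        show "wp skip (3 * n + 5 - 1) 0 Q s2"
          unfolding skip_def
        proof (rule wp_Assign)
          have "Q (s2(vup := 0))"
          proof (rule Q[where new = new])
            show "glob (s2(vup := 0))" using g2 by (auto simp: protected_def intro!: glob_upd)
            show "(s2(vup := 0)) z = s z" if "kept z" "z \<noteq> vempty" "z \<noteq> vbest" "even z \<or> z > - 100" for z
              using that s2s[of z] by (auto simp: kept_def)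
            show "best_at (s2(vup := 0)) j = (if new then x j else best_at s j)" if "j < n" for j
              using s2s new by (simp add: best_at_def)
          qed (use new s2s s2 in \<open>simp_all add: new_def b0_def\<close>)
          then show "Q (s2(eval \<epsilon> s2 (Const vup) := eval \<epsilon> s2 (Const 0)))" by simp
        qed simp_all }
    qed
    have fb: "\<bar>f x + 1\<bar> < 2 ^ bits" using less2(2)[of k] fx by simp
    have r1: "wp record_best (3 * n + 5) 0 Q (s1(vbest := f x + 1))" if "s vempty = 1"
      by (rule rest) (use that in \<open>simp_all add: b0_def\<close>)
    have r0: "wp record_best (3 * n + 5) 0 Q (s1(vup := 0))" if "s vempty \<noteq> 1"
      by (rule rest) (use that e1 in \<open>simp_all add: b0_def\<close>)
    show ?thesis
      apply (rule wp_If_Seq, simp, simp)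
       apply (rule wp_step, simp, simp, simp, simp add: v1 fb)
       apply (simp only: eval.simps v1)
      subgoal using r1 e e1 by (auto simp: numeral_eq_Suc)
      apply (rule wp_skip_Seq, simp)
      subgoal using r0 e e1 by (auto simp: numeral_eq_Suc)
      done
  qed
  define I2 where "I2 i s1 \<longleftrightarrow> J s1 \<and> s1 vvalue = Qq i" for i s1
  have second: "wp (add_squares ;;
     compare_best) (6 * n + 9) 0 Q s1" if "J s1" "s1 vvalue = Ql n" for s1
  proof (rule wp_Seq[of _ "3 * n + 2" 0 _ "3 * n + 7" 0], rule wp_for[where Inv = I2 and L = k and N = 1 and r = 0])
    show "eval \<epsilon> s2 (cell vk) = int k" if "I2 i s2" for i s2 using that globD(3)[OF Jg] by (simp add: I2_def)
    show "I2 0 (s1(vj := 0))" using that by (simp add: I2_def J_def Qq_def)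
    fix i s2 assume i: "i < k" and I: "I2 i s2" and vi: "s2 vj = int i"
    have J2: "J s2" using I by (simp add: I2_def)
    have step: "Qq i - quad i * (x i * x i) = Qq (Suc i)" by (simp add: Qq_def power2_eq_square)
    have iN: "i < n" using i dims(4) by simp
    have "I2 (Suc i) ((s2(vvalue := Qq (Suc i)))(vj := int (Suc i)))" using I by (simp add: I2_def J_def)
    then show "wp (put vvalue (Sub (cell vvalue) (Mul quad_at (Mul point_at point_at)))) 1 0
        (\<lambda>s'. s' vj = int i \<and> I2 (Suc i) (s'(vj := int (Suc i)))) s2"
      using I less2(1)[of "Suc i"] i
      by (intro wp_Assign)
         (simp_all add: quad_at_def point_at_def vi globD[OF Jg[OF J2]] Jx[OF J2 iN] Jq[OF J2 i] I2_def step)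
  next
    fix s2 assume "I2 k s2"
    then show "wp compare_best (3 * n + 7) 0 Q s2" by (intro last) (simp_all add: I2_def fx)
  qed (use nk dims(4) in simp_all)
  define I1 where "I1 i s1 \<longleftrightarrow> J s1 \<and> s1 vvalue = Ql i" for i s1
  have first: "wp (for_loop vj (cell vn) (put vvalue (Add (cell vvalue) (Mul lin_at point_at)))) (3 * n + 2) 0 
    (wp (add_squares ;;
     compare_best) (6 * n + 9) 0 Q) (s(vvalue := 0))"
  proof (rule wp_for[where Inv = I1 and L = n and N = 1 and r = 0])
    show "eval \<epsilon> s2 (cell vn) = int n" if "I1 i s2" for i s2 using that globD(1)[OF Jg] by (simp add: I1_def)
    show "I1 0 ((s(vvalue := 0))(vj := 0))" by (simp add: I1_def J_def Ql_def)
    fix i s2 assume i: "i < n" and I: "I1 i s2" and vi: "s2 vj = int i"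
    have J2: "J s2" using I by (simp add: I1_def)
    have step: "Ql i + lin i * x i = Ql (Suc i)" by (simp add: Ql_def)
    have "I1 (Suc i) ((s2(vvalue := Ql (Suc i)))(vj := int (Suc i)))" using I by (simp add: I1_def J_def)
    then show "wp (put vvalue (Add (cell vvalue) (Mul lin_at point_at))) 1 0
        (\<lambda>s'. s' vj = int i \<and> I1 (Suc i) (s'(vj := int (Suc i)))) s2"
      using I less[of "Suc i"] i
      by (intro wp_Assign)
         (simp_all add: lin_at_def point_at_def vi globD[OF Jg[OF J2]] Jx[OF J2 i] Jl[OF J2 i] I1_def step)
  qed (use nk second in \<open>simp_all add: I1_def\<close>)
  show ?thesis
    unfolding accept_def
    apply (rule wp_step, simp, simp, simp, simp)
    apply (rule wp_Seq[of _ "3 * n + 2" 0 _ "6 * n + 9" 0])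
    using first apply simp_all
    done
qed

text \<open>The LP minimizes the chords over bounds that contain all box points of piece t, so
  \<open>piece_compare\<close> bounds its solution; earlier pieces stay covered because v never
  increases.\<close>

lemma progress_step:
  assumes p: "progress t e v x0" and new: "new = (e = 1 \<or> v > f x)" and x: "feas x" "in_bounds (lo_at t) (up_at t) x"
    and opt: "\<forall>y. feas y \<and> in_bounds (lo_at t) (up_at t) y \<longrightarrow>
      (\<Sum>j<n. chord_slope l u (int grid) (int t) j * x j) \<le> (\<Sum>j<n. chord_slope l u (int grid) (int t) j * y j)"
    and box: "in_box (3 * B) x"
  shows "progress (Suc t) 0 (if new then f x else v) (\<lambda>j. if new then x j else x0 j)"
proof -
  have le: "(if new then f x else v) \<le> f x" using new by auto
  have le': "e = 0 \<Longrightarrow> (if new then f x else v) \<le> v" using new by auto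
  have "(if new then f x else v) \<le> f y + chord_error l u (int grid)"
    if y: "feas y" "in_piece l u (int grid) (int i) y" "in_box B y" and i: "i < Suc t" for y i
  proof (cases "i = t")
    case True
    have "f x \<le> f y + chord_error l u (int grid)"
      by (rule piece_compare[OF in_bounds_in_piece[OF x(2)]]) (use y True opt in_bounds_piece in auto)
    then show ?thesis using le by linarith
  next
    case False
    then have "i < t" using i by simp
    then have "e = 0 \<and> v \<le> f y + chord_error l u (int grid)" using p y unfolding progress_def by blast
    then show ?thesis using le' by auto
  qed
  moreover have "feas (\<lambda>j. if new then x j else x0 j) \<and> (if new then f x else v) = f (\<lambda>j. if new then x j else x0 j) \<and>
      in_box (3 * B) (\<lambda>j. if new then x j else x0 j)"
    using p x box new by (cases new) (auto simp: progress_def)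
  ultimately show ?thesis unfolding progress_def by blast
qed

lemma wp_piece_step:
  assumes t: "t < pieces" and inv: "pieces_inv fl t s" and st: "s vt = int t"
  shows "wp piece_step (28 * n + 30) 1 (\<lambda>s'. s' vt = int t \<and> pieces_inv fl (Suc t) (s'(vt := int (Suc t)))) s"
proof -
  define Q where "Q = (\<lambda>s'. s' vt = int t \<and> pieces_inv fl (Suc t) (s'(vt := int (Suc t))))"
  have g: "glob s" using inv by (simp add: pieces_inv_def)
  let ?s = "s(vrest := int t)"
  have g': "glob ?s" using g by (rule glob_upd) (simp add: protected_def)
  have pr: "progress t (s vempty) (s vbest) (best_at s)" using inv by (simp add: pieces_inv_def)
  have tail: "wp (IfPos lp_solved accept skip) (9 * n + 14) 0 Q s1"
    if b1: "bounded s1" and g1: "glob s1" and kp: "\<And>x. kept x \<Longrightarrow> s1 x = ?s x"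
      and ans: "answered (chord_slope l u (int grid) (int t)) (lo_at t) (up_at t) s1" for s1
  proof -
    note gd = globD[OF g1]
    have kp': "s1 z = s z" if "kept z" for z using kp[OF that] that by (auto simp: kept_def)
    have e1: "s1 vempty = s vempty" "s1 vbest = s vbest" "s1 vt = int t" "best_at s1 = best_at s" "s1 vflag = fl"
      using kp' st inv by (auto simp: kept_def best_at_def pieces_inv_def)
    from ans show ?thesis
      unfolding answered_def
    proof (elim disjE exE conjE)
      assume a: "s1 (int answer) = 1" "\<forall>y. feas y \<longrightarrow> \<not> in_bounds (lo_at t) (up_at t) y"
      have "progress (Suc t) (s vempty) (s vbest) (best_at s)"
        using pr a(2) in_bounds_piece unfolding progress_def by (auto simp: less_Suc_eq)
      then have q: "Q (s1(vup := 0))"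
        using inv g1 kp' e1 unfolding Q_def pieces_inv_def
        by (auto simp: protected_def kept_def best_at_def[abs_def] intro!: glob_upd)
      show ?thesis
        apply (rule wp_If, simp, simp)
        using a apply (simp add: gd)
        apply (simp only: skip_def)
        apply (rule wp_Assign, simp, simp, simp, simp)
        using q apply simp
        done
    next
      fix x assume a: "s1 (int answer) = 0" "\<forall>j<n. s1 (int answer + 1 + 2 * int j) = x j" "feas x" "in_bounds (lo_at t) (up_at t) x"
        "\<forall>y. feas y \<and> in_bounds (lo_at t) (up_at t) y \<longrightarrow>
          (\<Sum>j<n. chord_slope l u (int grid) (int t) j * x j) \<le> (\<Sum>j<n. chord_slope l u (int grid) (int t) j * y j)"
      have box: "in_box (3 * B) x" unfolding in_box_def
      proof (intro allI impI)
        fix j assume j: "j < n"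
        have "lo_at t j \<le> x j" "x j \<le> up_at t j" using a(4) j unfolding in_bounds_def by auto
        then show "\<bar>x j\<bar> \<le> 3 * B" using piece_lp_modest[of t] j unfolding modest_lp_def by (smt (verit))
      qed
      have acc: "wp accept (9 * n + 13) 0 Q s1"
      proof (rule wp_accept[OF g1 _ box])
        show "s1 (int answer + 1 + 2 * int j) = x j" if "j < n" for j using a(2) that by blast
        show "s1 vempty = 1 \<and> s1 vbest = 0 \<or> s1 vempty = 0" using pr e1 by (auto simp: progress_def)
        fix s2 new
        assume g2: "glob s2" and kp2: "\<And>z. kept z \<Longrightarrow> z \<noteq> vempty \<Longrightarrow> z \<noteq> vbest \<Longrightarrow> even z \<or> z > - 100 \<Longrightarrow> s2 z = s1 z"
          and new: "new = (s1 vempty = 1 \<or> s1 vbest > f x)" and s2: "s2 vempty = 0" "s2 vbest = (if new then f x else s1 vbest)"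
          and bx: "\<And>j. j < n \<Longrightarrow> best_at s2 j = (if new then x j else best_at s1 j)"
        have "progress (Suc t) 0 (if new then f x else s vbest) (\<lambda>j. if new then x j else best_at s j)"
          by (rule progress_step[OF pr _ a(3,4,5) box]) (simp add: new e1)
        moreover have "progress (Suc t) (s2 vempty) (s2 vbest) (best_at s2) =
            progress (Suc t) 0 (if new then f x else s vbest) (\<lambda>j. if new then x j else best_at s j)"
          unfolding s2 e1 by (rule progress_cong) (simp add: bx e1)
        ultimately have "progress (Suc t) (s2 vempty) (s2 vbest) (best_at s2)" by blast
        moreover have "best_at (s2(vt := w)) = best_at s2" for w by (auto simp: best_at_def)
        moreover have "glob (s2(vt := int (Suc t)))" using g2 by (rule glob_upd) (simp add: protected_def)
        moreover have "s2 (- 100 - 4 * int i) = l i \<and> s2 (- 102 - 4 * int i) = u i" if "i < k" for i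
          using kp2[of "- 100 - 4 * int i"] kp2[of "- 102 - 4 * int i"] kp'[of "- 100 - 4 * int i"] kp'[of "- 102 - 4 * int i"]
            inv that by (simp add: kept_def pieces_inv_def)
        moreover have "s2 vt = int t" "s2 vflag = fl" using kp2[of vt] kp2[of vflag] e1 by (simp_all add: kept_def)
        ultimately show "Q s2" unfolding Q_def pieces_inv_def by simp
      qed
      have steps: "9 * n + 14 - 1 = 9 * n + 13" by simp
      show ?thesis
      proof (rule wp_If, simp, simp)
        show "wp accept (9 * n + 14 - 1) 0 Q s1" unfolding steps by (rule acc)
        assume "eval \<epsilon> s1 lp_solved \<le> 0"
        then show "wp skip (9 * n + 14 - 1) 0 Q s1" using a(1) by (simp add: gd)
      qed
    qed
  qed
  have bld: "wp (build fill_piece) (n * 19 + 5) 1 (wp (IfPos lp_solved accept skip) (9 * n + 14) 0 Q) ?s"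
  proof (rule wp_build[OF fill_piece_fills[OF t] piece_lp_modest g'])
    show "?s (- 100 - 4 * int i) = l i \<and> ?s (- 102 - 4 * int i) = u i" if "i < k" for i
      using inv that by (simp add: pieces_inv_def)
    show "?s vrest = rest_at t 0" by (simp add: rest_at_def)
  qed (use tail in auto)
  have tb: "\<bar>int t\<bar> < 2 ^ bits" using grid_less[of "int t"] t count by simp
  have "wp piece_step (28 * n + 30) 1 Q s"
    unfolding piece_step_def
    apply (rule wp_step, simp, simp, simp, simp only: eval.simps st tb)
    apply (rule wp_Seq[of _ "n * 19 + 5" 1 _ "9 * n + 14" 0])
    using bld apply (simp add: st)
     apply simp_all
    done
  then show ?thesis by (simp only: Q_def)
qed

lemma wp_piece_phase:
  assumes g: "glob s" and v: "s vflag = fl" "s vempty = 1" "s vbest = 0"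
    and mem: "\<And>i. i < k \<Longrightarrow> s (- 100 - 4 * int i) = l i \<and> s (- 102 - 4 * int i) = u i"
    and Q: "\<And>s. pieces_inv fl pieces s \<Longrightarrow> Q s" and N: "pieces * (28 * n + 30 + 2) + 2 \<le> N"
  shows "wp piece_phase N pieces Q s"
  unfolding piece_phase_def
proof (rule wp_for[where Inv = "pieces_inv fl" and L = pieces and N = "28 * n + 30" and r = 1])
  show "eval \<epsilon> s (cell vpieces) = int pieces" if "pieces_inv fl t s" for t s
    using that globD(13)[of s] by (simp add: pieces_inv_def)
  show "pieces_inv fl 0 (s(vt := 0))"
    using g v mem by (auto simp: pieces_inv_def progress_def protected_def intro!: glob_upd)
  show "int pieces < 2 ^ bits" using grid_less[of "int pieces"] count by simp
  show "wp piece_step (28 * n + 30) 1 (\<lambda>s'. s' vt = int t \<and> pieces_inv fl (Suc t) (s'(vt := int (Suc t)))) s"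
    if "t < pieces" "pieces_inv fl t s" "s vt = int t" for t s using that by (rule wp_piece_step)
qed (use Q N in simp_all)

end

end

section \<open>Setup and answer\<close>

definition load :: cmd where
  "load =
     put vn (cell 0) ;; put vm (cell 1) ;; put vk (cell 2) ;;
     put vcells (Add (Mul (cell vn) (cell vm)) (cell vm)) ;;
     put vstart (Add (Const 3) (Add (cell vk) (Add (cell vn) (cell vcells)))) ;;
     put vanswer (Add (cell vstart) (Add (Const 2) (Add (Mul (Const 5) (cell vn)) (cell vcells)))) ;;
     Assign (cell vstart) (cell vn) ;;
     Assign (Add (cell vstart) (Const 1)) (cell vm)"

definition copy_body :: cmd where
  "copy_body = for_loop vj (cell vcells)
     (Assign (Add (cell vstart) (Add (Const 2) (Add (cell vn) (cell vj))))
       (Cell (Add (Const 3) (Add (cell vk) (Add (cell vn) (cell vj))))))"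

abbreviation "add_abs \<equiv> put vx (Cell (cell vj)) ;; IfPos (cell vx) (put vmass (Add (cell vmass) (cell vx))) (put vmass (Sub (cell vmass) (cell vx)))"

definition weigh :: cmd where
  "weigh =
     put vmass (Const 0) ;;
     for_loop vj (cell vstart)
       add_abs"

definition choose_box :: cmd where
  "choose_box =
     put vcap (Add (Mul (cell vmass) (Mul (cell vmass) (cell vmass))) (Mul (cell vmass) (cell vmass))) ;;
     put vB (Add (Mul (Const 3) (cell vcap)) (Add (Mul (Const 3) (cell vmass)) (Const 1))) ;;
     put vbase (Add (Mul (Const 2) (cell vB)) (Const 1)) ;;
     put vlead (Const 1) ;;
     for_loop vj (cell vn) (put vlead (Mul (cell vlead) (cell vbase)))"

abbreviation "init_best \<equiv> put vflag (Const 0) ;; put vempty (Const 1) ;; put vbest (Const 0)"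
abbreviation "power_pieces \<equiv> for_loop vj (cell vk) (put vpieces (Mul (cell vpieces) (cell vgrid)))"
abbreviation "count_pieces \<equiv> put vpieces (Const 1) ;; power_pieces ;; init_best"
abbreviation "grid_small \<equiv> Sub (Const 1) (Cut (cell vk) (Sub (Mul (cell vgrid) (cell vgrid)) (cell vk)))"

text \<open>A linear search suffices, since the grid size is at most \<open>lpc\<close>, in which
  the running time may be polynomial.\<close>

definition choose_grid :: cmd where
  "choose_grid =
     put vgrid (Const 1) ;;
     WhilePos grid_small
       (put vgrid (Add (cell vgrid) (Const 1))) ;;
     count_pieces"

abbreviation "write_best \<equiv> for_loop vj (cell vn) (Assign (Add (Const 1) (cell vj)) (Cell (Sub (Const (- 101)) (Mul (Const 2) (cell vj)))))"
abbreviation "report \<equiv> IfPos (cell vflag) (put 0 (Const 2)) (IfPos (cell vempty) (put 0 (Const 1)) (put 0 (Const 0) ;; write_best))"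

text \<open>If no point was found, the best value is 0, which is not below -cap; so the first test
  cannot mistake infeasibility for unboundedness.\<close>

definition finish :: cmd where
  "finish =
     IfPos (Sub (Sub (Const 0) (cell vcap)) (cell vbest)) (put vflag (Const 1)) skip ;;
     report"

definition iqp_algorithm :: cmd where
  "iqp_algorithm = load ;; copy_body ;; weigh ;; choose_box ;; choose_grid ;; bounds_phase ;; piece_phase ;; finish"

context iqp_run
begin

definition header :: "memory \<Rightarrow> bool" where
  "header s \<longleftrightarrow> s vn = int n \<and> s vm = int m \<and> s vk = int k \<and> s vstart = int start \<and> s vcells = int cells \<and>
     s vanswer = int answer \<and> holds_at s 0 (iqp_code I) \<and> s (int start) = int n \<and> s (int start + 1) = int m"

definition copied :: "memory \<Rightarrow> bool" where
  "copied s \<longleftrightarrow> header s \<and> holds_at s (int start + 2 + int n) body"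

definition boxed :: "memory \<Rightarrow> bool" where
  "boxed s \<longleftrightarrow> copied s \<and> s vmass = mass \<and> s vcap = cap \<and> s vB = B \<and> s vbase = base \<and> s vlead = lead"

lemma header_frame:
  assumes "header s" "\<And>x. - 6 \<le> x \<Longrightarrow> x < int start + 2 \<Longrightarrow> s' x = s x"
  shows "header s'"
proof -
  have "holds_at s' 0 (iqp_code I)"
    by (rule holds_at_cong[of _ _ _ s]) (use assms in \<open>auto simp: header_def length_code\<close>)
  then show ?thesis using assms unfolding header_def by simp
qed

lemma header_upd: "header s \<Longrightarrow> x < - 6 \<or> int start + 2 \<le> x \<Longrightarrow> header (s(x := v))"
  by (erule header_frame) auto

lemma copied_upd: "copied s \<Longrightarrow> x < - 6 \<Longrightarrow> copied (s(x := v))"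
  unfolding copied_def by (auto intro!: header_upd elim!: holds_at_cong[rotated])

lemma headerD:
  assumes "header s"
  shows "s vn = int n" "s vm = int m" "s vk = int k" "s vstart = int start" "s vcells = int cells" "s vanswer = int answer"
  using assms by (simp_all add: header_def)

lemma nat_less: "x \<le> answer + 2 * n + 2 \<Longrightarrow> int x < 2 ^ bits"
  using address_less[of "int x"] by linarith

lemma wp_load:
  assumes h: "holds_at s 0 (iqp_code I)" and Q: "\<And>s. header s \<Longrightarrow> Q s"
  shows "wp load 8 0 Q s"
proof -
  have c: "s 0 = int n" "s 1 = int m" "s 2 = int k" using h unfolding code_eq by (simp_all add: holds_at_Cons)
  have eqs: "int n * int m + int m = int cells" "3 + (int k + (int n + int cells)) = int start"
    "int start + (2 + (5 * int n + int cells)) = int answer"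
    by (simp_all add: cells_def start_def answer_def)
  have b: "\<bar>int n\<bar> < 2 ^ bits" "\<bar>int m\<bar> < 2 ^ bits" "\<bar>int k\<bar> < 2 ^ bits" "\<bar>int cells\<bar> < 2 ^ bits" "\<bar>int start\<bar> < 2 ^ bits" "\<bar>int answer\<bar> < 2 ^ bits"
    by (rule address_less; simp add: int_answer int_start cells_def)+
  have "header (s(vn := int n, vm := int m, vk := int k, vcells := int cells, vstart := int start, vanswer := int answer,
      int start := int n, int start + 1 := int m))"
    using h unfolding header_def by (auto elim!: holds_at_cong[rotated] simp: length_code)
  note q = Q[OF this]
  show ?thesis
    unfolding load_def
    apply (rule wp_step, simp, simp, simp, simp add: c eqs b[simplified], simp add: c eqs)
    apply (rule wp_step, simp, simp, simp, simp add: c eqs b[simplified], simp add: c eqs)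
    apply (rule wp_step, simp, simp, simp, simp add: c eqs b[simplified], simp add: c eqs)
    apply (rule wp_step, simp, simp, simp, simp add: c eqs b[simplified], simp add: c eqs)
    apply (rule wp_step, simp, simp, simp, simp add: c eqs b[simplified], simp add: c eqs)
    apply (rule wp_step, simp, simp, simp, simp add: c eqs b[simplified], simp add: c eqs)
    apply (rule wp_step, simp, simp, simp, simp add: c eqs b[simplified], simp add: c eqs)
    apply (rule wp_Assign, simp, simp, simp, simp add: b[simplified])
    using q apply simp
    done
qed

lemma wp_copy_body:
  assumes h: "header s" and Q: "\<And>s. copied s \<Longrightarrow> Q s"
  shows "wp copy_body (cells * 3 + 2) 0 Q s"
  unfolding copy_body_def
proof (rule wp_for[where L = cells and N = 1 and r = 0 and
      Inv = "\<lambda>i s. header s \<and> (\<forall>j<i. s (int start + 2 + int n + int j) = body ! j)"])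
  show "int cells < 2 ^ bits" by (rule nat_less) (simp add: answer_def)
  show "header (s(vj := 0)) \<and> (\<forall>j<0. (s(vj := 0)) (int start + 2 + int n + int j) = body ! j)" using header_upd[OF h] by simp
next
  fix i s assume i: "i < cells" and I: "header s \<and> (\<forall>j<i. s (int start + 2 + int n + int j) = body ! j)" and vi: "s vj = int i" and b: "bounded s"
  note hd = headerD[OF conjunct1[OF I]]
  have "holds_at s (3 + int k + int n) body"
    using I unfolding header_def code_eq by (simp add: holds_at_append holds_at_Cons add.assoc)
  then have src: "s (3 + (int k + (int n + int i))) = body ! i" using i by (simp add: holds_at_def length_body add.assoc)
  have "\<bar>body ! i\<bar> < 2 ^ bits" using b src unfolding bounded_def by metis
  moreover have "header (s(int start + (2 + (int n + int i)) := body ! i, vj := w))" for w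
    using I by (intro header_upd) auto
  then have "header ((s(int start + (2 + (int n + int i)) := body ! i))(vj := int (Suc i))) \<and>
      (\<forall>j<Suc i. ((s(int start + (2 + (int n + int i)) := body ! i))(vj := int (Suc i))) (int start + 2 + int n + int j) = body ! j)"
    using I by (auto simp: less_Suc_eq)
  ultimately show "wp (Assign (Add (cell vstart) (Add (Const 2) (Add (cell vn) (cell vj))))
       (Cell (Add (Const 3) (Add (cell vk) (Add (cell vn) (cell vj)))))) 1 0
     (\<lambda>s'. s' vj = int i \<and> header (s'(vj := int (Suc i))) \<and> (\<forall>j<Suc i. (s'(vj := int (Suc i))) (int start + 2 + int n + int j) = body ! j)) s"
    by (intro wp_Assign) (simp_all add: hd vi src)
next
  fix s assume "header s \<and> (\<forall>j<cells. s (int start + 2 + int n + int j) = body ! j)"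
  then show "Q s" by (intro Q) (auto simp: copied_def holds_at_def length_body)
qed (auto simp: header_def)

lemma wp_weigh:
  assumes h: "copied s" and Q: "\<And>s. copied s \<Longrightarrow> s vmass = mass \<Longrightarrow> Q s"
  shows "wp weigh (start * 5 + 3) 0 Q s"
proof -
  define part where "part i = (\<Sum>j<i. \<bar>iqp_code I ! j\<bar>)" for i
  have part_end: "part start = mass"
    unfolding part_def mass_def by (simp add: sum_list_sum_nth length_code atLeast0LessThan)
  have part_less: "\<bar>part i\<bar> < 2 ^ bits" if "i \<le> start" for i
  proof -
    have "part i \<le> part start" unfolding part_def using that by (intro sum_mono2) auto
    moreover have "0 \<le> part i" unfolding part_def by (rule sum_nonneg) simp
    ultimately show ?thesis using part_end B_ge by (intro box_less) linarith
  qed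
  define Inv where "Inv i s \<longleftrightarrow> copied s \<and> s vmass = part i" for i s
  have loop: "wp (for_loop vj (cell vstart)
       add_abs) (start * 5 + 2) 0 Q (s(vmass := 0))"
  proof (rule wp_for[where L = start and N = 3 and r = 0 and Inv = Inv])
    show "eval \<epsilon> s (cell vstart) = int start" if "Inv i s" for i s using that headerD(4)[of s] by (simp add: Inv_def copied_def)
    show "int start < 2 ^ bits" by (rule nat_less) (simp add: answer_def)
    show "Inv 0 ((s(vmass := 0))(vj := 0))" using h by (auto simp: Inv_def part_def intro!: copied_upd)
  next
    fix i s assume i: "i < start" and I: "Inv i s" and vi: "s vj = int i" and b: "bounded s"
    have "holds_at s 0 (iqp_code I)" using I by (simp add: Inv_def copied_def header_def)
    then have src: "s (int i) = iqp_code I ! i" using i by (simp add: holds_at_def length_code)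
    define z where "z = iqp_code I ! i"
    have zb: "\<bar>z\<bar> < 2 ^ bits" using b src unfolding bounded_def z_def by metis
    have nxt: "part i + \<bar>z\<bar> = part (Suc i)" by (simp add: part_def z_def)
    have pos: "part i + z = part (Suc i)" if "z > 0" using nxt that by simp
    have neg: "part i - z = part (Suc i)" if "z \<le> 0" using nxt that by simp
    have fin: "s2 vj = int i \<and> Inv (Suc i) (s2(vj := int (Suc i)))" if "s2 = s(vx := z, vmass := part (Suc i))" for s2
      using I vi that by (auto simp: Inv_def intro!: copied_upd)
    have m: "s vmass = part i" using I by (simp add: Inv_def)
    have pl: "\<bar>part (Suc i)\<bar> < 2 ^ bits" by (rule part_less) (use i in simp)
    define Q' where "Q' = (\<lambda>s'. s' vj = int i \<and> Inv (Suc i) (s'(vj := int (Suc i))))"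
    have "wp add_abs 3 0 Q' s"
      apply (rule wp_step, simp, simp, simp, simp add: vi src z_def[symmetric] zb, simp add: vi src z_def[symmetric])
      apply (rule wp_If, simp, simp)
       apply (rule wp_Assign, simp, simp, simp, simp add: m pos pl)
       apply (simp only: eval.simps Q'_def, rule fin, simp add: m pos, rule ext, simp)
      apply (rule wp_Assign, simp, simp, simp, simp add: m neg pl)
      apply (simp only: eval.simps Q'_def, rule fin, simp add: m neg, rule ext, simp)
      done
    then show "wp add_abs 3 0
        (\<lambda>s'. s' vj = int i \<and> Inv (Suc i) (s'(vj := int (Suc i)))) s" by (simp only: Q'_def)
  next
    fix s assume "Inv start s"
    then show "Q s" by (intro Q) (auto simp: Inv_def part_end)
  qed auto
  show ?thesis
    unfolding weigh_def
    apply (rule wp_step, simp, simp, simp, simp)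
    using loop apply simp
    done
qed

lemma wp_choose_box:
  assumes h: "copied s" "s vmass = mass" and Q: "\<And>s. boxed s \<Longrightarrow> Q s"
  shows "wp choose_box (n * 3 + 6) 0 Q s"
proof -
  have c: "mass * (mass * mass) + mass * mass = cap" by (simp add: cap_def power3_eq_cube power2_eq_square)
  have eB: "3 * cap + (3 * mass + 1) = B" by (simp add: B_def)
  have b: "\<bar>cap\<bar> < 2 ^ bits" "\<bar>B\<bar> < 2 ^ bits" "\<bar>base\<bar> < 2 ^ bits"
    by (rule box_less; use B_ge mass_nonneg T_nonneg eB in \<open>simp add: base_def\<close>)+
  define Inv where "Inv i s \<longleftrightarrow> copied s \<and> s vmass = mass \<and> s vcap = cap \<and> s vB = B \<and> s vbase = base \<and> s vlead = base ^ i" for i s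
  have loop: "wp (for_loop vj (cell vn) (put vlead (Mul (cell vlead) (cell vbase)))) (n * 3 + 2) 0 Q
      (s(vcap := cap, vB := B, vbase := base, vlead := 1))"
  proof (rule wp_for[where L = n and N = 1 and r = 0 and Inv = Inv])
    show "eval \<epsilon> s (cell vn) = int n" if "Inv i s" for i s using that headerD(1)[of s] by (simp add: Inv_def copied_def)
    show "int n < 2 ^ bits" by (rule nat_less) simp
    show "Inv 0 ((s(vcap := cap, vB := B, vbase := base, vlead := 1))(vj := 0))"
      using h by (auto simp: Inv_def intro!: copied_upd)
    show "Q s" if "Inv n s" for s using that by (intro Q) (simp add: Inv_def boxed_def lead_def)
    fix i s assume i: "i < n" and I: "Inv i s" and vi: "s vj = int i"
    have "\<bar>base ^ Suc i\<bar> < 2 ^ bits" by (rule power_less) (use i in simp)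
    moreover have "Inv (Suc i) (s(vlead := base ^ i * base, vj := int (Suc i)))"
      using I by (auto simp: Inv_def intro!: copied_upd)
    ultimately show "wp (put vlead (Mul (cell vlead) (cell vbase))) 1 0 (\<lambda>s'. s' vj = int i \<and> Inv (Suc i) (s'(vj := int (Suc i)))) s"
      using I vi by (intro wp_Assign) (simp_all add: Inv_def mult.commute)
  qed auto
  show ?thesis
    unfolding choose_box_def
    apply (rule wp_step, simp, simp, simp, simp add: h c b, simp add: h c)
    apply (rule wp_step, simp, simp, simp, simp add: h eB b, simp add: h eB)
    apply (rule wp_step, simp, simp, simp, simp add: base_def[symmetric] b, simp add: base_def[symmetric])
    apply (rule wp_step, simp, simp, simp, simp add: one_less_bits)
    using loop apply simp
    done
qed

text \<open>The test decides without square roots whether the grid is fine enough: it says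
  k (1 + 1 / \<epsilon>) \<le> x^2.\<close>

lemma cut_grid:
  assumes "1 \<le> x"
  shows "real_of_int (int k) \<le> real_of_int (int x * int x - int k) * \<epsilon> \<longleftrightarrow> grid \<le> x"
proof -
  have "real_of_int (int k) \<le> real_of_int (int x * int x - int k) * \<epsilon> \<longleftrightarrow> real k * (1 + 1 / \<epsilon>) \<le> (real x)\<^sup>2"
    using \<epsilon> by (simp add: field_simps power2_eq_square)
  also have "\<dots> \<longleftrightarrow> grid \<le> x" using sqrt_grid[of x] assms by (simp add: grid_def)
  finally show ?thesis .
qed

lemma wp_choose_grid:
  assumes h: "boxed s" and Q: "\<And>s. glob s \<Longrightarrow> s vflag = 0 \<Longrightarrow> s vempty = 1 \<Longrightarrow> s vbest = 0 \<Longrightarrow> Q s"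
  shows "wp choose_grid (2 * grid + 3 * k + 10) 0 Q s"
proof -
  have upd: "boxed (s(x := v))" if "boxed s" "x < - 11" for s x v
    using that by (auto simp: boxed_def intro!: copied_upd)
  have D: "s vk = int k" if "boxed s" for s using that headerD(3)[of s] by (simp add: boxed_def copied_def)
  define Inv where "Inv i s \<longleftrightarrow> boxed s \<and> s vgrid = int grid \<and> s vpieces = int (grid ^ i)" for i s
  have last: "wp init_best 3 0 Q s" if I: "Inv k s" for s
  proof -
    have "glob (s(vflag := 0, vempty := 1, vbest := 0))"
    proof (rule glob_frame[of s])
      show "glob s" using I by (auto simp: Inv_def boxed_def copied_def header_def glob_def pieces_def)
    qed (auto simp: protected_def)
    then have q: "Q (s(vflag := 0, vempty := 1, vbest := 0))" by (rule Q) simp_all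
    show ?thesis
      apply (rule wp_step, simp, simp, simp, simp, simp)
      apply (rule wp_step, simp, simp, simp, simp add: one_less_bits, simp)
      apply (rule wp_Assign, simp, simp, simp, simp)
      using q apply simp
      done
  qed
  have powers: "wp count_pieces (3 * k + 6) 0 Q s"
    if b: "boxed s" and g: "s vgrid = int grid" for s
  proof -
    have loop: "wp power_pieces (k * 3 + 2) 0
       (wp init_best 3 0 Q) (s(vpieces := 1))"
    proof (rule wp_for[where L = k and N = 1 and r = 0 and Inv = Inv])
      show "eval \<epsilon> s (cell vk) = int k" if "Inv i s" for i s using that D by (simp add: Inv_def)
      show "int k < 2 ^ bits" by (rule nat_less) (simp add: answer_def start_def)
      show "Inv 0 ((s(vpieces := 1))(vj := 0))" using b g by (auto simp: Inv_def intro!: upd)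
      show "wp init_best 3 0 Q s" if "Inv k s" for s
        using that by (rule last)
      fix i s assume i: "i < k" and I: "Inv i s" and vi: "s vj = int i"
      have "grid ^ Suc i \<le> pieces" unfolding pieces_def using i grid_ge by (intro power_increasing) auto
      then have "\<bar>int (grid ^ Suc i)\<bar> < 2 ^ bits" using count by (intro grid_less) linarith+
      moreover have eq: "int (grid ^ i) * int grid = int (grid ^ Suc i)" by simp
      moreover have "Inv (Suc i) (s(vpieces := int (grid ^ Suc i), vj := int (Suc i)))"
        using I by (auto simp: Inv_def intro!: upd)
      ultimately show "wp (put vpieces (Mul (cell vpieces) (cell vgrid))) 1 0 (\<lambda>s'. s' vj = int i \<and> Inv (Suc i) (s'(vj := int (Suc i)))) s"
        using I vi by (intro wp_Assign) (simp_all add: Inv_def del: of_nat_power power_Suc of_nat_mult)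
    qed auto
    show ?thesis
      apply (rule wp_step, simp, simp, simp, simp add: one_less_bits)
      apply (rule wp_Seq[of _ "k * 3 + 2" 0 _ 3 0])
      using loop apply simp_all
      done
  qed
  have search: "wp (WhilePos grid_small
       (put vgrid (Add (cell vgrid) (Const 1)))) (2 * grid + 1) 0
      (wp count_pieces (3 * k + 6) 0 Q) (s(vgrid := 1))"
  proof (rule wp_While[where L = "grid - 1" and N = 1 and r = 0 and Inv = "\<lambda>i s. boxed s \<and> s vgrid = int (Suc i)"])
    show "boxed (s(vgrid := 1)) \<and> (s(vgrid := 1)) vgrid = int (Suc 0)" using upd[OF h] by simp
    fix i s assume i: "i < grid - 1" and I: "boxed s \<and> s vgrid = int (Suc i)"
    have "\<not> grid \<le> Suc i" using i by linarith
    then have "\<not> real_of_int (int k) \<le> real_of_int (int (Suc i) * int (Suc i) - int k) * \<epsilon>" using cut_grid[of "Suc i"] by simp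
    then have "eval \<epsilon> s grid_small > 0"
      using I D[OF conjunct1[OF I]] by (simp del: of_int_diff of_int_mult of_nat_Suc)
    moreover have "wp (put vgrid (Add (cell vgrid) (Const 1))) 1 0 (\<lambda>s. boxed s \<and> s vgrid = int (Suc (Suc i))) s"
    proof (rule wp_Assign)
      have "\<bar>int (Suc (Suc i))\<bar> < 2 ^ bits" using i grid_le by (intro grid_less) linarith+
      moreover have eq: "eval \<epsilon> s (Add (cell vgrid) (Const 1)) = int (Suc (Suc i))" using I by simp
      ultimately show "\<bar>eval \<epsilon> s (Add (cell vgrid) (Const 1))\<bar> < 2 ^ bits" by (simp only:)
      show "boxed (s(eval \<epsilon> s (Const vgrid) := eval \<epsilon> s (Add (cell vgrid) (Const 1)))) \<and>
          (s(eval \<epsilon> s (Const vgrid) := eval \<epsilon> s (Add (cell vgrid) (Const 1)))) vgrid = int (Suc (Suc i))"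
        unfolding eq using I upd by simp
    qed simp_all
    ultimately show "eval \<epsilon> s grid_small > 0 \<and>
      wp (put vgrid (Add (cell vgrid) (Const 1))) 1 0 (\<lambda>s. boxed s \<and> s vgrid = int (Suc (Suc i))) s" by blast
  next
    fix s assume I: "boxed s \<and> s vgrid = int (Suc (grid - 1))"
    have g: "Suc (grid - 1) = grid" using grid_ge by simp
    have "real_of_int (int k) \<le> real_of_int (int grid * int grid - int k) * \<epsilon>" using cut_grid[OF grid_ge] by simp
    then have "eval \<epsilon> s grid_small \<le> 0"
      using I D[OF conjunct1[OF I]] unfolding g by (simp del: of_int_diff of_int_mult)
    moreover have "wp count_pieces (3 * k + 6) 0 Q s"
      using I unfolding g by (intro powers) auto
    ultimately show "eval \<epsilon> s grid_small \<le> 0 \<and>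
     wp count_pieces (3 * k + 6) 0 Q s" by blast
  qed auto
  show ?thesis
    unfolding choose_grid_def
    apply (rule wp_step, simp, simp, simp, simp add: one_less_bits)
    apply (rule wp_Seq[of _ "2 * grid + 1" 0 _ "3 * k + 6" 0])
    using search apply simp_all
    done
qed

section \<open>From index functions back to vectors, and correctness of the answer\<close>

lemma mult_vec_row:
  assumes v: "dim_vec v = n" and i: "i < m"
  shows "(iqp_W I *\<^sub>v v) $ i = row (\<lambda>j. v $ j) i"
proof -
  have "(iqp_W I *\<^sub>v v) $ i = Matrix.row (iqp_W I) i \<bullet> v" by (rule index_mult_mat_vec) (use i in \<open>simp only: dims\<close>)
  also have "\<dots> = (\<Sum>j<n. Matrix.row (iqp_W I) i $ j * v $ j)" unfolding scalar_prod_def v atLeast0LessThan ..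
  also have "\<dots> = row (\<lambda>j. v $ j) i" unfolding row_def
    by (rule sum.cong, rule refl) (use i in \<open>simp only: index_row dims lessThan_iff coef_def\<close>)
  finally show ?thesis .
qed

lemma iqp_feasible_iff: "v \<in> iqp_feasible I \<longleftrightarrow> dim_vec v = n \<and> feas (\<lambda>j. v $ j)"
proof (cases "dim_vec v = n")
  case True
  have "iqp_W I *\<^sub>v v \<le> iqp_w I \<longleftrightarrow> (\<forall>i<m. (iqp_W I *\<^sub>v v) $ i \<le> iqp_w I $ i)"
    unfolding less_eq_vec_def dim_mult_mat_vec dims by simp
  also have "\<dots> \<longleftrightarrow> feas (\<lambda>j. v $ j)" unfolding feas_def rhs_def by (intro all_cong) (simp only: mult_vec_row[OF True])
  finally show ?thesis using True by (simp only: iqp_feasible_def carrier_dim_vec mem_Collect_eq)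
next
  case False
  then show ?thesis by (simp only: iqp_feasible_def carrier_dim_vec mem_Collect_eq) blast
qed

lemma iqp_objective_eq: "dim_vec v = n \<Longrightarrow> iqp_objective I v = real_of_int (f (\<lambda>j. v $ j))"
  unfolding iqp_objective_def f_def quad_def lin_def scalar_prod_def atLeast0LessThan by simp

lemma vec_feasible: "vec n x \<in> iqp_feasible I \<longleftrightarrow> feas x"
  using feas_cong[of "\<lambda>j. vec n x $ j" x] by (simp add: iqp_feasible_iff)

lemma vec_objective: "iqp_objective I (vec n x) = real_of_int (f x)"
  using f_cong[of "\<lambda>j. vec n x $ j" x] by (simp add: iqp_objective_eq)

lemma unbounded_outcome:
  assumes bad: "\<not> rays_good" and x: "feas x"
  shows "correct_outcome (approx_solution \<epsilon>) (iqp_objective I) (iqp_feasible I) Unbounded"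
proof -
  have "\<not> bdd_below (iqp_objective I ` iqp_feasible I)"
  proof
    assume "bdd_below (iqp_objective I ` iqp_feasible I)"
    then obtain L where L: "\<And>v. v \<in> iqp_feasible I \<Longrightarrow> L \<le> iqp_objective I v" by (auto simp: bdd_below_def)
    obtain y where "feas y" "f y < \<lfloor>L\<rfloor>" using not_good_unbounded[OF bad x] by blast
    then show False using L[of "vec n y"] by (simp add: vec_feasible vec_objective) linarith
  qed
  moreover have "vec n x \<in> iqp_feasible I" using x by (simp add: vec_feasible)
  ultimately show ?thesis by auto
qed

lemma solution_outcome:
  assumes lu: "exact_bounds l u" "small_bounds l u" and good: rays_good and x: "feas x"
    and near: "near_optimal l u (int grid) (f x)"
  shows "correct_outcome (approx_solution \<epsilon>) (iqp_objective I) (iqp_feasible I) (Solution (vec n x))"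
proof -
  have g: "1 \<le> int grid" using grid_ge by simp
  obtain xs where xs: "feas xs" "\<And>y. feas y \<Longrightarrow> f xs \<le> f y"
    "\<And>G. (\<And>y. feas y \<Longrightarrow> of_int (f y) \<le> G) \<Longrightarrow> of_int (f x - f xs) \<le> \<epsilon> * (G - of_int (f xs))"
    by (rule near_optimal_approx[OF lu good x near \<epsilon> g grid_sq]) blast
  have "optimal (iqp_objective I) (iqp_feasible I) (vec n xs)"
    unfolding optimal_def vec_objective
  proof (intro conjI ballI)
    show "vec n xs \<in> iqp_feasible I" using xs(1) by (simp add: vec_feasible)
    fix v assume "v \<in> iqp_feasible I"
    then have "dim_vec v = n" "feas (\<lambda>j. v $ j)" by (simp_all add: iqp_feasible_iff)
    then show "real_of_int (f xs) \<le> iqp_objective I v" using xs(2)[of "\<lambda>j. v $ j"] iqp_objective_eq[of v] by linarith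
  qed
  moreover have "let fmax = Sup (iqp_objective I ` iqp_feasible I) in iqp_objective I (vec n xs) = fmax \<or>
      iqp_objective I (vec n xs) < fmax \<and>
      (iqp_objective I (vec n x) - iqp_objective I (vec n xs)) / (fmax - iqp_objective I (vec n xs)) \<le> \<epsilon>"
    if bdd: "bdd_above (iqp_objective I ` iqp_feasible I)"
  proof -
    define fmax where "fmax = Sup (iqp_objective I ` iqp_feasible I)"
    have le: "of_int (f y) \<le> fmax" if "feas y" for y
      unfolding fmax_def vec_objective[symmetric] by (rule cSup_upper[OF _ bdd]) (use that in \<open>simp add: vec_feasible\<close>)
    have "of_int (f x - f xs) \<le> \<epsilon> * (fmax - of_int (f xs))" by (rule xs(3)[OF le])
    then have "of_int (f xs) = fmax \<or> of_int (f xs) < fmax \<and> (of_int (f x) - of_int (f xs)) / (fmax - of_int (f xs)) \<le> \<epsilon>"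
      using le[OF xs(1)] by (auto simp: divide_le_eq)
    then show ?thesis by (simp add: Let_def fmax_def[symmetric] vec_objective)
  qed
  moreover have "vec n x \<in> iqp_feasible I" using x by (simp add: vec_feasible)
  ultimately show ?thesis
    unfolding correct_outcome.simps approx_solution_def by (intro conjI exI[of _ "vec n xs"] impI)
qed

text \<open>If all ranges are small, then the best value v found on the pieces is below - cap if and only if the
  objective function is unbounded.\<close>

definition verdict :: "int \<Rightarrow> int \<Rightarrow> int \<Rightarrow> (nat \<Rightarrow> int) \<Rightarrow> int vec outcome" where
  "verdict fl e v x = (if fl = 1 \<or> v < - cap then Unbounded else if e = 1 then Infeasible else Solution (vec n x))"

text \<open>A feasible point yields one in the small box, so the ranges are exact. Large ranges
  prove a bad ray. Small ranges cover all feasible points, hence so do the pieces, v is nearly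
  optimal on the box, and the threshold -cap decides.\<close>

lemma verdict_correct:
  assumes lu: "\<forall>i<k. \<bar>l i\<bar> \<le> B \<and> \<bar>u i\<bar> \<le> B \<and> l i \<le> u i"
    and exact: "\<exists>y. feas y \<and> in_box B y \<Longrightarrow> exact_bounds l u"
    and zero: "\<not> (\<exists>y. feas y \<and> in_box B y) \<Longrightarrow> small_bounds l u"
    and fl: "fl = (if small_bounds l u then 0 else 1)"
    and pr: "progress l u pieces e v x"
  shows "correct_outcome (approx_solution \<epsilon>) (iqp_objective I) (iqp_feasible I) (verdict fl e v x)"
proof (cases "\<exists>y. feas y")
  case False
  then have "e = 1 \<and> v = 0" using pr by (auto simp: progress_def[OF lu])
  moreover have "fl = 0" using False zero fl by auto
  moreover have "iqp_feasible I = {}" using False iqp_feasible_iff by auto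
  ultimately show ?thesis using T_nonneg by (simp add: verdict_def)
next
  case True
  then obtain x0 where x0: "feas x0" by blast
  then obtain x1 where x1: "feas x1" "in_box mass x1" using reduce_small by blast
  have ex: "exact_bounds l u" using exact x1 small_box by blast
  show ?thesis
  proof (cases "small_bounds l u")
    case False
    then have "verdict fl e v x = Unbounded" using fl by (simp add: verdict_def)
    then show ?thesis using unbounded_outcome[OF large_bounds_not_good[OF ex False] x0] by simp
  next
    case small: True
    have g: "1 \<le> int grid" using grid_ge by simp
    have cover: "e = 0 \<and> v \<le> f y + chord_error l u (int grid)" if y: "feas y" "in_box B y" for y
    proof -
      have "\<exists>t. 0 \<le> t \<and> t < int grid ^ k \<and> in_piece l u (int grid) t y"
        by (rule piece_cover[OF g]) (rule small_bounds_cover[OF ex small y(1)])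
      then obtain t where t: "0 \<le> t" "t < int grid ^ k" "in_piece l u (int grid) t y" by blast
      have "nat t < pieces" using t(1,2) by (simp add: pieces_def nat_less_iff)
      moreover have "in_piece l u (int grid) (int (nat t)) y" using t by simp
      ultimately show ?thesis using pr y unfolding progress_def[OF lu] by blast
    qed
    have e0: "e = 0" using cover x1 small_box by blast
    then have best: "feas x" "v = f x" using pr by (auto simp: progress_def[OF lu])
    have near: "near_optimal l u (int grid) v" using cover by (simp add: near_optimal_def)
    show ?thesis
    proof (cases "v < - cap")
      case True
      then have "\<not> rays_good" using good_lower_bound[OF _ best(1)] best(2) by auto
      then show ?thesis using True unbounded_outcome[OF _ x0] by (simp add: verdict_def)
    next
      case False
      then have good: rays_good using not_good_value[OF ex small x0 g near] by blast
      have "verdict fl e v x = Solution (vec n x)" using False e0 fl small by (simp add: verdict_def)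
      then show ?thesis using solution_outcome[OF ex small good best(1)] near best(2) by simp
    qed
  qed
qed

lemma wp_finish:
  assumes g: "glob s" and fl: "s vflag = fl" "fl = 0 \<or> fl = 1" and e: "s vempty = 0 \<or> s vempty = 1" and b: "bounded s"
    and Q: "\<And>s'. holds_at s' 0 (outcome_code (\<lambda>z. [z]) (verdict fl (s vempty) (s vbest) (best_at s))) \<Longrightarrow> Q s'"
  shows "wp finish (3 * n + 10) 0 Q s"
proof -
  note gd = globD[OF g]
  define out where "out = verdict fl (s vempty) (s vbest) (best_at s)"
  define fl' where "fl' = (if s vbest < - cap then 1 else fl)"
  have rest: "wp report (3 * n + 8) 0 Q s1"
    if s1: "s1 vflag = fl'" "\<And>x. x \<noteq> vflag \<Longrightarrow> x \<noteq> vup \<Longrightarrow> s1 x = s x" for s1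
  proof (rule wp_If, simp, simp)
    assume "eval \<epsilon> s1 (cell vflag) > 0"
    then have "out = Unbounded" using s1 fl by (auto simp: out_def verdict_def fl'_def split: if_splits)
    then have "Q (s1(0 := 2))" using Q by (simp add: out_def holds_at_Cons)
    moreover have "(2::int) < 2 ^ bits" using box_less[of 2] B_ge by simp
    ultimately show "wp (put 0 (Const 2)) (3 * n + 8 - 1) 0 Q s1" by (intro wp_Assign) simp_all
  next
    assume "eval \<epsilon> s1 (cell vflag) \<le> 0"
    then have nf: "fl \<noteq> 1" "\<not> s vbest < - cap" using s1 fl by (auto simp: fl'_def split: if_splits)
    show "wp (IfPos (cell vempty) (put 0 (Const 1))
         (put 0 (Const 0) ;;
          write_best)) (3 * n + 8 - 1) 0 Q s1"
    proof (rule wp_If, simp, simp)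
      assume "eval \<epsilon> s1 (cell vempty) > 0"
      then have "out = Infeasible" using s1 e nf by (auto simp: out_def verdict_def)
      then have "Q (s1(0 := 1))" using Q by (simp add: out_def holds_at_Cons)
      then show "wp (put 0 (Const 1)) (3 * n + 8 - 1 - 1) 0 Q s1" using one_less_bits by (intro wp_Assign) simp_all
    next
      assume "eval \<epsilon> s1 (cell vempty) \<le> 0"
      then have out: "out = Solution (vec n (best_at s))" using s1 e nf by (auto simp: out_def verdict_def)
      define Inv where "Inv i s2 \<longleftrightarrow> s2 vn = int n \<and> s2 0 = 0 \<and> (\<forall>x\<le>- 100. s2 x = s x) \<and> (\<forall>j<i. s2 (1 + int j) = best_at s j)" for i s2
      have loop: "wp write_best (n * 3 + 2) 0 Q (s1(0 := 0))"
      proof (rule wp_for[where L = n and N = 1 and r = 0 and Inv = Inv])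
        show "int n < 2 ^ bits" by (rule nat_less) simp
        show "Inv 0 ((s1(0 := 0))(vj := 0))" using s1(2) gd by (simp add: Inv_def)
        show "Q s2" if "Inv n s2" for s2
        proof (rule Q)
          have cc: "concat (map (\<lambda>z. [z]) xs) = xs" for xs :: "int list" by (induction xs) auto
          show "holds_at s2 0 (outcome_code (\<lambda>z. [z]) (verdict fl (s vempty) (s vbest) (best_at s)))"
            unfolding out_def[symmetric] out outcome_code.simps cc list_of_vec_vec holds_at_Cons holds_at_map
            using that by (simp add: Inv_def)
        qed
        fix i s2 assume i: "i < n" and I: "Inv i s2" and vi: "s2 vj = int i"
        have src: "s2 (- 101 - 2 * int i) = best_at s i" using I by (simp add: Inv_def best_at_def[of s i])
        have "\<bar>best_at s i\<bar> < 2 ^ bits" using b by (simp add: bounded_def best_at_def)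
        moreover have "Inv (Suc i) (s2(1 + int i := best_at s i, vj := int (Suc i)))"
          using I by (auto simp: Inv_def less_Suc_eq)
        ultimately show "wp (Assign (Add (Const 1) (cell vj)) (Cell (Sub (Const (- 101)) (Mul (Const 2) (cell vj))))) 1 0
            (\<lambda>s'. s' vj = int i \<and> Inv (Suc i) (s'(vj := int (Suc i)))) s2"
          by (intro wp_Assign) (simp_all add: vi src)
      qed (auto simp: Inv_def)
      then have "wp write_best (3 * n + 5) 0 Q (s1(0 := 0))"
        by (rule wp_mono) simp_all
      then show "wp (put 0 (Const 0) ;; write_best) (3 * n + 8 - 1 - 1) 0 Q s1"
        by (intro wp_step) (simp_all add: numeral_eq_Suc)
    qed
  qed
  have r1: "wp report (3 * n + 8) 0 Q (s(vflag := 1))"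
    if "s vbest < - cap" by (rule rest) (use that in \<open>simp_all add: fl'_def\<close>)
  have r0: "wp report (3 * n + 8) 0 Q (s(vup := 0))"
    if "\<not> s vbest < - cap" by (rule rest) (use that fl in \<open>simp_all add: fl'_def\<close>)
  show ?thesis
    unfolding finish_def
    apply (rule wp_If_Seq, simp, simp)
     apply (rule wp_step, simp, simp, simp, simp add: one_less_bits)
    subgoal using r1 by (simp add: gd numeral_eq_Suc)
    apply (rule wp_skip_Seq, simp)
    subgoal using r0 by (simp add: gd numeral_eq_Suc)
    done
qed

definition steps :: nat where
  "steps = 8 + (cells * 3 + 2) + (start * 5 + 3) + (n * 3 + 6) + (2 * grid + 3 * k + 10)
     + (2 * k * (n * 13 + 10 + 2) + 2) + (pieces * (28 * n + 30 + 2) + 2) + (3 * n + 10)"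

text \<open>The phases are joined from the last to the first, each taking the precondition of the
  remaining program as its postcondition. The ranges use 2 k of the LPs, the pieces the
  others.\<close>

lemma wp_iqp_algorithm:
  assumes s: "holds_at s 0 (iqp_code I)"
  shows "wp iqp_algorithm steps (2 * k + pieces) (\<lambda>s'. \<exists>out. holds_at s' 0 (outcome_code (\<lambda>z. [z]) out) \<and>
     correct_outcome (approx_solution \<epsilon>) (iqp_objective I) (iqp_feasible I) out) s"
    (is "wp _ _ _ ?Q s")
proof -
  have phase4: "wp finish (3 * n + 10) 0 ?Q s3"
    if lu: "\<forall>i<k. \<bar>l i\<bar> \<le> B \<and> \<bar>u i\<bar> \<le> B \<and> l i \<le> u i"
      and exact: "\<exists>y. feas y \<and> in_box B y \<Longrightarrow> exact_bounds l u"
      and zero: "\<not> (\<exists>y. feas y \<and> in_box B y) \<Longrightarrow> small_bounds l u"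
      and fl: "fl = (if small_bounds l u then 0 else 1)"
      and inv: "pieces_inv l u fl pieces s3" for l u fl s3
  proof (rule wp_bounded)
    assume b: "bounded s3"
    note inv' = inv[unfolded pieces_inv_def[OF lu]]
    have pr: "progress l u pieces (s3 vempty) (s3 vbest) (best_at s3)" using inv' by blast
    have em: "s3 vempty = 0 \<or> s3 vempty = 1" using pr unfolding progress_def[OF lu] by blast
    note ok = verdict_correct[OF lu exact zero fl pr]
    show "wp finish (3 * n + 10) 0 ?Q s3"
      by (rule wp_finish[of _ fl]) (use inv' fl b ok em in auto)
  qed
  have phase3: "wp (piece_phase ;; finish) ((pieces * (28 * n + 30 + 2) + 2) + (3 * n + 10)) pieces ?Q s2"
    if inv: "bounds_inv (2 * k) s2" for s2
  proof -
    define l where "l = (\<lambda>i. s2 (- 100 - 4 * int i))"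
    define u where "u = (\<lambda>i. s2 (- 102 - 4 * int i))"
    have box: "\<forall>i<k. \<bar>l i\<bar> \<le> B \<and> \<bar>u i\<bar> \<le> B \<and> l i \<le> u i"
      unfolding l_def u_def by (intro allI impI, rule bounds_inv_end(1)[OF inv])
    have ex: "exact_bounds l u" if "\<exists>y. feas y \<and> in_box B y"
      unfolding l_def u_def by (rule bounds_inv_end(2)[OF inv that])
    have flag: "s2 vflag = (if small_bounds l u then 0 else 1)"
      unfolding l_def u_def by (rule bounds_inv_end(3)[OF inv])
    have bv: "bound_value j (s2 (- 100 - 2 * int j))" if "j < 2 * k" for j using inv that by (simp add: bounds_inv_def)
    have zero: "small_bounds l u" if none: "\<not> (\<exists>y. feas y \<and> in_box B y)"
      unfolding small_bounds_def
    proof (intro allI impI)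
      fix i assume i: "i < k"
      have "bound_value (2 * i) (l i)" "bound_value (2 * i + 1) (u i)"
        using bv[of "2 * i"] bv[of "2 * i + 1"] i by (simp_all add: l_def u_def)
      then show "\<bar>l i\<bar> \<le> mass \<and> \<bar>u i\<bar> \<le> mass" using none mass_nonneg by (auto simp: bound_value_def)
    qed
    have b: "glob s2" "s2 vempty = 1" "s2 vbest = 0" using inv by (simp_all add: bounds_inv_def)
    have "wp piece_phase (pieces * (28 * n + 30 + 2) + 2) pieces (wp finish (3 * n + 10) 0 ?Q) s2"
    proof (rule wp_piece_phase[where l = l and u = u and fl = "s2 vflag", OF box b(1) refl b(2,3)])
      show "s2 (- 100 - 4 * int i) = l i \<and> s2 (- 102 - 4 * int i) = u i" for i by (simp add: l_def u_def)
      show "wp finish (3 * n + 10) 0 ?Q s3" if "pieces_inv l u (s2 vflag) pieces s3" for s3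
        by (rule phase4[OF box ex zero flag that])
    qed simp
    then show ?thesis by (rule wp_Seq) (rule order_refl, simp)
  qed
  have phase2: "wp (bounds_phase ;; piece_phase ;; finish)
      ((2 * k * (n * 13 + 10 + 2) + 2) + ((pieces * (28 * n + 30 + 2) + 2) + (3 * n + 10))) (2 * k + pieces) ?Q s1"
    if "glob s1" "s1 vflag = 0" "s1 vempty = 1" "s1 vbest = 0" for s1
    by (rule wp_Seq[OF wp_bounds_phase[OF that]]) (use phase3 in auto)
  have phase1d: "wp (choose_grid ;; bounds_phase ;; piece_phase ;; finish)
      ((2 * grid + 3 * k + 10) + ((2 * k * (n * 13 + 10 + 2) + 2) + ((pieces * (28 * n + 30 + 2) + 2) + (3 * n + 10)))) (2 * k + pieces) ?Q s1"
    if "boxed s1" for s1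
    by (rule wp_Seq[OF wp_choose_grid[OF that phase2]]) simp_all
  have phase1c: "wp (choose_box ;; choose_grid ;; bounds_phase ;; piece_phase ;; finish)
      ((n * 3 + 6) + ((2 * grid + 3 * k + 10) + ((2 * k * (n * 13 + 10 + 2) + 2) + ((pieces * (28 * n + 30 + 2) + 2) + (3 * n + 10))))) (2 * k + pieces) ?Q s1"
    if "copied s1" "s1 vmass = mass" for s1
    by (rule wp_Seq[OF wp_choose_box[OF that phase1d]]) simp_all
  have phase1b: "wp (weigh ;; choose_box ;; choose_grid ;; bounds_phase ;; piece_phase ;; finish)
      ((start * 5 + 3) + ((n * 3 + 6) + ((2 * grid + 3 * k + 10) + ((2 * k * (n * 13 + 10 + 2) + 2) + ((pieces * (28 * n + 30 + 2) + 2) + (3 * n + 10)))))) (2 * k + pieces) ?Q s1"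
    if "copied s1" for s1
    by (rule wp_Seq[OF wp_weigh[OF that phase1c]]) simp_all
  have phase1a: "wp (copy_body ;; weigh ;; choose_box ;; choose_grid ;; bounds_phase ;; piece_phase ;; finish)
      ((cells * 3 + 2) + ((start * 5 + 3) + ((n * 3 + 6) + ((2 * grid + 3 * k + 10) + ((2 * k * (n * 13 + 10 + 2) + 2) + ((pieces * (28 * n + 30 + 2) + 2) + (3 * n + 10))))))) (2 * k + pieces) ?Q s1"
    if "header s1" for s1
    by (rule wp_Seq[OF wp_copy_body[OF that phase1b]]) simp_all
  show ?thesis
    unfolding iqp_algorithm_def steps_def
    by (rule wp_Seq[OF wp_load[OF s phase1a]]) simp_all
qed

end

section \<open>Running time and sizes of the linear programs\<close>

context iqp_run
begin

lemma run:
  "\<exists>t Ps s out. exec solve \<epsilon> iqp_algorithm (store (\<lambda>_. 0) 0 (iqp_code I)) t Ps s \<and>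
     holds_at s 0 (outcome_code (\<lambda>z. [z]) out) \<and>
     correct_outcome (approx_solution \<epsilon>) (iqp_objective I) (iqp_feasible I) out \<and>
     t \<le> steps * unit \<and> length Ps \<le> 2 * k + pieces \<and> (\<forall>P\<in>set Ps. admissible P)"
proof -
  have "bounded (store (\<lambda>_. 0) 0 (iqp_code I))"
    unfolding bounded_def
  proof
    fix x
    have "\<bar>store (\<lambda>_. 0) 0 (iqp_code I) x\<bar> \<le> mass"
    proof (cases "0 \<le> x \<and> x < int (length (iqp_code I))")
      case True
      then have "iqp_code I ! nat x \<in> set (iqp_code I)" by (intro nth_mem) linarith
      then show ?thesis using True abs_code by (simp add: store_def)
    next
      case False
      then show ?thesis using mass_nonneg by (auto simp: store_def)
    qed
    then show "\<bar>store (\<lambda>_. 0) 0 (iqp_code I) x\<bar> < 2 ^ bits" using B_ge by (intro box_less) linarith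
  qed
  then show ?thesis
    using wp_iqp_algorithm[OF holds_at_store[of "\<lambda>_. 0" 0 "iqp_code I"]] unfolding wp_def by blast
qed

lemma lpbits_bound: "lpbits + 1 \<le> 10 * \<sigma>\<^sup>2"
proof -
  have "3 * \<sigma> \<le> \<sigma> * \<sigma>" using \<sigma>_ge by (rule mult_right_mono) simp
  moreover have "9 \<le> \<sigma> * \<sigma>" using mult_mono[OF \<sigma>_ge \<sigma>_ge] by simp
  ultimately show ?thesis unfolding lpbits_def power2_eq_square by linarith
qed

lemma lp_bound_le: "lp_bound \<le> 70 * \<sigma> ^ 3"
proof -
  have "lp_bound \<le> (7 * \<sigma>) * (10 * \<sigma>\<^sup>2)"
    unfolding lp_bound_def using \<sigma>_ge lpbits_bound by (intro mult_mono) auto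
  then show ?thesis by (simp add: power2_eq_square power3_eq_cube)
qed

text \<open>With K = \<sigma> + \<open>lpc\<close> there are at most 100 K^2 steps of cost at most
  500000 K^3; K \<ge> 3 absorbs the terms of lower order.\<close>

lemma cost_le: "steps * unit \<le> 10 ^ 8 * (\<sigma> + lpc) ^ 5"
proof -
  define K where "K = \<sigma> + lpc"
  have K3: "3 \<le> K" using \<sigma>_ge by (simp add: K_def)
  have K: "\<sigma> \<le> K" "lpc \<le> K" by (simp_all add: K_def)
  have K2: "3 * K \<le> K * K" "9 \<le> K * K" using mult_mono[OF K3 K3] K3 by simp_all
  have \<sigma>2: "\<sigma>\<^sup>2 \<le> K * K" and \<sigma>3: "\<sigma> ^ 3 \<le> K * (K * K)"
    using power_mono[OF K(1), of 2] power_mono[OF K(1), of 3] by (simp_all add: power2_eq_square power3_eq_cube)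
  have b: "bits + 1 \<le> 12 * (K * K)" using lpbits_bound \<sigma>2 K2 K(2) unfolding bits_def by linarith
  have "(1 + 2 * \<sigma>) * (lpbits + 1) \<le> (3 * K) * (10 * (K * K))"
    using \<sigma>_ge K(1) lpbits_bound \<sigma>2 by (intro mult_mono) linarith+
  then have "unit \<le> 100000 * (12 * (K * K)) + 70 * (K * (K * K)) + (3 * K) * (10 * (K * K))"
    unfolding unit_def using b lp_bound_le \<sigma>3 by (intro add_mono mult_le_mono2) linarith+
  also have "\<dots> = 1200000 * (K * K) + 100 * (K * (K * K))" by simp
  also have "\<dots> \<le> 500000 * (K * (K * K))" using mult_right_mono[OF K3, of "K * K"] by linarith
  finally have unit: "unit \<le> 500000 * (K * (K * K))" .
  have sz: "n \<le> K" "k \<le> K" "cells \<le> K" "start \<le> K"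
    using start_le K(1) by (simp_all add: start_def)
  have cnt: "2 * k \<le> K" "pieces \<le> K" "grid \<le> K" using count grid_le K(2) by linarith+
  have "2 * k * (n * 13 + 10 + 2) \<le> K * (13 * K + 12)" using sz cnt by (intro mult_mono) linarith+
  moreover have "pieces * (28 * n + 30 + 2) \<le> K * (28 * K + 32)" using sz cnt by (intro mult_mono) linarith+
  moreover have "K * (13 * K + 12) = 13 * (K * K) + 12 * K" "K * (28 * K + 32) = 28 * (K * K) + 32 * K"
    by (simp_all add: algebra_simps)
  ultimately have "steps \<le> 100 * (K * K)"
    unfolding steps_def using sz cnt K2 by linarith
  then have "steps * unit \<le> (100 * (K * K)) * (500000 * (K * (K * K)))" using unit by (rule mult_mono) simp_all
  also have "\<dots> = 50000000 * K ^ 5" using power_add[of K 2 3] by (simp add: power2_eq_square power3_eq_cube)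
  finally show ?thesis by (simp add: K_def)
qed

end

theorem theorem2:
  shows "\<exists>(alg :: cmd) (p :: nat poly).
    \<forall>(I :: iqp) (\<epsilon> :: real) (solve :: lp_oracle).
      tu_iqp I \<and> 0 < \<epsilon> \<and> \<epsilon> \<le> 1 \<and> lp_solver solve \<longrightarrow>
      (\<exists>t Ps s out.
         exec solve \<epsilon> alg (store (\<lambda>_. 0) 0 (iqp_code I)) t Ps s \<and>
         holds_at s 0 (outcome_code (\<lambda>z. [z]) out) \<and>
         correct_outcome (approx_solution \<epsilon>) (iqp_objective I) (iqp_feasible I) out \<and>
         length Ps \<le> lp_count (iqp_k I) \<epsilon> \<and>
         t \<le> poly p (iqp_size I + lp_count (iqp_k I) \<epsilon>) \<and>
         (\<forall>P\<in>set Ps.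
            lp_vars P \<le> iqp_vars I \<and>
            lp_ineqs P \<le> iqp_ineqs I \<and>
            totally_unimodular (lp_A P) \<and>
            code_size (lp_code P) \<le> poly p (iqp_size I)))"
proof (rule exI[of _ iqp_algorithm], rule exI[of _ "monom (10 ^ 8) 5"], intro allI impI, elim conjE)
  fix I :: iqp and \<epsilon> :: real and solve :: lp_oracle
  assume "tu_iqp I" "0 < \<epsilon>" "\<epsilon> \<le> 1" "lp_solver solve"
  then interpret iqp_run I \<epsilon> solve by unfold_locales
  obtain t Ps s out where x: "exec solve \<epsilon> iqp_algorithm (store (\<lambda>_. 0) 0 (iqp_code I)) t Ps s"
      "holds_at s 0 (outcome_code (\<lambda>z. [z]) out)"
      "correct_outcome (approx_solution \<epsilon>) (iqp_objective I) (iqp_feasible I) out"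
      "t \<le> steps * unit" "length Ps \<le> 2 * k + pieces" and adm: "\<forall>P\<in>set Ps. admissible P"
    using run by blast
  have len: "length Ps \<le> lpc" using x(5) count by linarith
  have cost: "t \<le> poly (monom (10 ^ 8) 5) (\<sigma> + lpc)" using x(4) cost_le by (simp add: poly_monom)
  \<comment> \<open>One polynomial has to bound both the running time in \<sigma> +
    \<open>lpc\<close> and the LP size in \<sigma> alone; the latter is at most 70
    \<sigma>^3.\<close>
  have "\<sigma> ^ 3 \<le> \<sigma> ^ 5" using \<sigma>_ge by (intro power_increasing) auto
  then have "lp_bound \<le> poly (monom (10 ^ 8) 5) \<sigma>" using lp_bound_le by (simp add: poly_monom)
  then have lps: "lp_vars P \<le> n \<and> lp_ineqs P \<le> m \<and> totally_unimodular (lp_A P) \<and>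
      code_size (lp_code P) \<le> poly (monom (10 ^ 8) 5) \<sigma>" if "P \<in> set Ps" for P
    using bspec[OF adm that] dims(5-7) by (simp add: admissible_def lp_vars_def lp_ineqs_def)
  show "\<exists>t Ps s out.
         exec solve \<epsilon> iqp_algorithm (store (\<lambda>_. 0) 0 (iqp_code I)) t Ps s \<and>
         holds_at s 0 (outcome_code (\<lambda>z. [z]) out) \<and>
         correct_outcome (approx_solution \<epsilon>) (iqp_objective I) (iqp_feasible I) out \<and>
         length Ps \<le> lpc \<and> t \<le> poly (monom (10 ^ 8) 5) (\<sigma> + lpc) \<and>
         (\<forall>P\<in>set Ps. lp_vars P \<le> n \<and> lp_ineqs P \<le> m \<and> totally_unimodular (lp_A P) \<and>
            code_size (lp_code P) \<le> poly (monom (10 ^ 8) 5) \<sigma>)"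
    using x(1-3) len cost lps by blast
qed

end
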